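(* Let $G$ be a discrete group acting by homeomorphisms on compact Hausdorff spaces $X$ and $Y$, and let $\mu$ and $\nu$ be $G$-invariant regular Borel probability measures on $X$ and $Y$, respectively. Consider the diagonal action of $G$ on $X\times Y$ and the product measure $\mu\times\nu$. Then for all $k\ge1$ we have $$\mathrm{IN}^{\mu\times\nu}_k(X\times Y)=\mathrm{IN}^\mu_k(X)\times\mathrm{IN}^\nu_k(Y),$$ under the identification $(X\times Y)^k=X^k\times Y^k$.
   Context: $G$ is not assumed amenable. When $X$ or $Y$ is nonmetrizable, $\mu\times\nu$ denotes the regular Borel probability measure on $X\times Y$ determined by the product measure. $\mu$-IN-tuples. Let $\mathscr B'(\mu,\delta)$ be the set of maps $D$ from $G$ to the Borel subsets of $X$, $s\mapsto D_s$, with $\inf_{s\in G}\mu(D_s)\ge1-\delta$. For a tuple $\boldsymbol A=(A_1,\dots,A_k)$ of subsets of $X$, $J\subseteq G$ is an independence set for $\boldsymbol A$ relative to $D$ if $\bigcap_{s\in F}(D_s\cap s^{-1}A_{\sigma(s)})\ne\emptyset$ for every nonempty finite $F\subseteq J$ and every $\sigma:F\to\{1,\dots,k\}$. $\boldsymbol A$ has positive sequential $\mu$-independence density if there are $\delta>0$ and $c>0$ such that for every $M>0$ there is a finite $F\subseteq G$ with $|F|\ge M$ such that for every $D\in\mathscr B'(\mu,\delta)$ there is an independence set $I\subseteq F$ for $\boldsymbol A$ relative to $D$ with $|I|\ge c|F|$. $(x_1,\dots,x_k)\in X^k$ is a $\mu$-IN-tuple if for every product neighbourhood $U_1\times\cdots\times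 U_k$ of it, $(U_1,\dots,U_k)$ has positive sequential $\mu$-independence density. $\mathrm{IN}^\mu_k(X)$ is the set of $\mu$-IN-tuples of length $k$. The same definitions apply to $(Y,\nu)$ and $(X\times Y,\mu\times\nu)$. *)

theory Defs
  imports "HOL-Probability.Probability" "HOL-Algebra.Group_Action"
begin

text \<open>
  A compact Hausdorff space is a type of class \<open>t2_space\<close> whose universe is compact.
  A tuple of length \<open>k\<close> is a list of length \<open>k\<close>, indexed by \<open>0, \<dots>, k - 1\<close>.
\<close>

definition acts_by_homeomorphisms ::
    "('g, 'm) monoid_scheme \<Rightarrow> ('g \<Rightarrow> 'x::topological_space \<Rightarrow> 'x) \<Rightarrow> bool" where
  "acts_by_homeomorphisms G \<phi> \<longleftrightarrow>
     group_action G UNIV \<phi> \<and> (\<forall>s\<in>carrier G. \<exists>h. homeomorphism UNIV UNIV (\<phi> s) h)"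

definition regular_borel_prob :: "'x::topological_space measure \<Rightarrow> bool" where
  "regular_borel_prob \<mu> \<longleftrightarrow>
     prob_space \<mu> \<and> sets \<mu> = sets borel \<and>
     (\<forall>A\<in>sets borel. emeasure \<mu> A = (SUP K\<in>{K. K \<subseteq> A \<and> compact K}. emeasure \<mu> K)) \<and>
     (\<forall>A\<in>sets borel. emeasure \<mu> A = (INF U\<in>{U. A \<subseteq> U \<and> open U}. emeasure \<mu> U))"

definition invariant_measure ::
    "('g, 'm) monoid_scheme \<Rightarrow> ('g \<Rightarrow> 'x::topological_space \<Rightarrow> 'x) \<Rightarrow> 'x measure \<Rightarrow> bool" where
  "invariant_measure G \<phi> \<mu> \<longleftrightarrow>
     (\<forall>s\<in>carrier G. \<forall>A\<in>sets borel. emeasure \<mu> (\<phi> s ` A) = emeasure \<mu> A)"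

text \<open>
  The library's \<open>\<mu> \<Otimes>\<^sub>M \<nu>\<close> lives on the product sigma-algebra, which can be strictly
  smaller than the Borel sigma-algebra of the product space when the factors are not
  metrizable. For regular Borel probability measures on compact Hausdorff spaces it has
  exactly one regular Borel extension, and that extension is meant by \<open>\<mu> \<times> \<nu>\<close>.
\<close>

definition regular_product ::
    "'x::topological_space measure \<Rightarrow> 'y::topological_space measure \<Rightarrow> ('x \<times> 'y) measure" where
  "regular_product \<mu> \<nu> =
     (THE \<rho>. regular_borel_prob \<rho> \<and>
        (\<forall>E\<in>sets (\<mu> \<Otimes>\<^sub>M \<nu>). emeasure \<rho> E = emeasure (\<mu> \<Otimes>\<^sub>M \<nu>) E))"

definition diagonal_action ::
    "('g \<Rightarrow> 'x \<Rightarrow> 'x) \<Rightarrow> ('g \<Rightarrow> 'y \<Rightarrow> 'y) \<Rightarrow> 'g \<Rightarrow> 'x \<times> 'y \<Rightarrow> 'x \<times> 'y" where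
  "diagonal_action \<phi> \<psi> s = map_prod (\<phi> s) (\<psi> s)"

text \<open>The set \<open>\<B>'(\<mu>, \<delta>)\<close>.\<close>

definition large_borel_maps ::
    "('g, 'm) monoid_scheme \<Rightarrow> 'x::topological_space measure \<Rightarrow> real \<Rightarrow> ('g \<Rightarrow> 'x set) set" where
  "large_borel_maps G \<mu> \<delta> =
     {D \<in> carrier G \<rightarrow> sets borel. (INF s\<in>carrier G. measure \<mu> (D s)) \<ge> 1 - \<delta>}"

definition independence_set ::
    "('g, 'm) monoid_scheme \<Rightarrow> ('g \<Rightarrow> 'x \<Rightarrow> 'x) \<Rightarrow> 'x set list \<Rightarrow> ('g \<Rightarrow> 'x set) \<Rightarrow> 'g set \<Rightarrow> bool" where
  "independence_set G \<phi> A D J \<longleftrightarrow>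
     J \<subseteq> carrier G \<and>
     (\<forall>F \<sigma>. finite F \<and> F \<noteq> {} \<and> F \<subseteq> J \<and> \<sigma> \<in> F \<rightarrow> {..<length A} \<longrightarrow>
        (\<Inter>s\<in>F. D s \<inter> \<phi> (inv\<^bsub>G\<^esub> s) ` (A ! \<sigma> s)) \<noteq> {})"

definition positive_sequential_independence_density ::
    "('g, 'm) monoid_scheme \<Rightarrow> ('g \<Rightarrow> 'x::topological_space \<Rightarrow> 'x) \<Rightarrow> 'x measure \<Rightarrow> 'x set list \<Rightarrow> bool" where
  "positive_sequential_independence_density G \<phi> \<mu> A \<longleftrightarrow>
     (\<exists>\<delta>>0. \<exists>c>0. \<forall>M>0. \<exists>F. F \<subseteq> carrier G \<and> finite F \<and> real (card F) \<ge> M \<and>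
        (\<forall>D\<in>large_borel_maps G \<mu> \<delta>. \<exists>I\<subseteq>F.
           independence_set G \<phi> A D I \<and> real (card I) \<ge> c * real (card F)))"

definition IN_tuples ::
    "('g, 'm) monoid_scheme \<Rightarrow> ('g \<Rightarrow> 'x::topological_space \<Rightarrow> 'x) \<Rightarrow> 'x measure \<Rightarrow> nat \<Rightarrow> 'x list set" where
  "IN_tuples G \<phi> \<mu> k =
     {xs. length xs = k \<and>
        (\<forall>Us. length Us = k \<and> (\<forall>i<k. xs ! i \<in> interior (Us ! i)) \<longrightarrow>
           positive_sequential_independence_density G \<phi> \<mu> Us)}"

text \<open>The identification of \<open>(X \<times> Y)\<^sup>k\<close> with \<open>X\<^sup>k \<times> Y\<^sup>k\<close>.\<close>

definition split_tuple :: "('x \<times> 'y) list \<Rightarrow> 'x list \<times> 'y list" where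
  "split_tuple zs = (map fst zs, map snd zs)"

end

theory Submission
  imports Defs
begin

text \<open>
  For a measure-preserving action of \<open>G\<close>, call an integrable function almost periodic if its
  orbit is totally bounded in \<open>L\<^sup>1\<close>. These are exactly the integrable functions that are
  measurable for one sub-sigma-algebra (\<open>ap_iff_ap_algebra\<close>). Given Borel sets \<open>U\<^sub>0, \<dots>, U\<^sub>k\<^sub>-\<^sub>1\<close>, let
  \<open>f\<^sub>i\<close> be the conditional expectation of the indicator of \<open>U\<^sub>i\<close> on that sigma-algebra. The proof
  compares independence density of the tuple with the statement that \<open>f\<^sub>0, \<dots>, f\<^sub>k\<^sub>-\<^sub>1\<close> are
  simultaneously positive on a set of positive measure (\<^emph>\<open>overlap\<close>).

  Density implies overlap (\<open>independence_density_imp_overlap\<close>). The set \<open>C\<^sub>i = {f\<^sub>i > 0}\<close> contains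
  \<open>U\<^sub>i\<close> up to a null set and is almost periodic. So \<open>G\<close> can be coloured with finitely many
  colours such that elements of one colour move each \<open>C\<^sub>i\<close> almost alike. Let \<open>D\<^sub>s\<close> delete the
  points where \<open>s\<^sup>-\<^sup>1C\<^sub>i\<close> differs from the translate by a representative of the colour of \<open>s\<close>. If
  the \<open>C\<^sub>i\<close> have null intersection, then \<open>k\<close> elements of one colour, carrying the \<open>k\<close>
  different labels, would meet inside that null intersection. Hence independence sets have
  bounded size, against positive density.

  Overlap in both factors implies density for the product (\<open>independence_density_Times\<close>). The
  function \<open>1\<^sub>U - f\<close> is orthogonal to all almost periodic functions, and on such functions the
  action is weakly mixing (\<open>weak_mixing\<close>). Hence there are elements \<open>s\<^sub>1, \<dots>, s\<^sub>n\<close> along which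
  the labels \<open>{i. s\<^sub>jx \<in> U\<^sub>i}\<close> behave, given the almost periodic information at \<open>x\<close>, almost like
  independent random letters that contain \<open>i\<close> with probability \<open>f\<^sub>i(x)\<close>
  (\<open>independent_translates\<close>). The same elements serve for \<open>X\<close> and for \<open>Y\<close> when they are chosen in
  the product system, because functions orthogonal to the almost periodic ones stay so after
  lifting to the product (\<open>orth_lift_fst\<close>, \<open>orth_lift_snd\<close>). At \<open>(x, y)\<close> the common labels
  then contain \<open>i\<close> with probability \<open>f\<^sub>i(x) g\<^sub>i(y)\<close>, which is bounded below on a rectangle of
  positive measure. A Sauer--Shelah type estimate (\<open>unshattered_weight_le\<close>) says that a family of
  words which realises all labellings on no set of \<open>cn\<close> positions is exponentially improbable,
  even if a few positions of every word may be discarded. Discarding positions is what passing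
  from \<open>X \<times> Y\<close> to the sets \<open>D\<^sub>s\<close> does, so some independence set has at least \<open>cn\<close> elements.

  Together these show that a tuple with \<open>IN\<close>-tuples as projections is an \<open>IN\<close>-tuple; density makes
  \<open>G\<close> infinite, which weak mixing uses to supply distinct elements. The converse inclusion holds because the coordinate projections are factor maps
  (\<open>IN_tuples_factor\<close>). The measure on \<open>X \<times> Y\<close> enters as a Borel probability
  measure that extends the product measure (\<open>regular_product_extends\<close>).
\<close>

section \<open>The regular product measure\<close>

lemma closed_nbhd_in_open:
  fixes p :: "'a::t2_space"
  assumes comp: "compact (UNIV :: 'a set)" and "open E" "p \<in> E"
  obtains W where "open W" "p \<in> W" "closure W \<subseteq> E"
proof -
  have "regular_space (euclidean :: 'a topology)"
    using comp by (intro compact_Hausdorff_imp_regular_space)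
      (auto simp: compact_space_def Hausdorff_space_def disjnt_def intro: hausdorff[simplified])
  then obtain U V where UV: "open U" "open V" "p \<in> U" "- E \<subseteq> V" "U \<inter> V = {}"
    using assms(2,3)
    by (auto simp: regular_space_def disjnt_def closed_closedin[symmetric] dest!: spec[of _ "- E"] bspec[of _ _ p])
  have "closure U \<subseteq> - V"
    using UV by (intro closure_minimal) auto
  then show ?thesis using UV by (intro that[of U]) auto
qed

text \<open>
  Finite unions of open rectangles are measurable for the product sigma-algebra. This makes them
  the link between a Borel measure on the product space and its values on that sigma-algebra.
\<close>
lemma compact_cover_by_rectangles:
  fixes E K :: "('a::t2_space \<times> 'b::t2_space) set"
  assumes compX: "compact (UNIV :: 'a set)" and compY: "compact (UNIV :: 'b set)"
    and E: "open E" and K: "compact K" "K \<subseteq> E"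
  obtains R where "open R" "R \<in> sets (borel \<Otimes>\<^sub>M borel)" "K \<subseteq> R" "closure R \<subseteq> E"
proof -
  have comp: "compact (UNIV :: ('a \<times> 'b) set)"
    using compact_Times[OF compX compY] by simp
  define Q where "Q = {A \<times> B | A B. open (A::'a set) \<and> open (B::'b set) \<and> closure (A \<times> B) \<subseteq> E}"
  have "K \<subseteq> \<Union>Q"
  proof
    fix p assume "p \<in> K"
    then have "p \<in> E" using K by auto
    obtain W where W: "open W" "p \<in> W" "closure W \<subseteq> E"
      by (rule closed_nbhd_in_open[OF comp E \<open>p \<in> E\<close>])
    obtain A B where "open A" "open B" "p \<in> A \<times> B" "A \<times> B \<subseteq> W"
      by (rule open_prod_elim[OF W(1,2)])
    then show "p \<in> \<Union>Q"
      using W closure_mono[of "A \<times> B" W] unfolding Q_def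
      by (intro UnionI[of "A \<times> B"] CollectI exI[of _ A] exI[of _ B] conjI) simp_all
  qed
  moreover have "\<forall>T\<in>Q. open T" by (auto simp: Q_def open_Times)
  ultimately obtain F where F: "F \<subseteq> Q" "finite F" "K \<subseteq> \<Union>F"
    using K(1) by (meson compactE)
  show thesis
  proof
    show "open (\<Union>F)" using F \<open>\<forall>T\<in>Q. open T\<close> by auto
    show "\<Union>F \<in> sets (borel \<Otimes>\<^sub>M borel)"
      using F by (intro sets.finite_Union) (auto simp: Q_def)
    show "K \<subseteq> \<Union>F" by fact
    have "closed (\<Union>(closure ` F))" using F(2) by (intro closed_Union) auto
    moreover have "\<Union>F \<subseteq> \<Union>(closure ` F)" using closure_subset by fast
    ultimately have "closure (\<Union>F) \<subseteq> \<Union>(closure ` F)" by (intro closure_minimal)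
    also have "\<dots> \<subseteq> E" using F(1) by (auto simp: Q_def)
    finally show "closure (\<Union>F) \<subseteq> E" .
  qed
qed

lemma borel_prod_subset:
  "sets (borel \<Otimes>\<^sub>M borel) \<subseteq> sets (borel :: ('a::topological_space \<times> 'b::topological_space) measure)"
proof -
  have f: "fst \<in> borel_measurable (borel :: ('a \<times> 'b) measure)"
    and s: "snd \<in> borel_measurable (borel :: ('a \<times> 'b) measure)"
    by (auto intro!: borel_measurable_continuous_onI continuous_intros)
  have "(\<lambda>p. p) \<in> (borel :: ('a \<times> 'b) measure) \<rightarrow>\<^sub>M borel \<Otimes>\<^sub>M borel"
    using f s measurable_Pair[OF f s] by simp
  then show ?thesis
    by (auto dest: measurable_sets)
qed

text \<open>
  A compact subset of an open set \<open>E\<close> fits inside a finite union of rectangles inside \<open>E\<close>, so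
  inner regularity lets the values on such unions determine the measure of \<open>E\<close>; outer regularity
  does the rest.
\<close>
lemma regular_borel_prob_unique:
  fixes \<rho> \<tau> :: "('a::t2_space \<times> 'b::t2_space) measure"
  assumes compX: "compact (UNIV :: 'a set)" and compY: "compact (UNIV :: 'b set)"
    and \<rho>: "regular_borel_prob \<rho>" and \<tau>: "regular_borel_prob \<tau>"
    and eq: "\<And>E. E \<in> sets (borel \<Otimes>\<^sub>M borel) \<Longrightarrow> emeasure \<rho> E = emeasure \<tau> E"
  shows "\<rho> = \<tau>"
proof -
  have le: "emeasure \<rho>1 E \<le> emeasure \<rho>2 E"
    if r1: "regular_borel_prob \<rho>1" and r2: "regular_borel_prob \<rho>2" and "open E"
      and eq: "\<And>E. E \<in> sets (borel \<Otimes>\<^sub>M borel) \<Longrightarrow> emeasure \<rho>1 E = emeasure \<rho>2 E"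
    for \<rho>1 \<rho>2 :: "('a \<times> 'b) measure" and E
  proof -
    have s1: "sets \<rho>1 = sets borel" "sets \<rho>2 = sets borel"
      using r1 r2 by (auto simp: regular_borel_prob_def)
    have "emeasure \<rho>1 E = (SUP K\<in>{K. K \<subseteq> E \<and> compact K}. emeasure \<rho>1 K)"
      using r1 \<open>open E\<close> by (auto simp: regular_borel_prob_def)
    also have "\<dots> \<le> emeasure \<rho>2 E"
    proof (rule SUP_least, clarify)
      fix K assume K: "K \<subseteq> E" "compact K"
      obtain R where R: "open R" "R \<in> sets (borel \<Otimes>\<^sub>M borel)" "K \<subseteq> R" "closure R \<subseteq> E"
        by (rule compact_cover_by_rectangles[OF compX compY \<open>open E\<close> K(2,1)])
      have "emeasure \<rho>1 K \<le> emeasure \<rho>1 R"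
        using R s1 by (intro emeasure_mono) auto
      also have "\<dots> = emeasure \<rho>2 R" using eq R by auto
      also have "\<dots> \<le> emeasure \<rho>2 E"
        using R s1 \<open>open E\<close> closure_subset[of R] by (intro emeasure_mono) auto
      finally show "emeasure \<rho>1 K \<le> emeasure \<rho>2 E" .
    qed
    finally show ?thesis .
  qed
  have op: "emeasure \<rho> U = emeasure \<tau> U" if "open U" for U
    using le[OF \<rho> \<tau> that eq] le[OF \<tau> \<rho> that eq[symmetric]] by (rule antisym)
  show ?thesis
  proof (rule measure_eqI)
    show "sets \<rho> = sets \<tau>" using \<rho> \<tau> by (auto simp: regular_borel_prob_def)
    fix A assume "A \<in> sets \<rho>"
    then have A: "A \<in> sets borel" using \<rho> by (auto simp: regular_borel_prob_def)
    have "emeasure \<rho> A = (INF U\<in>{U. A \<subseteq> U \<and> open U}. emeasure \<rho> U)"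
      using \<rho> A by (auto simp: regular_borel_prob_def)
    also have "\<dots> = (INF U\<in>{U. A \<subseteq> U \<and> open U}. emeasure \<tau> U)"
      by (intro INF_cong) (auto simp: op)
    also have "\<dots> = emeasure \<tau> A"
      using \<tau> A by (auto simp: regular_borel_prob_def)
    finally show "emeasure \<rho> A = emeasure \<tau> A" .
  qed
qed

text \<open>
  The sets that can be approximated by a closed set from inside and an open set from outside form a
  sigma-algebra, so it suffices to approximate open sets from inside.
\<close>
lemma regular_borel_probI:
  fixes \<rho> :: "'a::t2_space measure"
  assumes comp: "compact (UNIV :: 'a set)" and p: "prob_space \<rho>" and s: "sets \<rho> = sets borel"
    and op: "\<And>E e. open E \<Longrightarrow> e > 0 \<Longrightarrow> \<exists>C. closed C \<and> C \<subseteq> E \<and> measure \<rho> (E - C) < e"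
  shows "regular_borel_prob \<rho>"
proof -
  interpret prob_space \<rho> by fact
  have sp: "space \<rho> = UNIV" using sets_eq_imp_space_eq[OF s] by simp
  have appr: "\<forall>e>0. \<exists>C U. closed C \<and> open U \<and> C \<subseteq> A \<and> A \<subseteq> U \<and> measure \<rho> (U - C) < e"
    if "A \<in> sets borel" for A
  proof -
    have "A \<in> sigma_sets UNIV {S. open S}" using that by (simp add: borel_def)
    then show ?thesis
    proof induction
      case (Basic A)
      show ?case
      proof (intro allI impI)
        fix e :: real assume "e > 0"
        then obtain C where "closed C" "C \<subseteq> A" "measure \<rho> (A - C) < e"
          using op[of A e] Basic by auto
        then show "\<exists>C U. closed C \<and> open U \<and> C \<subseteq> A \<and> A \<subseteq> U \<and> measure \<rho> (U - C) < e"
          using Basic by (intro exI[of _ C] exI[of _ A]) simp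
      qed
    next
      case Empty show ?case by (auto intro!: exI[of _ "{}"])
    next
      case (Compl A)
      show ?case
      proof (intro allI impI)
        fix e :: real assume "e > 0"
        then obtain C U where CU: "closed C" "open U" "C \<subseteq> A" "A \<subseteq> U" "measure \<rho> (U - C) < e"
          using Compl.IH[rule_format, OF \<open>e > 0\<close>] by metis
        have "- C - - U = U - C" by auto
        then show "\<exists>C U. closed C \<and> open U \<and> C \<subseteq> UNIV - A \<and> UNIV - A \<subseteq> U \<and> measure \<rho> (U - C) < e"
          using CU by (intro exI[of _ "- U"] exI[of _ "- C"] conjI) (simp_all, blast+)
      qed
    next
      case (Union A)
      show ?case
      proof (intro allI impI)
        fix e :: real assume e: "e > 0"
        have "\<exists>C U. closed C \<and> open U \<and> C \<subseteq> A i \<and> A i \<subseteq> U \<and> measure \<rho> (U - C) < e/2 * (1/2)^Suc i" for i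
          using e by (intro Union.IH[rule_format]) simp
        then obtain C U where CU: "\<And>i. closed (C i)" "\<And>i. open (U i)" "\<And>i. C i \<subseteq> A i" "\<And>i. A i \<subseteq> U i"
            "\<And>i. measure \<rho> (U i - C i) < e/2 * (1/2)^Suc i"
          by metis
        have CUs: "C i \<in> sets \<rho>" "U i \<in> sets \<rho>" for i using CU s by auto
        let ?V = "\<Union>i. U i" and ?C = "\<Union>i. C i"
        have sm: "summable (\<lambda>i. e/2 * (1/2::real)^Suc i)" "(\<Sum>i. e/2 * (1/2::real)^Suc i) = e/2"
          using sums_mult[OF power_half_series, of "e/2"] by (auto simp: sums_iff)
        have sm': "summable (\<lambda>i. measure \<rho> (U i - C i))"
          by (rule summable_comparison_test'[OF sm(1), of 0]) (use CU(5) in \<open>simp add: less_imp_le\<close>)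
        have "measure \<rho> (?V - ?C) \<le> measure \<rho> (\<Union>i. U i - C i)"
          using CUs by (intro finite_measure_mono) auto
        also have "\<dots> \<le> (\<Sum>i. measure \<rho> (U i - C i))"
          using CUs by (intro finite_measure_subadditive_countably sm') auto
        also have "\<dots> \<le> (\<Sum>i. e/2 * (1/2)^Suc i)"
          by (intro suminf_le sm' sm(1) less_imp_le CU(5))
        finally have 1: "measure \<rho> (?V - ?C) \<le> e/2" using sm by simp
        have "(\<lambda>n. measure \<rho> (\<Union>i\<le>n. C i)) \<longlonglongrightarrow> measure \<rho> (\<Union>n. \<Union>i\<le>n. C i)"
          using CUs by (intro finite_Lim_measure_incseq) (auto simp: incseq_def intro: order_trans)
        then have "(\<lambda>n. measure \<rho> (\<Union>i\<le>n. C i)) \<longlonglongrightarrow> measure \<rho> ?C"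
          by (rule back_subst[where P="\<lambda>S. (\<lambda>n. measure \<rho> (\<Union>i\<le>n. C i)) \<longlonglongrightarrow> measure \<rho> S"]) auto
        then have "\<forall>\<^sub>F n in sequentially. measure \<rho> (\<Union>i\<le>n. C i) > measure \<rho> ?C - e/2"
          using e by (intro order_tendstoD) auto
        then obtain n where n: "measure \<rho> (\<Union>i\<le>n. C i) > measure \<rho> ?C - e/2"
          by (auto simp: eventually_sequentially)
        let ?D = "\<Union>i\<le>n. C i"
        have DV: "?C \<subseteq> ?V" "?D \<subseteq> ?C" "?D \<subseteq> ?V" using CU(3,4) by blast+
        have "measure \<rho> (?V - ?D) = measure \<rho> ?V - measure \<rho> ?D"
          using CUs DV by (intro finite_measure_Diff) auto
        moreover have "measure \<rho> (?V - ?C) = measure \<rho> ?V - measure \<rho> ?C"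
          using CUs DV by (intro finite_measure_Diff) auto
        ultimately have 2: "measure \<rho> (?V - ?D) < e" using 1 n by linarith
        have cD: "closed ?D" by (intro closed_UN ballI CU(1)) simp
        have oV: "open ?V" by (intro open_UN ballI CU(2))
        have DA: "?D \<subseteq> \<Union>(range A)" "\<Union>(range A) \<subseteq> ?V" using CU(3,4) by blast+
        show "\<exists>C V. closed C \<and> open V \<and> C \<subseteq> \<Union>(range A) \<and> \<Union>(range A) \<subseteq> V \<and> measure \<rho> (V - C) < e"
          by (intro exI[of _ ?D] exI[of _ ?V] conjI cD oV DA 2)
      qed
    qed
  qed
  have oe: "U \<in> events" if "open U" for U using that s by simp
  have ce: "C \<in> events" if "closed C" for C using that s by simp
  have diff: "prob U \<le> prob C + prob (U - C)" if "C \<in> events" "U \<in> events" for U C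
  proof -
    have "prob U \<le> prob (C \<union> (U - C))" using that by (intro finite_measure_mono) simp_all
    also have "\<dots> \<le> prob C + prob (U - C)" using that by (intro measure_Un_le) simp_all
    finally show ?thesis .
  qed
  have inner: "emeasure \<rho> A = (SUP K\<in>{K. K \<subseteq> A \<and> compact K}. emeasure \<rho> K)"
    if A: "A \<in> sets borel" for A
  proof (rule antisym)
    show "emeasure \<rho> A \<le> (SUP K\<in>{K. K \<subseteq> A \<and> compact K}. emeasure \<rho> K)"
    proof (rule ennreal_le_epsilon)
      fix e :: real assume "e > 0"
      then obtain C U where CU: "closed C" "open U" "C \<subseteq> A" "A \<subseteq> U" "measure \<rho> (U - C) < e"
        using appr[OF A, rule_format, OF \<open>e > 0\<close>] by metis
      have "measure \<rho> A \<le> measure \<rho> C + e"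
        using diff[OF ce oe, OF CU(1,2)] CU(5) finite_measure_mono[OF CU(4) oe[OF CU(2)]] by linarith
      then have "emeasure \<rho> A \<le> emeasure \<rho> C + ennreal e"
        using \<open>e > 0\<close> by (simp add: emeasure_eq_measure flip: ennreal_plus)
      also have "\<dots> \<le> (SUP K\<in>{K. K \<subseteq> A \<and> compact K}. emeasure \<rho> K) + ennreal e"
        using CU(3) compact_Int_closed[OF comp CU(1)] by (intro add_right_mono SUP_upper) simp
      finally show "emeasure \<rho> A \<le> (SUP K\<in>{K. K \<subseteq> A \<and> compact K}. emeasure \<rho> K) + ennreal e" .
    qed
  qed (use A s in \<open>auto intro!: SUP_least emeasure_mono\<close>)
  have outer: "emeasure \<rho> A = (INF U\<in>{U. A \<subseteq> U \<and> open U}. emeasure \<rho> U)"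
    if A: "A \<in> sets borel" for A
  proof (rule antisym)
    show "(INF U\<in>{U. A \<subseteq> U \<and> open U}. emeasure \<rho> U) \<le> emeasure \<rho> A"
    proof (rule ennreal_le_epsilon)
      fix e :: real assume "e > 0"
      then obtain C U where CU: "closed C" "open U" "C \<subseteq> A" "A \<subseteq> U" "measure \<rho> (U - C) < e"
        using appr[OF A, rule_format, OF \<open>e > 0\<close>] by metis
      have "measure \<rho> U \<le> measure \<rho> A + e"
        using diff[OF ce oe, OF CU(1,2)] CU(5) finite_measure_mono[OF CU(3)] A s by fastforce
      then have "emeasure \<rho> U \<le> emeasure \<rho> A + ennreal e"
        using \<open>e > 0\<close> by (simp add: emeasure_eq_measure flip: ennreal_plus)
      then show "(INF U\<in>{U. A \<subseteq> U \<and> open U}. emeasure \<rho> U) \<le> emeasure \<rho> A + ennreal e"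
        using CU(2,4) by (intro INF_lower2[of U]) simp_all
    qed
  qed (use A s in \<open>auto intro!: INF_greatest emeasure_mono\<close>)
  show ?thesis unfolding regular_borel_prob_def
    using inner outer p s by auto
qed


text \<open>
  The candidate for the regular product integrates the measures of the vertical sections. It is
  defined on all Borel sets of the product space, not only on the product sigma-algebra.
\<close>
definition section_measure ::
  "'x::topological_space measure \<Rightarrow> 'y::topological_space measure \<Rightarrow> ('x \<times> 'y) measure" where
  "section_measure \<mu> \<nu> = \<mu> \<bind> (\<lambda>x. distr \<nu> borel (Pair x))"

lemma borel_measurable_Pair:
  fixes x :: "'x::topological_space"
  assumes "sets \<nu> = sets (borel :: 'y::topological_space measure)"
  shows "Pair x \<in> \<nu> \<rightarrow>\<^sub>M (borel :: ('x \<times> 'y) measure)"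
  unfolding measurable_cong_sets[OF assms refl]
  by (intro borel_measurable_continuous_onI continuous_intros)

text \<open>
  Inner regularity of \<open>\<nu>\<close> and the tube lemma make the measure of the sections of an open set lower
  semicontinuous; in particular it is measurable.
\<close>
lemma open_superlevel_sections:
  assumes \<nu>: "regular_borel_prob \<nu>" and E: "open (E :: ('x::topological_space \<times> 'y::topological_space) set)"
  shows "open {x. t < emeasure \<nu> (Pair x -` E)}"
proof (subst open_subopen, clarify)
  fix x assume x: "t < emeasure \<nu> (Pair x -` E)"
  have op: "open (Pair x' -` E)" for x'
    using E by (intro open_vimage continuous_intros)
  then have b: "Pair x' -` E \<in> sets borel" for x' by auto
  have "t < (SUP K\<in>{K. K \<subseteq> Pair x -` E \<and> compact K}. emeasure \<nu> K)"
    using x \<nu> b[of x] by (auto simp: regular_borel_prob_def)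
  then obtain K where K: "K \<subseteq> Pair x -` E" "compact K" "t < emeasure \<nu> K"
    unfolding less_SUP_iff by auto
  then have "{x} \<times> K \<subseteq> E" by auto
  then obtain X0 where X0: "x \<in> X0" "open X0" "X0 \<times> K \<subseteq> E"
    using Elementary_Topology.tube_lemma[OF K(2) E] by blast
  have "X0 \<subseteq> {x. t < emeasure \<nu> (Pair x -` E)}"
  proof
    fix x' assume "x' \<in> X0"
    then have "K \<subseteq> Pair x' -` E" using X0 by auto
    then have "emeasure \<nu> K \<le> emeasure \<nu> (Pair x' -` E)"
      using b \<nu> by (intro emeasure_mono) (auto simp: regular_borel_prob_def)
    then show "x' \<in> {x. t < emeasure \<nu> (Pair x -` E)}" using K(3) by auto
  qed
  then show "\<exists>T. open T \<and> x \<in> T \<and> T \<subseteq> {x. t < emeasure \<nu> (Pair x -` E)}"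
    using X0 by blast
qed

lemma section_kernel_measurable:
  fixes \<mu> :: "'x::topological_space measure" and \<nu> :: "'y::topological_space measure"
  assumes \<nu>: "regular_borel_prob \<nu>" and \<mu>: "sets \<mu> = sets borel"
  shows "(\<lambda>x. distr \<nu> borel (Pair x)) \<in> \<mu> \<rightarrow>\<^sub>M prob_algebra (borel :: ('x \<times> 'y) measure)"
proof (rule measurable_prob_algebra_generated[where \<Omega>=UNIV and G="{S. open S}"])
  have s: "sets \<nu> = sets borel" and p: "prob_space \<nu>" using \<nu> by (auto simp: regular_borel_prob_def)
  have sp: "space \<mu> = UNIV" "space \<nu> = UNIV"
    using sets_eq_imp_space_eq[OF \<mu>] sets_eq_imp_space_eq[OF s] by auto
  show "sets (borel :: ('x \<times> 'y) measure) = sigma_sets UNIV {S. open S}" by (simp add: borel_def)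
  show "Int_stable {S :: ('x \<times> 'y) set. open S}" by (auto simp: Int_stable_def)
  show "prob_space (distr \<nu> borel (Pair a))" for a :: 'x
    by (intro prob_space.prob_space_distr[OF p] borel_measurable_Pair s)
  fix A :: "('x \<times> 'y) set" assume "A \<in> {S. open S}"
  then have "open A" by simp
  have "(\<lambda>a. emeasure (distr \<nu> borel (Pair a)) A) = (\<lambda>a. emeasure \<nu> (Pair a -` A))"
    using \<open>open A\<close> sp by (auto simp: emeasure_distr[OF borel_measurable_Pair[OF s]])
  moreover have "(\<lambda>a. emeasure \<nu> (Pair a -` A)) \<in> borel_measurable \<mu>"
    using open_superlevel_sections[OF \<nu> \<open>open A\<close>] sp \<mu>
    by (intro borel_measurableI_greater) auto
  ultimately show "(\<lambda>a. emeasure (distr \<nu> borel (Pair a)) A) \<in> borel_measurable \<mu>" by simp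
qed auto

lemma emeasure_section_measure:
  fixes \<mu> :: "'x::topological_space measure" and \<nu> :: "'y::topological_space measure"
  assumes \<nu>: "regular_borel_prob \<nu>" and \<mu>: "regular_borel_prob \<mu>" and E: "E \<in> sets borel"
  shows "emeasure (section_measure \<mu> \<nu>) E = (\<integral>\<^sup>+x. emeasure \<nu> (Pair x -` E) \<partial>\<mu>)"
    and "(\<lambda>x. emeasure \<nu> (Pair x -` E)) \<in> borel_measurable \<mu>"
proof -
  have s: "sets \<nu> = sets borel" "sets \<mu> = sets borel"
    using \<nu> \<mu> by (auto simp: regular_borel_prob_def)
  have sp: "space \<mu> = UNIV" "space \<nu> = UNIV"
    using s[THEN sets_eq_imp_space_eq] by auto
  note k = section_kernel_measurable[OF \<nu> s(2)]
  have eq: "emeasure (distr \<nu> borel (Pair x)) E = emeasure \<nu> (Pair x -` E)" for x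
    using E sp by (simp add: emeasure_distr[OF borel_measurable_Pair[OF s(1)]])
  show "emeasure (section_measure \<mu> \<nu>) E = (\<integral>\<^sup>+x. emeasure \<nu> (Pair x -` E) \<partial>\<mu>)"
    unfolding section_measure_def eq[symmetric]
    by (rule emeasure_bind[OF _ measurable_prob_algebraD[OF k] E]) (simp add: sp)
  show "(\<lambda>x. emeasure \<nu> (Pair x -` E)) \<in> borel_measurable \<mu>"
    unfolding eq[symmetric]
    using measurable_compose[OF measurable_prob_algebraD[OF k] measurable_emeasure_subprob_algebra[OF E]] .
qed

lemma section_measure_eq_pair_measure:
  fixes \<mu> :: "'x::topological_space measure" and \<nu> :: "'y::topological_space measure"
  assumes \<nu>: "regular_borel_prob \<nu>" and \<mu>: "regular_borel_prob \<mu>" and E: "E \<in> sets (\<mu> \<Otimes>\<^sub>M \<nu>)"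
  shows "emeasure (section_measure \<mu> \<nu>) E = emeasure (\<mu> \<Otimes>\<^sub>M \<nu>) E"
proof -
  interpret n: prob_space \<nu> using \<nu> by (simp add: regular_borel_prob_def)
  have "sets (\<mu> \<Otimes>\<^sub>M \<nu>) = sets (borel \<Otimes>\<^sub>M borel)"
    using \<nu> \<mu> by (intro sets_pair_measure_cong) (auto simp: regular_borel_prob_def)
  then have "E \<in> sets borel" using E borel_prod_subset by blast
  then show ?thesis
    using emeasure_section_measure[OF \<nu> \<mu>] n.emeasure_pair_measure_alt[OF E] by simp
qed

lemma prob_space_section_measure:
  fixes \<mu> :: "'x::topological_space measure" and \<nu> :: "'y::topological_space measure"
  assumes \<nu>: "regular_borel_prob \<nu>" and \<mu>: "regular_borel_prob \<mu>"
  shows "prob_space (section_measure \<mu> \<nu>)" "sets (section_measure \<mu> \<nu>) = sets borel"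
proof -
  have s: "sets \<nu> = sets borel" "sets \<mu> = sets borel" and m: "prob_space \<mu>" and n: "prob_space \<nu>"
    using \<nu> \<mu> by (auto simp: regular_borel_prob_def)
  interpret m: prob_space \<mu> by fact
  note k = section_kernel_measurable[OF \<nu> s(2)]
  show "prob_space (section_measure \<mu> \<nu>)" unfolding section_measure_def
    by (rule m.prob_space_bind[OF _ measurable_prob_algebraD[OF k]])
      (auto intro!: prob_space.prob_space_distr[OF n] borel_measurable_Pair s)
  show "sets (section_measure \<mu> \<nu>) = sets borel" unfolding section_measure_def
    by (intro sets_bind) (auto simp: m.not_empty)
qed

text \<open>
  Exhaust \<open>E\<close> by an increasing sequence of open sets \<open>R n\<close> with closure in \<open>E\<close> whose measures
  approach the supremum. If \<open>E - V\<close> had positive measure for their union \<open>V\<close>, then for some \<open>q\<close> the sections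
  of \<open>V\<close> would have measure below \<open>q\<close> and those of \<open>E\<close> measure above \<open>q\<close> on a compact set of
  positive measure. Covering that compact set by tubes yields one more admissible open set that
  strictly increases the measure, a contradiction. Countability is available because only rational
  \<open>q\<close> are needed, although \<open>E\<close> need not be a countable union of rectangles.
\<close>
lemma section_measure_inner:
  fixes \<mu> :: "'x::t2_space measure" and \<nu> :: "'y::t2_space measure"
  assumes compX: "compact (UNIV :: 'x set)" and compY: "compact (UNIV :: 'y set)"
    and \<mu>: "regular_borel_prob \<mu>" and \<nu>: "regular_borel_prob \<nu>" and E: "open E" and e: "e > 0"
  shows "\<exists>C. closed C \<and> C \<subseteq> E \<and> measure (section_measure \<mu> \<nu>) (E - C) < e"
proof -
  define \<rho> where "\<rho> = section_measure \<mu> \<nu>"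
  have pr: "prob_space \<rho>" and sr: "sets \<rho> = sets borel"
    using prob_space_section_measure[OF \<nu> \<mu>] by (auto simp: \<rho>_def)
  interpret r: prob_space \<rho> by (rule pr)
  interpret m: prob_space \<mu> using \<mu> by (simp add: regular_borel_prob_def)
  interpret n: prob_space \<nu> using \<nu> by (simp add: regular_borel_prob_def)
  have sm: "sets \<mu> = sets borel" and sn: "sets \<nu> = sets borel"
    using \<mu> \<nu> by (auto simp: regular_borel_prob_def)
  have em: "emeasure \<rho> A = (\<integral>\<^sup>+x. emeasure \<nu> (Pair x -` A) \<partial>\<mu>)"
    and [measurable]: "(\<lambda>x. emeasure \<nu> (Pair x -` A)) \<in> borel_measurable \<mu>" if "A \<in> sets borel" for A
    using emeasure_section_measure[OF \<nu> \<mu> that] by (auto simp: \<rho>_def)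
  have secb: "Pair x -` A \<in> sets \<nu>" if "open A" for A and x :: 'x
  proof -
    have "open (Pair x -` A)" by (intro open_vimage[OF that] continuous_intros)
    then show ?thesis using sn by simp
  qed
  define \<G> where "\<G> = {R. open R \<and> closure R \<subseteq> E}"
  have Un: "R \<union> R' \<in> \<G>" if "R \<in> \<G>" "R' \<in> \<G>" for R R'
    using that by (auto simp: \<G>_def)
  have G0: "{} \<in> \<G>" by (auto simp: \<G>_def)
  have Gb: "R \<in> sets borel" "R \<in> sets \<rho>" if "R \<in> \<G>" for R using that sr by (auto simp: \<G>_def)
  define s where "s = (SUP R\<in>\<G>. measure \<rho> R)"
  have bdd: "bdd_above (measure \<rho> ` \<G>)" by (intro bdd_aboveI[of _ 1]) auto
  have les: "measure \<rho> R \<le> s" if "R \<in> \<G>" for R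
    unfolding s_def using bdd that by (rule cSUP_upper2) auto
  have "\<exists>R\<in>\<G>. s - inverse (Suc n) < measure \<rho> R" for n
    using less_cSUP_iff[OF _ bdd, of "s - inverse (Suc n)"] G0 by (auto simp: s_def[symmetric])
  then obtain Q where Q: "\<And>n. Q n \<in> \<G>" "\<And>n. s - inverse (Suc n) < measure \<rho> (Q n)" by metis
  define R where "R n = (\<Union>i\<le>n. Q i)" for n
  have RG: "R n \<in> \<G>" for n
    by (induction n) (auto simp: R_def atMost_Suc Q intro!: Un[simplified])
  have Rinc: "incseq R" by (auto simp: incseq_def R_def intro: order_trans)
  have Rlow: "s - inverse (Suc n) < measure \<rho> (R n)" for n
    using Q(2)[of n] r.finite_measure_mono[of "Q n" "R n"] Gb[OF RG[of n]] by (force simp: R_def)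
  define V where "V = (\<Union>n. R n)"
  have "open V" using RG by (auto simp: V_def \<G>_def)
  have "V \<subseteq> E" using RG closure_subset by (fastforce simp: V_def \<G>_def)
  \<comment> \<open>Adding a single admissible set to the exhaustion gains nothing.\<close>
  have lim_union: "measure \<rho> (V \<union> R') \<le> s" if R': "R' \<in> \<G>" for R'
  proof -
    have "(\<lambda>n. measure \<rho> (R n \<union> R')) \<longlonglongrightarrow> measure \<rho> (\<Union>n. R n \<union> R')"
      using Gb[OF Un[OF RG R']] Rinc by (intro r.finite_Lim_measure_incseq) (auto simp: incseq_def subset_iff)
    moreover have "(\<Union>n. R n \<union> R') = V \<union> R'" by (auto simp: V_def)
    ultimately show ?thesis
      using les[OF Un[OF RG R']] by (auto intro: LIMSEQ_le_const2)
  qed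
  have Vs: "measure \<rho> V = s"
  proof (rule antisym)
    show "measure \<rho> V \<le> s" using lim_union[OF G0] by simp
    show "s \<le> measure \<rho> V"
    proof (rule field_le_epsilon)
      fix d :: real assume "d > 0"
      then obtain n where "inverse (real (Suc n)) < d" using reals_Archimedean by blast
      moreover have "measure \<rho> (R n) \<le> measure \<rho> V"
        using \<open>open V\<close> sr by (intro r.finite_measure_mono) (auto simp: V_def)
      ultimately show "s \<le> measure \<rho> V + d" using Rlow[of n] by linarith
    qed
  qed
  have Pm: "{x. emeasure \<nu> (Pair x -` V) < a \<and> b < emeasure \<nu> (Pair x -` E)} \<in> sets \<mu>" for a b
  proof -
    have "{x\<in>space \<mu>. emeasure \<nu> (Pair x -` V) < a \<and> b < emeasure \<nu> (Pair x -` E)} \<in> sets \<mu>"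
      using E \<open>open V\<close> by measurable
    then show ?thesis using sets_eq_imp_space_eq[OF sm] by simp
  qed
  have null: "emeasure \<mu> {x. emeasure \<nu> (Pair x -` V) < a \<and> b < emeasure \<nu> (Pair x -` E)} = 0"
    (is "emeasure \<mu> ?P = 0") if ab: "a \<le> b" for a b :: ennreal
  proof (rule ccontr)
    assume "emeasure \<mu> ?P \<noteq> 0"
    note Pm = Pm[of a b]
    have "0 < (SUP K\<in>{K. K \<subseteq> ?P \<and> compact K}. emeasure \<mu> K)"
      using \<open>emeasure \<mu> ?P \<noteq> 0\<close> \<mu> Pm sm by (auto simp: regular_borel_prob_def zero_less_iff_neq_zero)
    then obtain K where K: "K \<subseteq> ?P" "compact K" "0 < emeasure \<mu> K" unfolding less_SUP_iff by auto
    have "\<exists>O' R'. open O' \<and> x \<in> O' \<and> R' \<in> \<G> \<and> (\<forall>x'\<in>O'. b < emeasure \<nu> (Pair x' -` R'))" if "x \<in> K" for x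
    proof -
      have "b < emeasure \<nu> (Pair x -` E)" using K that by auto
      then have "b < (SUP L\<in>{L. L \<subseteq> Pair x -` E \<and> compact L}. emeasure \<nu> L)"
        using \<nu> secb[OF E] sn by (auto simp: regular_borel_prob_def)
      then obtain L where L: "L \<subseteq> Pair x -` E" "compact L" "b < emeasure \<nu> L"
        unfolding less_SUP_iff by auto
      have "compact ({x} \<times> L)" "{x} \<times> L \<subseteq> E" using L by (auto intro!: compact_Times)
      then obtain R' where R': "open R'" "R' \<in> sets (borel \<Otimes>\<^sub>M borel)" "{x} \<times> L \<subseteq> R'" "closure R' \<subseteq> E"
        by (rule compact_cover_by_rectangles[OF compX compY E])
      obtain O' where O': "x \<in> O'" "open O'" "O' \<times> L \<subseteq> R'"
        using Elementary_Topology.tube_lemma[OF L(2) R'(1,3)] by blast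
      have "b < emeasure \<nu> (Pair x' -` R')" if "x' \<in> O'" for x'
        using O' that by (intro less_le_trans[OF L(3)] emeasure_mono secb R'(1)) auto
      then have "\<forall>x'\<in>O'. b < emeasure \<nu> (Pair x' -` R')" by simp
      moreover have "R' \<in> \<G>" using R' by (simp add: \<G>_def)
      ultimately show ?thesis using O'(1,2) by (intro exI[of _ O'] exI[of _ R'] conjI)
    qed
    then obtain Ox Rx where OR: "\<And>x. x \<in> K \<Longrightarrow> open (Ox x)" "\<And>x. x \<in> K \<Longrightarrow> x \<in> Ox x"
      "\<And>x. x \<in> K \<Longrightarrow> Rx x \<in> \<G>" "\<And>x x'. x \<in> K \<Longrightarrow> x' \<in> Ox x \<Longrightarrow> b < emeasure \<nu> (Pair x' -` Rx x)"
      by metis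
    obtain J where J: "J \<subseteq> K" "finite J" "K \<subseteq> (\<Union>x\<in>J. Ox x)"
    proof (rule compactE_image[OF K(2), of K Ox])
      show "K \<subseteq> (\<Union>x\<in>K. Ox x)" using OR(2) by fast
    qed (simp_all add: OR(1))
    define R' where "R' = (\<Union>x\<in>J. Rx x)"
    have "(\<Union>x\<in>I. Rx x) \<in> \<G>" if "finite I" "I \<subseteq> K" for I
      using that by (induction I) (simp_all add: G0 Un OR(3))
    then have "R' \<in> \<G>" using J by (simp add: R'_def)
    have big: "b < emeasure \<nu> (Pair x -` (V \<union> R'))" if "x \<in> K" for x
    proof -
      have "x \<in> (\<Union>x\<in>J. Ox x)" using J(3) that by (rule subsetD)
      then obtain j where j: "j \<in> J" "x \<in> Ox j" by (rule UN_E)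
      then have "b < emeasure \<nu> (Pair x -` Rx j)" using OR(4)[of j x] J(1) by (simp add: subset_iff)
      also have "\<dots> \<le> emeasure \<nu> (Pair x -` (V \<union> R'))"
        using \<open>R' \<in> \<G>\<close> \<open>open V\<close> j by (intro emeasure_mono secb) (auto simp: R'_def \<G>_def)
      finally show ?thesis .
    qed
    have oU: "open (V \<union> R')" using \<open>R' \<in> \<G>\<close> \<open>open V\<close> by (auto simp: \<G>_def)
    have fin: "(\<integral>\<^sup>+x. emeasure \<nu> (Pair x -` V) \<partial>\<mu>) \<noteq> \<infinity>"
      using em[of V] \<open>open V\<close> by (simp flip: em)
    have Km: "K \<in> sets \<mu>" using borel_closed[OF compact_imp_closed[OF K(2)]] sm by simp
    have "emeasure \<rho> V < emeasure \<rho> (V \<union> R')"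
      unfolding em[OF borel_open[OF oU]] em[OF borel_open[OF \<open>open V\<close>]]
    proof (rule nn_integral_less)
      show "AE x in \<mu>. emeasure \<nu> (Pair x -` V) \<le> emeasure \<nu> (Pair x -` (V \<union> R'))"
        using oU by (intro AE_I2 emeasure_mono secb) auto
      show "\<not> (AE x in \<mu>. emeasure \<nu> (Pair x -` (V \<union> R')) \<le> emeasure \<nu> (Pair x -` V))"
      proof
        assume "AE x in \<mu>. emeasure \<nu> (Pair x -` (V \<union> R')) \<le> emeasure \<nu> (Pair x -` V)"
        then have "AE x in \<mu>. x \<notin> K"
        proof eventually_elim
          case (elim x)
          show ?case
          proof
            assume "x \<in> K"
            then have "emeasure \<nu> (Pair x -` V) < a" using K by auto
            then show False using elim big[OF \<open>x \<in> K\<close>] ab by (meson leD le_less_trans less_le_trans order.strict_trans2 less_imp_le)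
          qed
        qed
        then have "emeasure \<mu> K = 0" using Km by (subst (asm) AE_iff_measurable[OF Km]) (auto dest: sets.sets_into_space)
        then show False using K by simp
      qed
    qed (use oU \<open>open V\<close> fin in \<open>simp_all del: vimage_Un\<close>)
    then have "measure \<rho> V < measure \<rho> (V \<union> R')"
      by (simp add: r.emeasure_eq_measure ennreal_less_iff)
    then show False using lim_union[OF \<open>R' \<in> \<G>\<close>] Vs by simp
  qed
  have "AE x in \<mu>. \<forall>q::rat. \<not> (emeasure \<nu> (Pair x -` V) < ennreal (of_rat q) \<and> ennreal (of_rat q) < emeasure \<nu> (Pair x -` E))"
  proof (subst AE_all_countable, intro allI)
    fix q :: rat
    show "AE x in \<mu>. \<not> (emeasure \<nu> (Pair x -` V) < ennreal (of_rat q) \<and> ennreal (of_rat q) < emeasure \<nu> (Pair x -` E))"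
      using null[of "ennreal (of_rat q)" "ennreal (of_rat q)"] sets_eq_imp_space_eq[OF sm]
        Pm by (subst AE_iff_measurable[OF _ refl]) auto
  qed
  then have "AE x in \<mu>. emeasure \<nu> (Pair x -` E) \<le> emeasure \<nu> (Pair x -` V)"
  proof eventually_elim
    case (elim x)
    show ?case
    proof (rule ccontr)
      assume "\<not> ?thesis"
      then have "measure \<nu> (Pair x -` V) < measure \<nu> (Pair x -` E)"
        by (simp add: n.emeasure_eq_measure)
      then obtain q where q: "measure \<nu> (Pair x -` V) < of_rat q" "of_rat q < measure \<nu> (Pair x -` E)"
        using of_rat_dense by blast
      have q0: "(0::real) \<le> of_rat q" using q(1) measure_nonneg[of \<nu> "Pair x -` V"] by linarith
      have "emeasure \<nu> (Pair x -` V) < ennreal (of_rat q)"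
        unfolding n.emeasure_eq_measure by (subst ennreal_less_iff) (simp_all add: q(1))
      moreover have "ennreal (of_rat q) < emeasure \<nu> (Pair x -` E)"
        unfolding n.emeasure_eq_measure by (subst ennreal_less_iff[OF q0]) (rule q(2))
      ultimately have "emeasure \<nu> (Pair x -` V) < ennreal (of_rat q) \<and> ennreal (of_rat q) < emeasure \<nu> (Pair x -` E)" ..
      then show False using elim by blast
    qed
  qed
  then have "emeasure \<rho> E \<le> emeasure \<rho> V"
    using E \<open>open V\<close> by (auto simp: em intro!: nn_integral_mono_AE)
  then have EV: "measure \<rho> E \<le> s"
    using measure_nonneg[of \<rho> V] by (simp add: r.emeasure_eq_measure flip: Vs)
  obtain n where "inverse (real (Suc n)) < e" using reals_Archimedean[OF e] by blast
  then have "measure \<rho> E - e < measure \<rho> (R n)" using EV Rlow[of n] by linarith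
  also have "\<dots> \<le> measure \<rho> (closure (R n))"
    using sr closure_subset by (intro r.finite_measure_mono) auto
  finally have "measure \<rho> (E - closure (R n)) < e"
    using RG[of n] E sr by (subst r.finite_measure_Diff) (auto simp: \<G>_def)
  then show ?thesis
    using RG[of n] by (auto simp: \<rho>_def \<G>_def intro!: exI[of _ "closure (R n)"])
qed

lemma regular_product_extends:
  fixes \<mu> :: "'x::t2_space measure" and \<nu> :: "'y::t2_space measure"
  assumes compX: "compact (UNIV :: 'x set)" and compY: "compact (UNIV :: 'y set)"
    and \<mu>: "regular_borel_prob \<mu>" and \<nu>: "regular_borel_prob \<nu>"
  shows "regular_borel_prob (regular_product \<mu> \<nu>)"
    and "\<And>E. E \<in> sets (\<mu> \<Otimes>\<^sub>M \<nu>) \<Longrightarrow> emeasure (regular_product \<mu> \<nu>) E = emeasure (\<mu> \<Otimes>\<^sub>M \<nu>) E"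
proof -
  let ?Q = "\<lambda>\<rho>. regular_borel_prob \<rho> \<and> (\<forall>E\<in>sets (\<mu> \<Otimes>\<^sub>M \<nu>). emeasure \<rho> E = emeasure (\<mu> \<Otimes>\<^sub>M \<nu>) E)"
  have sp: "sets (\<mu> \<Otimes>\<^sub>M \<nu>) = sets (borel \<Otimes>\<^sub>M borel)"
    using \<mu> \<nu> by (intro sets_pair_measure_cong) (auto simp: regular_borel_prob_def)
  have comp: "compact (UNIV :: ('x \<times> 'y) set)"
    using compact_Times[OF compX compY] by simp
  have "?Q (section_measure \<mu> \<nu>)"
    using regular_borel_probI[OF comp prob_space_section_measure[OF \<nu> \<mu>]
        section_measure_inner[OF compX compY \<mu> \<nu>]]
      section_measure_eq_pair_measure[OF \<nu> \<mu>] by blast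
  moreover have "\<rho> = \<tau>" if "?Q \<rho>" "?Q \<tau>" for \<rho> \<tau>
    using that by (intro regular_borel_prob_unique[OF compX compY]) (auto simp: sp)
  ultimately have "?Q (regular_product \<mu> \<nu>)"
    unfolding regular_product_def by (intro theI[of ?Q]) auto
  then show "regular_borel_prob (regular_product \<mu> \<nu>)"
    and "\<And>E. E \<in> sets (\<mu> \<Otimes>\<^sub>M \<nu>) \<Longrightarrow> emeasure (regular_product \<mu> \<nu>) E = emeasure (\<mu> \<Otimes>\<^sub>M \<nu>) E"
    by auto
qed

section \<open>Almost periodic functions\<close>

text \<open>
  Taking the whole type as the underlying set is no loss for Borel measures and keeps translates
  \<open>x \<mapsto> f (act s x)\<close> free of side conditions.
\<close>
locale mp_system = prob_space M + group G
  for M :: "'a measure" and G :: "('g, 'm) monoid_scheme" (structure) +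
  fixes act :: "'g \<Rightarrow> 'a \<Rightarrow> 'a"
  assumes space_UNIV: "space M = UNIV"
    and act_measurable: "s \<in> carrier G \<Longrightarrow> act s \<in> M \<rightarrow>\<^sub>M M"
    and act_distr: "s \<in> carrier G \<Longrightarrow> distr M M (act s) = M"
    and act_mult: "\<lbrakk>s \<in> carrier G; t \<in> carrier G\<rbrakk> \<Longrightarrow> act (s \<otimes> t) x = act s (act t x)"
    and act_one: "act \<one> x = x"

text \<open>
  Total boundedness is expressed by colourings of \<open>G\<close> with finitely many colours. Finitely many
  conditions are combined by pairing the colours.
\<close>
lemma pair_colouring:
  fixes h1 h2 :: "'g \<Rightarrow> nat"
  assumes "finite (h1 ` C)" "finite (h2 ` C)"
  shows "\<exists>h::'g \<Rightarrow> nat. finite (h ` C) \<and> (\<forall>s t. h s = h t \<longrightarrow> h1 s = h1 t \<and> h2 s = h2 t)"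
proof (intro exI[of _ "\<lambda>s. prod_encode (h1 s, h2 s)"] conjI)
  have "(\<lambda>s. prod_encode (h1 s, h2 s)) ` C \<subseteq> prod_encode ` (h1 ` C \<times> h2 ` C)" by auto
  then show "finite ((\<lambda>s. prod_encode (h1 s, h2 s)) ` C)"
    using assms by (meson finite_SigmaI finite_imageI finite_subset)
qed simp

lemma joint_colouring:
  fixes Q :: "'i \<Rightarrow> 'g \<Rightarrow> 'g \<Rightarrow> bool"
  assumes "finite I" "\<And>i. i \<in> I \<Longrightarrow> \<exists>h::'g \<Rightarrow> nat. finite (h ` C) \<and> (\<forall>s\<in>C. \<forall>t\<in>C. h s = h t \<longrightarrow> Q i s t)"
  shows "\<exists>h::'g \<Rightarrow> nat. finite (h ` C) \<and> (\<forall>i\<in>I. \<forall>s\<in>C. \<forall>t\<in>C. h s = h t \<longrightarrow> Q i s t)"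
  using assms
proof (induction I)
  case empty
  show ?case by (intro exI[of _ "\<lambda>_. 0"]) (simp add: image_constant_conv)
next
  case (insert i I)
  obtain h1 :: "'g \<Rightarrow> nat" where h1: "finite (h1 ` C)" "\<forall>i\<in>I. \<forall>s\<in>C. \<forall>t\<in>C. h1 s = h1 t \<longrightarrow> Q i s t"
    using insert.IH insert.prems by (metis insertI2)
  obtain h2 :: "'g \<Rightarrow> nat" where h2: "finite (h2 ` C)" "\<forall>s\<in>C. \<forall>t\<in>C. h2 s = h2 t \<longrightarrow> Q i s t"
    using insert.prems by (metis insertI1)
  obtain h :: "'g \<Rightarrow> nat" where "finite (h ` C)" "\<forall>s t. h s = h t \<longrightarrow> h1 s = h1 t \<and> h2 s = h2 t"
    using pair_colouring[OF h1(1) h2(1)] by metis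
  then show ?case using h1(2) h2(2) by (intro exI[of _ h]) (metis insertE)
qed

lemma interval_colouring:
  fixes c :: "'g \<Rightarrow> real"
  assumes "e > 0" "\<And>s. s \<in> C \<Longrightarrow> \<bar>c s\<bar> \<le> b"
  shows "\<exists>h::'g \<Rightarrow> nat. finite (h ` C) \<and> (\<forall>s\<in>C. \<forall>t\<in>C. h s = h t \<longrightarrow> \<bar>c s - c t\<bar> < e)"
proof (intro exI[of _ "\<lambda>s. nat \<lfloor>(c s + b) / e\<rfloor>"] conjI ballI impI)
  have "(\<lambda>s. nat \<lfloor>(c s + b) / e\<rfloor>) ` C \<subseteq> {..nat \<lfloor>2 * b / e\<rfloor>}"
  proof clarsimp
    fix s assume "s \<in> C"
    then have "c s + b \<le> 2 * b" using assms(2)[of s] by linarith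
    then show "nat \<lfloor>(c s + b) / e\<rfloor> \<le> nat \<lfloor>2 * b / e\<rfloor>"
      using \<open>e > 0\<close> by (intro nat_mono floor_mono divide_right_mono) auto
  qed
  then show "finite ((\<lambda>s. nat \<lfloor>(c s + b) / e\<rfloor>) ` C)" by (rule finite_subset) simp
  fix s t assume st: "s \<in> C" "t \<in> C" "nat \<lfloor>(c s + b) / e\<rfloor> = nat \<lfloor>(c t + b) / e\<rfloor>"
  have "0 \<le> (c s + b) / e" "0 \<le> (c t + b) / e"
    using assms(2)[OF st(1)] assms(2)[OF st(2)] \<open>e > 0\<close> by (auto intro!: divide_nonneg_pos)
  then have "\<lfloor>(c s + b) / e\<rfloor> = \<lfloor>(c t + b) / e\<rfloor>" using st(3) by (simp add: nat_eq_iff2)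
  then have "\<bar>(c s + b) / e - (c t + b) / e\<bar> < 1" by linarith
  then have "\<bar>(c s - c t) / e\<bar> < 1" by (simp add: diff_divide_distrib add_divide_distrib)
  then show "\<bar>c s - c t\<bar> < e" using \<open>e > 0\<close> by (simp add: abs_divide)
qed

context mp_system
begin

lemma act_integral:
  fixes f :: "'a \<Rightarrow> real"
  assumes "s \<in> carrier G" "f \<in> borel_measurable M"
  shows "(\<integral>x. f (act s x) \<partial>M) = (\<integral>x. f x \<partial>M)"
  using integral_distr[OF act_measurable[OF assms(1)] assms(2)] act_distr[OF assms(1)] by simp

lemma act_integrable:
  fixes f :: "'a \<Rightarrow> real"
  assumes "s \<in> carrier G" "integrable M f"
  shows "integrable M (\<lambda>x. f (act s x))"
  using integrable_distr_eq[OF act_measurable[OF assms(1)], of f] act_distr[OF assms(1)] assms(2) by auto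

lemma act_borel:
  fixes f :: "'a \<Rightarrow> real"
  assumes "s \<in> carrier G" "f \<in> borel_measurable M"
  shows "(\<lambda>x. f (act s x)) \<in> borel_measurable M"
  using measurable_compose[OF act_measurable[OF assms(1)] assms(2)] .

definition osc :: "('a \<Rightarrow> real) \<Rightarrow> 'g \<Rightarrow> 'g \<Rightarrow> real" where
  "osc f s t = (\<integral>x. \<bar>f (act s x) - f (act t x)\<bar> \<partial>M)"

text \<open>
  Almost periodicity: the orbit is totally bounded in \<open>L\<^sup>1\<close>. A finite colouring whose classes have
  small diameter replaces a finite cover by balls, which avoids choosing centres and makes several
  functions easy to treat at once.
\<close>
definition ap :: "('a \<Rightarrow> real) \<Rightarrow> bool" where
  "ap f \<longleftrightarrow> integrable M f \<and> (\<forall>e>0. \<exists>h::'g \<Rightarrow> nat. finite (h ` carrier G) \<and>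
     (\<forall>s\<in>carrier G. \<forall>t\<in>carrier G. h s = h t \<longrightarrow> osc f s t < e))"

lemma ap_integrable: "ap f \<Longrightarrow> integrable M f" by (simp add: ap_def)

lemma ap_measurable: "ap f \<Longrightarrow> f \<in> borel_measurable M"
  using ap_integrable by (rule borel_measurable_integrable)

lemma ap_joint:
  assumes "finite I" "\<And>i. i \<in> I \<Longrightarrow> ap (f i)" "e > 0"
  shows "\<exists>h::'g \<Rightarrow> nat. finite (h ` carrier G) \<and>
    (\<forall>i\<in>I. \<forall>s\<in>carrier G. \<forall>t\<in>carrier G. h s = h t \<longrightarrow> osc (f i) s t < e)"
  using assms(2,3) by (intro joint_colouring assms(1)) (simp add: ap_def)

lemma osc_nonneg: "0 \<le> osc f s t"
  by (simp add: osc_def)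

text \<open>
  The common source of the closure properties below: a function inherits almost periodicity if its
  oscillation is controlled, up to arbitrarily small errors, by that of almost periodic functions.
\<close>
lemma ap_dominated:
  assumes f: "integrable M f"
    and dom: "\<And>e. e > 0 \<Longrightarrow> \<exists>g g' L. ap g \<and> ap g' \<and> 0 \<le> L \<and>
      (\<forall>s\<in>carrier G. \<forall>t\<in>carrier G. osc f s t \<le> L * (osc g s t + osc g' s t) + e)"
  shows "ap f"
  unfolding ap_def
proof (intro conjI f allI impI)
  fix e :: real assume e: "e > 0"
  obtain g g' L where g: "ap g" "ap g'" "0 \<le> L"
    "\<forall>s\<in>carrier G. \<forall>t\<in>carrier G. osc f s t \<le> L * (osc g s t + osc g' s t) + e/2"
    using dom[of "e/2"] e by auto
  define d where "d = e / (4 * (L + 1))"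
  have d: "d > 0" using e g(3) by (simp add: d_def)
  obtain h :: "'g \<Rightarrow> nat" where h: "finite (h ` carrier G)"
      "\<forall>i\<in>{g,g'}. \<forall>s\<in>carrier G. \<forall>t\<in>carrier G. h s = h t \<longrightarrow> osc i s t < d"
    using ap_joint[of "{g, g'}" "\<lambda>f. f" d] g(1,2) d by (metis finite.emptyI finite_insert insertE singletonD)
  have "osc f s t < e" if st: "s \<in> carrier G" "t \<in> carrier G" "h s = h t" for s t
  proof -
    have "osc f s t \<le> L * (osc g s t + osc g' s t) + e/2" using g(4) st by auto
    also have "L * (osc g s t + osc g' s t) \<le> L * (2 * d)"
    proof (rule mult_left_mono[OF _ g(3)])
      have "osc i s t < d" if "i \<in> {g, g'}" for i using h(2) st that by blast
      from this[of g] this[of g'] show "osc g s t + osc g' s t \<le> 2 * d" by simp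
    qed
    also have "L * (2 * d) < e / 2"
      using g(3) e by (simp add: d_def field_simps)
    finally show ?thesis by simp
  qed
  then show "\<exists>h::'g \<Rightarrow> nat. finite (h ` carrier G) \<and>
     (\<forall>s\<in>carrier G. \<forall>t\<in>carrier G. h s = h t \<longrightarrow> osc f s t < e)"
    using h(1) by blast
qed

lemma osc_integrable:
  fixes f :: "'a \<Rightarrow> real"
  assumes "integrable M f" "s \<in> carrier G" "t \<in> carrier G"
  shows "integrable M (\<lambda>x. \<bar>f (act s x) - f (act t x)\<bar>)"
  using act_integrable[OF assms(2,1)] act_integrable[OF assms(3,1)] by simp

lemma osc_approx:
  assumes f: "integrable M f" and g: "integrable M g" and st: "s \<in> carrier G" "t \<in> carrier G"
  shows "osc f s t \<le> osc g s t + 2 * (\<integral>x. \<bar>f x - g x\<bar> \<partial>M)"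
proof -
  define d where "d x = \<bar>f x - g x\<bar>" for x
  have d: "integrable M d" using f g unfolding d_def by auto
  note i = osc_integrable[OF f st] osc_integrable[OF g st] act_integrable[OF st(1) d] act_integrable[OF st(2) d]
  have "osc f s t \<le> (\<integral>x. \<bar>g (act s x) - g (act t x)\<bar> + d (act s x) + d (act t x) \<partial>M)"
    unfolding osc_def using i by (intro integral_mono) (auto simp: d_def)
  also have "\<dots> = osc g s t + (\<integral>x. d (act s x) \<partial>M) + (\<integral>x. d (act t x) \<partial>M)"
    using i by (simp add: osc_def)
  also have "\<dots> = osc g s t + 2 * (\<integral>x. d x \<partial>M)"
    using d st by (simp add: act_integral)
  finally show ?thesis by (simp add: d_def)
qed

lemma ap_lim:
  assumes f: "integrable M f" and lim: "\<And>e. e > 0 \<Longrightarrow> \<exists>g. ap g \<and> (\<integral>x. \<bar>f x - g x\<bar> \<partial>M) < e"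
  shows "ap f"
proof (rule ap_dominated[OF f])
  fix e :: real assume "e > 0"
  then obtain g where g: "ap g" "(\<integral>x. \<bar>f x - g x\<bar> \<partial>M) < e/2" using lim[of "e/2"] by auto
  have "osc f s t \<le> 1 * (osc g s t + osc g s t) + e" if "s \<in> carrier G" "t \<in> carrier G" for s t
  proof -
    define I where "I = (\<integral>x. \<bar>f x - g x\<bar> \<partial>M)"
    have "osc f s t \<le> osc g s t + 2 * I" "I < e/2" "0 \<le> osc g s t"
      using osc_approx[OF f ap_integrable[OF g(1)] that] g(2) osc_nonneg by (auto simp: I_def)
    then show ?thesis by simp
  qed
  then show "\<exists>g g' L. ap g \<and> ap g' \<and> 0 \<le> L \<and>
      (\<forall>s\<in>carrier G. \<forall>t\<in>carrier G. osc f s t \<le> L * (osc g s t + osc g' s t) + e)"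
    using g(1) by (intro exI[of _ g] exI[of _ 1]) auto
qed

lemma ap_limseq:
  assumes f: "integrable M f" and g: "\<And>n. ap (g n)"
    and lim: "(\<lambda>n. \<integral>x. \<bar>f x - g n x\<bar> \<partial>M) \<longlonglongrightarrow> 0"
  shows "ap f"
proof (rule ap_lim[OF f])
  fix e :: real assume "e > 0"
  then have "\<forall>\<^sub>F n in sequentially. (\<integral>x. \<bar>f x - g n x\<bar> \<partial>M) < e"
    by (rule order_tendstoD(2)[OF lim])
  then show "\<exists>g. ap g \<and> (\<integral>x. \<bar>f x - g x\<bar> \<partial>M) < e"
    using g by (auto simp: eventually_sequentially)
qed

lemma ap_Lipschitz:
  fixes g :: "real \<Rightarrow> real"
  assumes f: "ap f" and g: "\<And>a b. \<bar>g a - g b\<bar> \<le> L * \<bar>a - b\<bar>" and gm: "g \<in> borel_measurable borel"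
  shows "ap (\<lambda>x. g (f x))"
proof (rule ap_dominated)
  note fi = ap_integrable[OF f]
  have L: "0 \<le> L" using g[of 1 0] by simp
  show gi: "integrable M (\<lambda>x. g (f x))"
  proof (rule Bochner_Integration.integrable_bound)
    show "integrable M (\<lambda>x. \<bar>g 0\<bar> + L * \<bar>f x\<bar>)" using fi by auto
    show "(\<lambda>x. g (f x)) \<in> borel_measurable M"
      using measurable_compose[OF ap_measurable[OF f] gm] .
    have "\<bar>g (f x)\<bar> \<le> \<bar>g 0\<bar> + L * \<bar>f x\<bar>" for x using g[of "f x" 0] by auto
    moreover have "0 \<le> \<bar>g 0\<bar> + L * \<bar>f x\<bar>" for x using L by simp
    ultimately show "AE x in M. norm (g (f x)) \<le> norm (\<bar>g 0\<bar> + L * \<bar>f x\<bar>)"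
      by (intro AE_I2) (metis abs_of_nonneg real_norm_def)
  qed
  fix e :: real assume e: "e > 0"
  have "osc (\<lambda>x. g (f x)) s t \<le> L * (osc f s t + osc f s t) + e" if st: "s \<in> carrier G" "t \<in> carrier G" for s t
  proof -
    have "osc (\<lambda>x. g (f x)) s t \<le> (\<integral>x. L * \<bar>f (act s x) - f (act t x)\<bar> \<partial>M)"
      unfolding osc_def using g osc_integrable[OF gi st] osc_integrable[OF fi st]
      by (intro integral_mono) auto
    also have "\<dots> = L * osc f s t" by (simp add: osc_def)
    also have "\<dots> \<le> L * (osc f s t + osc f s t) + e"
      using L osc_nonneg[of f s t] e by (simp add: distrib_left)
    finally show ?thesis .
  qed
  then show "\<exists>g' g'' L. ap g' \<and> ap g'' \<and> 0 \<le> L \<and>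
      (\<forall>s\<in>carrier G. \<forall>t\<in>carrier G. osc (\<lambda>x. g (f x)) s t \<le> L * (osc g' s t + osc g'' s t) + e)"
    using f L by (intro exI[of _ f] exI[of _ L]) auto
qed

lemma ap_add:
  assumes f: "ap f" and g: "ap g"
  shows "ap (\<lambda>x. f x + g x)"
proof (rule ap_dominated)
  note fi = ap_integrable[OF f] and gi = ap_integrable[OF g]
  show i: "integrable M (\<lambda>x. f x + g x)" using fi gi by auto
  fix e :: real assume e: "e > 0"
  have "osc (\<lambda>x. f x + g x) s t \<le> 1 * (osc f s t + osc g s t) + e" if st: "s \<in> carrier G" "t \<in> carrier G" for s t
  proof -
    have "osc (\<lambda>x. f x + g x) s t \<le> (\<integral>x. \<bar>f (act s x) - f (act t x)\<bar> + \<bar>g (act s x) - g (act t x)\<bar> \<partial>M)"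
      unfolding osc_def using osc_integrable[OF i st] osc_integrable[OF fi st] osc_integrable[OF gi st]
      by (intro integral_mono) auto
    also have "\<dots> = osc f s t + osc g s t"
      using osc_integrable[OF fi st] osc_integrable[OF gi st] by (simp add: osc_def)
    finally show ?thesis using e by simp
  qed
  then show "\<exists>g' g'' L. ap g' \<and> ap g'' \<and> 0 \<le> L \<and>
      (\<forall>s\<in>carrier G. \<forall>t\<in>carrier G. osc (\<lambda>x. f x + g x) s t \<le> L * (osc g' s t + osc g'' s t) + e)"
    using f g by (intro exI[of _ f] exI[of _ g] exI[of _ 1]) auto
qed

lemma ap_const: "ap (\<lambda>_. c)"
  unfolding ap_def
proof (intro conjI allI impI)
  fix e :: real assume "e > 0"
  then show "\<exists>h::'g \<Rightarrow> nat. finite (h ` carrier G) \<and>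
     (\<forall>s\<in>carrier G. \<forall>t\<in>carrier G. h s = h t \<longrightarrow> osc (\<lambda>_. c) s t < e)"
    by (intro exI[of _ "\<lambda>_. 0"]) (simp add: osc_def image_constant_conv)
qed auto

lemma ap_cmult: "ap f \<Longrightarrow> ap (\<lambda>x. c * f x)"
  by (rule ap_Lipschitz[where g="\<lambda>a. c * a" and L="\<bar>c\<bar>"])
    (auto simp: abs_mult right_diff_distrib[symmetric])

lemma ap_diff: "ap f \<Longrightarrow> ap g \<Longrightarrow> ap (\<lambda>x. f x - g x)"
  using ap_add[of f "\<lambda>x. -1 * g x"] ap_cmult[of g "-1"] by simp

lemma ap_sum: "finite I \<Longrightarrow> (\<And>i. i \<in> I \<Longrightarrow> ap (f i)) \<Longrightarrow> ap (\<lambda>x. \<Sum>i\<in>I. f i x)"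
  by (induction I rule: finite_induct) (auto intro: ap_const ap_add)

definition apsets :: "'a set set" where
  "apsets = {C \<in> sets M. ap (indicator C)}"

text \<open>
  Boolean operations on sets are Lipschitz operations on indicators, and countable unions are
  \<open>L\<^sup>1\<close>-limits of finite ones.
\<close>
lemma sigma_algebra_apsets: "sigma_algebra UNIV apsets"
  unfolding sigma_algebra_iff2
proof (intro conjI ballI allI impI)
  show "apsets \<subseteq> Pow UNIV" by simp
  have 0: "indicator {} = (\<lambda>_. 0 :: real)" by (auto simp: indicator_def)
  have "ap (indicator {})" unfolding 0 by (rule ap_const)
  then show "{} \<in> apsets" by (simp add: apsets_def)
  fix A assume A: "A \<in> apsets"
  have "indicator (UNIV - A) = (\<lambda>x. 1 - indicator A x :: real)" by (auto simp: indicator_def)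
  moreover have "UNIV - A \<in> sets M" using A space_UNIV sets.compl_sets[of A M] by (auto simp: apsets_def)
  ultimately show "UNIV - A \<in> apsets"
    using A ap_diff[OF ap_const[of 1]] by (auto simp: apsets_def)
next
  have Un: "A \<union> B \<in> apsets" if "A \<in> apsets" "B \<in> apsets" for A B
  proof -
    have "ap (\<lambda>x. min 1 (indicator A x + indicator B x))"
      using that by (intro ap_Lipschitz[where g="min 1" and L=1] ap_add) (auto simp: apsets_def)
    moreover have "(\<lambda>x. min 1 (indicator A x + indicator B x)) = (indicator (A \<union> B) :: 'a \<Rightarrow> real)"
      by (auto simp: indicator_def)
    ultimately show ?thesis using that by (auto simp: apsets_def)
  qed
  fix A :: "nat \<Rightarrow> 'a set" assume "range A \<subseteq> apsets"
  then have A: "A i \<in> apsets" for i by auto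
  define B where "B n = (\<Union>i\<le>n. A i)" for n
  have B: "B n \<in> apsets" for n
    by (induction n) (simp_all add: B_def atMost_Suc A Un)
  have U: "(\<Union>i. A i) \<in> sets M" using A by (auto simp: apsets_def)
  have Bs: "B n \<in> sets M" for n using B by (auto simp: apsets_def)
  have UB: "(\<Union>i. A i) = (\<Union>n. B n)" by (auto simp: B_def)
  have "ap (indicator (\<Union>i. A i))"
  proof (rule ap_limseq)
    show "integrable M (indicator (\<Union>i. A i) :: 'a \<Rightarrow> real)" using U by (simp add: emeasure_eq_measure)
    show "ap (indicator (B n))" for n using B by (simp add: apsets_def)
    have "(\<lambda>n. measure M (B n)) \<longlonglongrightarrow> measure M (\<Union>n. B n)"
      using Bs by (intro finite_Lim_measure_incseq) (auto simp: incseq_def B_def intro: order_trans)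
    then have "(\<lambda>n. measure M (\<Union>n. B n) - measure M (B n)) \<longlonglongrightarrow> 0"
      using tendsto_diff[OF tendsto_const[of "measure M (\<Union>n. B n)"]] by fastforce
    moreover have "(\<integral>x. \<bar>indicator (\<Union>i. A i) x - indicator (B n) x :: real\<bar> \<partial>M) = measure M (\<Union>n. B n) - measure M (B n)" for n
    proof -
      have "(\<lambda>x. \<bar>indicator (\<Union>i. A i) x - indicator (B n) x :: real\<bar>) = (indicator ((\<Union>n. B n) - B n) :: 'a \<Rightarrow> real)"
        unfolding UB by (auto simp: indicator_def fun_eq_iff)
      then have "(\<integral>x. \<bar>indicator (\<Union>i. A i) x - indicator (B n) x :: real\<bar> \<partial>M) = measure M ((\<Union>n. B n) - B n)"
        using space_UNIV by simp
      also have "\<dots> = measure M (\<Union>n. B n) - measure M (B n)"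
        using Bs U UB by (intro finite_measure_Diff) auto
      finally show ?thesis .
    qed
    ultimately show "(\<lambda>n. \<integral>x. \<bar>indicator (\<Union>i. A i) x - indicator (B n) x :: real\<bar> \<partial>M) \<longlonglongrightarrow> 0" by simp
  qed
  then show "(\<Union>i. A i) \<in> apsets" using U by (simp add: apsets_def)
qed

definition ap_algebra :: "'a measure" where "ap_algebra = sigma UNIV apsets"

lemma sets_ap_algebra: "sets ap_algebra = apsets"
  unfolding ap_algebra_def by (simp add: sigma_algebra.sigma_sets_eq[OF sigma_algebra_apsets])

lemma space_ap_algebra: "space ap_algebra = UNIV"
  by (simp add: ap_algebra_def)

lemma subalgebra_ap_algebra: "subalgebra M ap_algebra"
  by (auto simp: subalgebra_def sets_ap_algebra space_ap_algebra space_UNIV apsets_def)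

lemma ap_algebra_imp_measurable: "f \<in> borel_measurable ap_algebra \<Longrightarrow> f \<in> borel_measurable M"
  using measurable_from_subalg[OF subalgebra_ap_algebra] .

lemma ap_if_ap_algebra_nonneg:
  assumes "u \<in> borel_measurable ap_algebra" "\<And>x. 0 \<le> u x"
  shows "integrable M u \<longrightarrow> ap u"
  using assms
proof (induction rule: borel_measurable_induct_real)
  case (set A) then show ?case by (simp add: sets_ap_algebra apsets_def)
next
  case (mult u c)
  show ?case
  proof
    assume "integrable M (\<lambda>x. c * u x)"
    then show "ap (\<lambda>x. c * u x)"
      using mult by (cases "c = 0") (auto intro: ap_const ap_cmult)
  qed
next
  case (add u v)
  show ?case
  proof
    assume i: "integrable M (\<lambda>x. v x + u x)"
    have "integrable M u" "integrable M v"
      using add.hyps(1,3)[THEN ap_algebra_imp_measurable] add.hyps(2,4)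
      by (auto intro!: Bochner_Integration.integrable_bound[OF i])
    then show "ap (\<lambda>x. v x + u x)" using add by (intro ap_add) auto
  qed
next
  case (seq U)
  show ?case
  proof
    assume i: "integrable M u"
    have Ule: "U n x \<le> u x" for n x
      using seq.hyps(3,4) by (intro incseq_le[where X="\<lambda>n. U n x"]) (auto simp: incseq_def le_fun_def space_ap_algebra)
    have Ui: "integrable M (U n)" for n
      using seq.hyps(1)[THEN ap_algebra_imp_measurable] seq.hyps(2) Ule
      by (intro Bochner_Integration.integrable_bound[OF i] AE_I2) (auto intro: order_trans[OF _ abs_ge_self])
    show "ap u"
    proof (rule ap_limseq[OF i])
      show "ap (U n)" for n using seq.IH Ui by auto
      have "(\<lambda>n. \<integral>x. \<bar>u x - U n x\<bar> \<partial>M) \<longlonglongrightarrow> (\<integral>x. 0 \<partial>M)"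
      proof (rule integral_dominated_convergence[where w=u])
        show "AE x in M. (\<lambda>n. \<bar>u x - U n x\<bar>) \<longlonglongrightarrow> 0"
          using seq.hyps(4) by (intro AE_I2 tendsto_rabs_zero)
            (auto simp: space_ap_algebra intro!: tendsto_eq_intros)
        show "AE x in M. norm \<bar>u x - U n x\<bar> \<le> u x" for n
          using Ule[of n] seq.hyps(2)[of n] by (intro AE_I2) (simp add: abs_of_nonneg)
      qed (use i Ui in auto)
      then show "(\<lambda>n. \<integral>x. \<bar>u x - U n x\<bar> \<partial>M) \<longlonglongrightarrow> 0" by simp
    qed
  qed
qed

text \<open>
  From right to left, approximate a measurable function by simple ones. From left to right, a
  superlevel set is an \<open>L\<^sup>1\<close>-limit of Lipschitz functions of \<open>f\<close>.
\<close>
lemma ap_iff_ap_algebra: "ap f \<longleftrightarrow> integrable M f \<and> f \<in> borel_measurable ap_algebra"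
proof
  assume "integrable M f \<and> f \<in> borel_measurable ap_algebra"
  then have i: "integrable M f" and [measurable]: "f \<in> borel_measurable ap_algebra" by auto
  have "ap (\<lambda>x. max 0 (f x))"
    by (rule ap_if_ap_algebra_nonneg[rule_format]) (use i in auto)
  moreover have "ap (\<lambda>x. max 0 (- f x))"
    by (rule ap_if_ap_algebra_nonneg[rule_format]) (use i in auto)
  ultimately have "ap (\<lambda>x. max 0 (f x) - max 0 (- f x))" by (rule ap_diff)
  moreover have "(\<lambda>x. max 0 (f x) - max 0 (- f x)) = f" by (auto simp: max_def)
  ultimately show "ap f" by simp
next
  assume f: "ap f"
  note [measurable] = ap_measurable[OF f]
  have "{x. a < f x} \<in> apsets" for a
  proof -
    \<comment> \<open>These cut-offs increase pointwise to the indicator of the superlevel set.\<close>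
    define g where "g n x = min 1 (max 0 (real n * (f x - a)))" for n x
    have "ap (indicator {x\<in>space M. a < f x})"
    proof (rule ap_limseq)
      show "integrable M (indicator {x\<in>space M. a < f x} :: 'a \<Rightarrow> real)"
        by (simp add: emeasure_eq_measure)
      show apg: "ap (g n)" for n
        unfolding g_def
      proof (rule ap_Lipschitz[OF f, where g="\<lambda>v. min 1 (max 0 (real n * (v - a)))" and L="real n"])
        fix v w
        have "\<bar>min 1 (max 0 (real n * (v - a))) - min 1 (max 0 (real n * (w - a)))\<bar>
            \<le> \<bar>real n * (v - a) - real n * (w - a)\<bar>" by (auto simp: min_def max_def)
        also have "\<dots> = real n * \<bar>v - w\<bar>" by (simp add: right_diff_distrib[symmetric] abs_mult)
        finally show "\<bar>min 1 (max 0 (real n * (v - a))) - min 1 (max 0 (real n * (w - a)))\<bar> \<le> real n * \<bar>v - w\<bar>" .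
      qed simp
      have "(\<lambda>n. \<integral>x. \<bar>indicator {x\<in>space M. a < f x} x - g n x\<bar> \<partial>M) \<longlonglongrightarrow> (\<integral>x. 0 \<partial>M)"
      proof (rule integral_dominated_convergence[where w="\<lambda>_. 1"])
        show "AE x in M. (\<lambda>n. \<bar>indicator {x\<in>space M. a < f x} x - g n x\<bar>) \<longlonglongrightarrow> 0"
        proof (rule AE_I2)
          fix x assume x: "x \<in> space M"
          have "\<forall>\<^sub>F n in sequentially. indicator {x\<in>space M. a < f x} x = g n x"
          proof (cases "a < f x")
            case True
            then obtain N where N: "1 < real N * (f x - a)" using reals_Archimedean3[of "f x - a"] by auto
            have "1 \<le> real n * (f x - a)" if "n \<ge> N" for n
            proof -
              have "real N * (f x - a) \<le> real n * (f x - a)"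
                using that True by (intro mult_right_mono) auto
              then show ?thesis using N by linarith
            qed
            then show ?thesis using True x
              by (auto simp: eventually_sequentially g_def intro!: exI[of _ N])
          next
            case False
            then have "real n * (f x - a) \<le> 0" for n by (intro mult_nonneg_nonpos) auto
            then have "g n x = 0" for n by (simp add: g_def)
            then show ?thesis using False by simp
          qed
          then have "\<forall>\<^sub>F n in sequentially. \<bar>indicator {x\<in>space M. a < f x} x - g n x\<bar> = 0"
            by eventually_elim simp
          then show "(\<lambda>n. \<bar>indicator {x\<in>space M. a < f x} x - g n x\<bar>) \<longlonglongrightarrow> 0"
            by (rule tendsto_eventually)
        qed
        show "AE x in M. norm \<bar>indicator {x\<in>space M. a < f x} x - g n x\<bar> \<le> 1" for n
          by (auto simp: g_def indicator_def)
      qed (use ap_measurable[OF apg] in auto)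
      then show "(\<lambda>n. \<integral>x. \<bar>indicator {x\<in>space M. a < f x} x - g n x\<bar> \<partial>M) \<longlonglongrightarrow> 0" by simp
    qed
    moreover have "{x\<in>space M. a < f x} \<in> sets M" by measurable
    ultimately show ?thesis using space_UNIV by (simp add: apsets_def)
  qed
  then show "integrable M f \<and> f \<in> borel_measurable ap_algebra"
    using ap_integrable[OF f] by (auto intro!: borel_measurableI_greater simp: sets_ap_algebra space_ap_algebra)
qed

lemma ap_bounded:
  assumes "f \<in> borel_measurable ap_algebra" "\<And>x. \<bar>f x\<bar> \<le> b"
  shows "ap f"
  unfolding ap_iff_ap_algebra
  using assms ap_algebra_imp_measurable[OF assms(1)] by (auto intro!: integrable_const_bound[of _ b])

text \<open>
  Orthogonality to the almost periodic functions. Testing against bounded ones is enough, and it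
  keeps all products and sections integrable.
\<close>
definition orth :: "('a \<Rightarrow> real) \<Rightarrow> bool" where
  "orth u \<longleftrightarrow> u \<in> borel_measurable M \<and> (\<forall>x. \<bar>u x\<bar> \<le> 1) \<and>
     (\<forall>k. ap k \<and> (\<exists>b. \<forall>x. \<bar>k x\<bar> \<le> b) \<longrightarrow> (\<integral>x. u x * k x \<partial>M) = 0)"

text \<open>
  The almost periodic part is the conditional expectation on \<open>ap_algebra\<close>, cut off to \<open>[0, 1]\<close> so that its
  bounds hold everywhere.
\<close>
lemma decomposition:
  assumes A[measurable]: "A \<in> sets M"
  shows "\<exists>F. ap F \<and> (\<forall>x. 0 \<le> F x \<and> F x \<le> 1) \<and> orth (\<lambda>x. indicator A x - F x)"
proof -
  interpret finite_measure_subalgebra M ap_algebra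
    by unfold_locales (rule subalgebra_ap_algebra)
  define E where "E = real_cond_exp M ap_algebra (indicator A)"
  have Em[measurable]: "E \<in> borel_measurable ap_algebra" by (simp add: E_def)
  have iA: "integrable M (indicator A :: 'a \<Rightarrow> real)" by (simp add: emeasure_eq_measure)
  define F where "F x = min 1 (max 0 (E x))" for x
  have Fm: "F \<in> borel_measurable ap_algebra" unfolding F_def by simp
  have F01: "0 \<le> F x" "F x \<le> 1" for x by (auto simp: F_def)
  have apF: "ap F" by (rule ap_bounded[OF Fm, of 1]) (use F01 in \<open>auto simp: abs_le_iff intro: order_trans\<close>)
  have "AE x in M. E x \<ge> 0" unfolding E_def by (rule real_cond_exp_ge_c[OF iA]) simp
  moreover have "AE x in M. E x \<le> 1" unfolding E_def by (rule real_cond_exp_le_c[OF iA]) (simp add: indicator_def)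
  ultimately have AE: "AE x in M. E x = F x" by eventually_elim (simp add: F_def)
  note [measurable] = ap_algebra_imp_measurable[OF Fm] ap_algebra_imp_measurable[OF Em]
  have "(\<integral>x. (indicator A x - F x) * k x \<partial>M) = 0" if k: "ap k" "\<forall>x. \<bar>k x\<bar> \<le> b" for k b
  proof -
    have km[measurable]: "k \<in> borel_measurable ap_algebra" using k(1) ap_iff_ap_algebra by auto
    note [measurable] = ap_algebra_imp_measurable[OF km]
    have i1: "integrable M (\<lambda>x. k x * indicator A x)"
      using integrable_mult_indicator[OF A ap_integrable[OF k(1)]] by (simp add: mult.commute)
    have i2: "integrable M (\<lambda>x. k x * F x)"
    proof (rule Bochner_Integration.integrable_bound[OF ap_integrable[OF k(1)]])
      show "AE x in M. norm (k x * F x) \<le> norm (k x)"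
        using F01 by (intro AE_I2) (simp add: abs_mult mult_left_le)
    qed simp
    have "(\<integral>x. k x * indicator A x \<partial>M) = (\<integral>x. k x * E x \<partial>M)"
      unfolding E_def using real_cond_exp_intg(2)[OF i1] by simp
    also have "\<dots> = (\<integral>x. k x * F x \<partial>M)"
      using AE by (intro integral_cong_AE) auto
    finally have "(\<integral>x. k x * indicator A x - k x * F x \<partial>M) = 0" using i1 i2 by simp
    then show ?thesis by (simp add: algebra_simps)
  qed
  moreover have "\<bar>indicator A x - F x\<bar> \<le> 1" for x
    using F01[of x] by (auto simp: indicator_def)
  ultimately have "orth (\<lambda>x. indicator A x - F x)"
    unfolding orth_def by auto
  then show ?thesis using apF F01 by blast
qed

end

section \<open>Product systems and bounded functions\<close>

text \<open>
  The product sigma-algebra is used here and not the Borel sigma-algebra of a product space, so that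
  Fubini's theorem applies.
\<close>
lemma mp_system_pair:
  assumes M: "mp_system M G a" and N: "mp_system N G b"
  shows "mp_system (M \<Otimes>\<^sub>M N) G (\<lambda>s. map_prod (a s) (b s))"
proof -
  interpret M: mp_system M G a by fact
  interpret N: mp_system N G b by fact
  have pr: "prob_space (M \<Otimes>\<^sub>M N)"
    using M.prob_space_axioms N.prob_space_axioms by (rule prob_space_pair)
  have eq: "map_prod (a s) (b s) = (\<lambda>(x, y). (a s x, b s y))" for s
    by (auto simp: fun_eq_iff)
  have me: "map_prod (a s) (b s) \<in> M \<Otimes>\<^sub>M N \<rightarrow>\<^sub>M M \<Otimes>\<^sub>M N" if "s \<in> carrier G" for s
  proof -
    note [measurable] = M.act_measurable[OF that] N.act_measurable[OF that]
    show ?thesis unfolding eq by measurable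
  qed
  have di: "distr (M \<Otimes>\<^sub>M N) (M \<Otimes>\<^sub>M N) (map_prod (a s) (b s)) = M \<Otimes>\<^sub>M N" if "s \<in> carrier G" for s
    using pair_measure_distr[OF M.act_measurable[OF that] N.act_measurable[OF that]]
      M.act_distr[OF that] N.act_distr[OF that] N.sigma_finite_measure_axioms
    unfolding eq by simp
  show ?thesis
    using pr M.group_axioms me di
    by (auto simp: mp_system_def mp_system_axioms_def space_pair_measure M.space_UNIV N.space_UNIV
        M.act_mult N.act_mult M.act_one N.act_one)
qed

lemma (in prob_space) square_expectation_abs_le:
  fixes f :: "'a \<Rightarrow> real"
  assumes f: "f \<in> borel_measurable M" "\<And>x. \<bar>f x\<bar> \<le> b"
  shows "(\<integral>x. \<bar>f x\<bar> \<partial>M)\<^sup>2 \<le> (\<integral>x. (f x)\<^sup>2 \<partial>M)"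
proof -
  note [measurable] = f(1)
  have i: "integrable M (\<lambda>x. \<bar>f x\<bar>)" by (rule integrable_const_bound[of _ b]) (use f in auto)
  have i2: "integrable M (\<lambda>x. (f x)\<^sup>2)"
  proof (rule integrable_const_bound[of _ "b\<^sup>2"])
    show "AE x in M. norm ((f x)\<^sup>2) \<le> b\<^sup>2"
    proof (rule AE_I2)
      fix x show "norm ((f x)\<^sup>2) \<le> b\<^sup>2"
        using power_mono[OF f(2)[of x] abs_ge_zero, of 2] by simp
    qed
  qed simp
  define m where "m = (\<integral>x. \<bar>f x\<bar> \<partial>M)"
  have "0 \<le> (\<integral>x. (\<bar>f x\<bar> - m)\<^sup>2 \<partial>M)" by simp
  also have "(\<lambda>x. (\<bar>f x\<bar> - m)\<^sup>2) = (\<lambda>x. (f x)\<^sup>2 - 2 * m * \<bar>f x\<bar> + m\<^sup>2)"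
    by (auto simp: power2_eq_square algebra_simps)
  also have "(\<integral>x. (f x)\<^sup>2 - 2 * m * \<bar>f x\<bar> + m\<^sup>2 \<partial>M) = (\<integral>x. (f x)\<^sup>2 \<partial>M) - 2 * m * m + m\<^sup>2"
    using i i2 by (simp add: m_def prob_space)
  finally show ?thesis by (simp add: m_def[symmetric] power2_eq_square)
qed

lemma (in finite_measure) integrable_bounded:
  fixes f :: "'a \<Rightarrow> real"
  assumes "f \<in> borel_measurable M" "\<And>x. \<bar>f x\<bar> \<le> b"
  shows "integrable M f"
  using assms by (intro integrable_const_bound[of _ b]) auto

section \<open>Weak mixing\<close>

context mp_system
begin

text \<open>
  Dyadic convex combinations of the translates of the kernel \<open>\<Sum>\<^sub>p p(x)p(y)\<close>. Closure under midpoints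
  suffices for the minimisation below.
\<close>
inductive_set kernels :: "('a \<Rightarrow> real) set \<Rightarrow> ('a \<times> 'a \<Rightarrow> real) set" for P where
  base: "s \<in> carrier G \<Longrightarrow> (\<lambda>z. \<Sum>p\<in>P. p (act s (fst z)) * p (act s (snd z))) \<in> kernels P"
| mid: "k \<in> kernels P \<Longrightarrow> l \<in> kernels P \<Longrightarrow> (\<lambda>z. (k z + l z) / 2) \<in> kernels P"

definition tests :: "('a \<Rightarrow> real) set \<Rightarrow> bool" where
  "tests P \<longleftrightarrow> finite P \<and> (\<forall>p\<in>P. p \<in> borel_measurable M \<and> (\<forall>x. \<bar>p x\<bar> \<le> 1))"

lemma kernel_measurable:
  assumes "k \<in> kernels P" "tests P"
  shows "k \<in> borel_measurable (M \<Otimes>\<^sub>M M)"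
  using assms(1)
proof induction
  case (base s)
  have "(\<lambda>x. p (act s x)) \<in> borel_measurable M" if "p \<in> P" for p
    using base that assms(2) by (intro act_borel) (auto simp: tests_def)
  then show ?case
    by (intro borel_measurable_sum borel_measurable_times)
      (auto intro: measurable_compose[OF measurable_fst] measurable_compose[OF measurable_snd])
next
  case (mid k l)
  then show ?case by measurable
qed

lemma kernel_bounded:
  assumes "k \<in> kernels P" "tests P"
  shows "\<bar>k z\<bar> \<le> card P"
  using assms(1)
proof induction
  case (base s)
  have "\<bar>\<Sum>p\<in>P. p (act s (fst z)) * p (act s (snd z))\<bar> \<le> (\<Sum>p\<in>P. \<bar>p (act s (fst z)) * p (act s (snd z))\<bar>)"
    by (rule sum_abs)
  also have "\<dots> \<le> (\<Sum>p\<in>P. 1)"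
    using assms(2) by (intro sum_mono) (auto simp: tests_def abs_mult intro!: mult_le_one)
  finally show ?case by simp
next
  case (mid k l)
  then show ?case by simp
qed

lemma kernel_translate:
  assumes "k \<in> kernels P" "t \<in> carrier G"
  shows "(\<lambda>z. k (map_prod (act t) (act t) z)) \<in> kernels P"
  using assms(1)
proof induction
  case (base s)
  then have "s \<otimes> t \<in> carrier G" using assms(2) by simp
  from kernels.base[OF this, of P] show ?case
    using base assms(2) by (simp add: act_mult)
next
  case (mid k l)
  then show ?case using kernels.mid by fastforce
qed

lemma kernel_section:
  assumes "k \<in> kernels P" "tests P"
  shows "(\<lambda>y. k (x, y)) \<in> borel_measurable M"
  using kernel_measurable[OF assms] by (rule measurable_Pair2) (simp add: space_UNIV)

text \<open>
  The integral operator of a kernel has finite rank, so it maps the orbit of \<open>u\<close> to a set that is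
  totally bounded, even uniformly: the kernel translated by \<open>r\<close> sees the orbit only through
  the finitely many bounded numbers \<open>c p s\<close>.
\<close>
lemma kernel_compact:
  assumes k: "k \<in> kernels P" and P: "tests P"
    and u: "u \<in> borel_measurable M" "\<And>x. \<bar>u x\<bar> \<le> 1" and e: "e > 0"
  shows "\<exists>h::'g \<Rightarrow> nat. finite (h ` carrier G) \<and> (\<forall>s\<in>carrier G. \<forall>t\<in>carrier G. h s = h t \<longrightarrow>
    (\<forall>x. \<bar>(\<integral>y. k (x, y) * u (act s y) \<partial>M) - (\<integral>y. k (x, y) * u (act t y) \<partial>M)\<bar> \<le> e))"
  using k e
proof (induction arbitrary: e)
  case (base r)
  have ub: "(\<lambda>y. u (act s y)) \<in> borel_measurable M" if "s \<in> carrier G" for s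
    using that u by (intro act_borel)
  have pb: "(\<lambda>y. p (act r y)) \<in> borel_measurable M" "\<bar>p x\<bar> \<le> 1" if "p \<in> P" for p x
    using that P base by (auto intro!: act_borel simp: tests_def)
  have i: "integrable M (\<lambda>y. p (act r y) * u (act s y))" if "p \<in> P" "s \<in> carrier G" for p s
    using that ub pb u by (intro integrable_bounded[of _ 1] borel_measurable_times)
      (auto simp: abs_mult intro!: mult_le_one)
  define c where "c p s = (\<integral>y. p (act r y) * u (act s y) \<partial>M)" for p s
  have c1: "\<bar>c p s\<bar> \<le> 1" if "p \<in> P" "s \<in> carrier G" for p s
  proof -
    have "\<bar>c p s\<bar> \<le> (\<integral>y. \<bar>p (act r y) * u (act s y)\<bar> \<partial>M)" unfolding c_def by (rule integral_abs_bound)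
    also have "\<dots> \<le> (\<integral>y. 1 \<partial>M)"
      using i that pb(2) u by (intro integral_mono Bochner_Integration.integrable_abs)
        (auto simp: abs_mult intro!: mult_le_one)
    finally show ?thesis by (simp add: prob_space)
  qed
  define d where "d = e / (real (card P) + 1)"
  have d: "d > 0" using base by (simp add: d_def)
  have "\<exists>h::'g \<Rightarrow> nat. finite (h ` carrier G) \<and>
      (\<forall>p\<in>P. \<forall>s\<in>carrier G. \<forall>t\<in>carrier G. h s = h t \<longrightarrow> \<bar>c p s - c p t\<bar> < d)"
    using P c1 by (intro joint_colouring interval_colouring[OF d, of _ _ 1]) (auto simp: tests_def)
  then obtain h :: "'g \<Rightarrow> nat" where h: "finite (h ` carrier G)"
      "\<And>p s t. p \<in> P \<Longrightarrow> s \<in> carrier G \<Longrightarrow> t \<in> carrier G \<Longrightarrow> h s = h t \<Longrightarrow> \<bar>c p s - c p t\<bar> < d"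
    by blast
  have eq: "(\<integral>y. (\<Sum>p\<in>P. p (act r x) * p (act r y)) * u (act s y) \<partial>M) = (\<Sum>p\<in>P. p (act r x) * c p s)"
    if "s \<in> carrier G" for s x
  proof -
    have "(\<lambda>y. (\<Sum>p\<in>P. p (act r x) * p (act r y)) * u (act s y)) = (\<lambda>y. \<Sum>p\<in>P. p (act r x) * (p (act r y) * u (act s y)))"
      by (simp add: sum_distrib_right mult.assoc)
    then show ?thesis using i that by (simp add: c_def Bochner_Integration.integral_sum)
  qed
  have "\<bar>(\<Sum>p\<in>P. p (act r x) * c p s) - (\<Sum>p\<in>P. p (act r x) * c p t)\<bar> \<le> e"
    if st: "s \<in> carrier G" "t \<in> carrier G" "h s = h t" for s t x
  proof -
    have "\<bar>(\<Sum>p\<in>P. p (act r x) * c p s) - (\<Sum>p\<in>P. p (act r x) * c p t)\<bar> = \<bar>\<Sum>p\<in>P. p (act r x) * (c p s - c p t)\<bar>"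
      by (simp add: sum_subtractf[symmetric] right_diff_distrib)
    also have "\<dots> \<le> (\<Sum>p\<in>P. \<bar>p (act r x) * (c p s - c p t)\<bar>)" by (rule sum_abs)
    also have "\<dots> \<le> (\<Sum>p\<in>P. 1 * d)"
      unfolding abs_mult using h(2)[OF _ st] pb(2) by (intro sum_mono mult_mono) (auto intro: less_imp_le)
    also have "\<dots> \<le> e" using base by (simp add: d_def field_simps)
    finally show ?thesis .
  qed
  then show ?case using h(1) eq by (intro exI[of _ h]) simp
next
  case (mid k l)
  obtain h1 :: "'g \<Rightarrow> nat" where h1: "finite (h1 ` carrier G)" "\<And>s t x. s \<in> carrier G \<Longrightarrow> t \<in> carrier G \<Longrightarrow> h1 s = h1 t \<Longrightarrow>
    \<bar>(\<integral>y. k (x, y) * u (act s y) \<partial>M) - (\<integral>y. k (x, y) * u (act t y) \<partial>M)\<bar> \<le> e"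
    using mid.IH(1)[OF mid.prems] by blast
  obtain h2 :: "'g \<Rightarrow> nat" where h2: "finite (h2 ` carrier G)" "\<And>s t x. s \<in> carrier G \<Longrightarrow> t \<in> carrier G \<Longrightarrow> h2 s = h2 t \<Longrightarrow>
    \<bar>(\<integral>y. l (x, y) * u (act s y) \<partial>M) - (\<integral>y. l (x, y) * u (act t y) \<partial>M)\<bar> \<le> e"
    using mid.IH(2)[OF mid.prems] by blast
  obtain h :: "'g \<Rightarrow> nat" where h: "finite (h ` carrier G)" "\<And>s t. h s = h t \<Longrightarrow> h1 s = h1 t \<and> h2 s = h2 t"
    using pair_colouring[OF h1(1) h2(1)] by blast
  have i: "integrable M (\<lambda>y. k (x, y) * u (act s y))" if "k \<in> kernels P" "s \<in> carrier G" for k s x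
  proof (rule integrable_bounded[of _ "real (card P) * 1"])
    show "(\<lambda>y. k (x, y) * u (act s y)) \<in> borel_measurable M"
      using kernel_section[OF that(1) P] act_borel[OF that(2) u(1)] by measurable
    show "\<bar>k (x, y) * u (act s y)\<bar> \<le> real (card P) * 1" for y
      using kernel_bounded[OF that(1) P] u(2) unfolding abs_mult by (intro mult_mono) auto
  qed
  have eq: "(\<integral>y. (k (x, y) + l (x, y)) / 2 * u (act s y) \<partial>M) =
      ((\<integral>y. k (x, y) * u (act s y) \<partial>M) + (\<integral>y. l (x, y) * u (act s y) \<partial>M)) / 2" if "s \<in> carrier G" for s x
  proof -
    have "(\<lambda>y. (k (x, y) + l (x, y)) / 2 * u (act s y)) = (\<lambda>y. (k (x, y) * u (act s y) + l (x, y) * u (act s y)) / 2)"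
      by (auto simp: algebra_simps add_divide_distrib)
    then show ?thesis using i[OF mid.hyps(1) that] i[OF mid.hyps(2) that] by simp
  qed
  show ?case
  proof (intro exI[of _ h] conjI ballI impI allI h(1))
    fix s t x assume st: "s \<in> carrier G" "t \<in> carrier G" "h s = h t"
    show "\<bar>(\<integral>y. (k (x, y) + l (x, y)) / 2 * u (act s y) \<partial>M) - (\<integral>y. (k (x, y) + l (x, y)) / 2 * u (act t y) \<partial>M)\<bar> \<le> e"
      unfolding eq[OF st(1)] eq[OF st(2)]
      using h1(2)[of s t x] h2(2)[of s t x] h(2)[OF st(3)] st by (auto simp: abs_le_iff field_simps)
  qed
qed

text \<open>
  A minimising sequence for the \<open>L\<^sup>2\<close> norm is Cauchy by the parallelogram identity. Translating a
  kernel preserves its norm and stays in the set, so the same identity shows that near-minimisers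
  are almost invariant, uniformly over the group.
\<close>
lemma kernel_minimizing_sequence:
  assumes P: "tests P"
  shows "\<exists>k. (\<forall>n::nat. k n \<in> kernels P) \<and>
    (\<forall>n m. n \<le> m \<longrightarrow> (\<integral>z. \<bar>k n z - k m z\<bar> \<partial>(M \<Otimes>\<^sub>M M)) \<le> 2 * (1/2)^n) \<and>
    (\<forall>n. \<forall>t\<in>carrier G. (\<integral>z. \<bar>k n (map_prod (act t) (act t) z) - k n z\<bar> \<partial>(M \<Otimes>\<^sub>M M)) \<le> 2 * (1/2)^n)"
proof -
  let ?MM = "M \<Otimes>\<^sub>M M"
  interpret Q: mp_system ?MM G "\<lambda>s. map_prod (act s) (act s)"
    by (intro mp_system_pair mp_system_axioms)
  define b where "b = real (card P)"
  have km: "k \<in> borel_measurable ?MM" and kb: "\<bar>k z\<bar> \<le> b" if "k \<in> kernels P" for k z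
    using kernel_measurable[OF that P] kernel_bounded[OF that P] by (auto simp: b_def)
  define N where "N k = (\<integral>z. (k z)\<^sup>2 \<partial>?MM)" for k :: "'a \<times> 'a \<Rightarrow> real"
  have ki: "integrable ?MM (\<lambda>z. k z * l z)" if "k \<in> kernels P" "l \<in> kernels P" for k l
    using km[OF that(1)] km[OF that(2)] kb[OF that(1)] kb[OF that(2)]
    by (intro Q.integrable_bounded[of _ "b * b"]) (auto simp: abs_mult b_def intro!: mult_mono)
  have ne: "kernels P \<noteq> {}" using kernels.base[OF one_closed] by blast
  \<comment> \<open>Since midpoints are again kernels, none of them has norm below \<open>J\<close>.\<close>
  define J where "J = (INF k\<in>kernels P. N k)"
  have bdd: "bdd_below (N ` kernels P)" by (intro bdd_belowI[of _ 0]) (auto simp: N_def)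
  have J: "J \<le> N k" if "k \<in> kernels P" for k unfolding J_def using bdd that by (rule cINF_lower)
  have par: "(\<integral>z. \<bar>k z - l z\<bar> \<partial>?MM) \<le> 2 * sqrt d"
    if kl: "k \<in> kernels P" "l \<in> kernels P" "N k \<le> J + d" "N l \<le> J + d" for k l d
  proof -
    note [measurable] = km[OF kl(1)] km[OF kl(2)]
    have "(\<integral>z. \<bar>k z - l z\<bar> \<partial>?MM)\<^sup>2 \<le> (\<integral>z. (k z - l z)\<^sup>2 \<partial>?MM)"
    proof (rule Q.square_expectation_abs_le)
      show "\<bar>k z - l z\<bar> \<le> 2 * b" for z using kb[OF kl(1), of z] kb[OF kl(2), of z] by linarith
    qed simp
    also have "(\<lambda>z. (k z - l z)\<^sup>2) = (\<lambda>z. 2 * (k z * k z) + 2 * (l z * l z) - 4 * ((k z + l z) / 2)\<^sup>2)"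
      by (auto simp: power2_eq_square algebra_simps add_divide_distrib)
    also have "(\<integral>z. 2 * (k z * k z) + 2 * (l z * l z) - 4 * ((k z + l z) / 2)\<^sup>2 \<partial>?MM) =
      2 * N k + 2 * N l - 4 * N (\<lambda>z. (k z + l z) / 2)"
    proof -
      have "integrable ?MM (\<lambda>z. 4 * ((k z + l z) / 2)\<^sup>2)"
        using ki[OF kernels.mid[OF kl(1,2)] kernels.mid[OF kl(1,2)]]
        unfolding power2_eq_square by (rule integrable_mult_right)
      moreover have "integrable ?MM (\<lambda>z. 2 * (k z * k z))" "integrable ?MM (\<lambda>z. 2 * (l z * l z))"
        using ki[OF kl(1,1)] ki[OF kl(2,2)] by simp_all
      ultimately have "(\<integral>z. 2 * (k z * k z) + 2 * (l z * l z) - 4 * ((k z + l z) / 2)\<^sup>2 \<partial>?MM) =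
          (\<integral>z. 2 * (k z * k z) \<partial>?MM) + (\<integral>z. 2 * (l z * l z) \<partial>?MM) - (\<integral>z. 4 * ((k z + l z) / 2)\<^sup>2 \<partial>?MM)"
        by (simp only: Bochner_Integration.integral_diff Bochner_Integration.integral_add
            Bochner_Integration.integrable_add)
      then show ?thesis
        by (simp only: N_def power2_eq_square integral_mult_right_zero)
    qed
    also have "\<dots> \<le> 4 * d" using kl(3,4) J[OF kernels.mid[OF kl(1,2)]] by linarith
    finally have "(\<integral>z. \<bar>k z - l z\<bar> \<partial>?MM) \<le> sqrt (4 * d)" by (rule real_le_rsqrt)
    then show ?thesis by (simp add: real_sqrt_mult)
  qed
  have "\<exists>k\<in>kernels P. N k < J + (1/4)^n" for n :: nat
    using cINF_less_iff[OF ne bdd, of "J + (1/4)^n"] by (simp add: J_def)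
  then obtain k where k: "\<And>n. k n \<in> kernels P" "\<And>n::nat. N (k n) < J + (1/4)^n" by metis
  have sq: "sqrt ((1/4)^n) = (1/2)^n" for n :: nat
  proof -
    have "(1/4::real)^n = ((1/2)^n)\<^sup>2"
      unfolding power_mult[symmetric] mult.commute[of n 2] unfolding power_mult by (simp add: power2_eq_square)
    then show ?thesis by (simp only: real_sqrt_abs) simp
  qed
  show ?thesis
  proof (intro exI[of _ k] conjI allI impI ballI k(1))
    fix n m :: nat assume "n \<le> m"
    then have "(1/4::real)^m \<le> (1/4)^n" by (intro power_decreasing) auto
    then have "N (k m) \<le> J + (1/4)^n" using k(2)[of m] by linarith
    then show "(\<integral>z. \<bar>k n z - k m z\<bar> \<partial>?MM) \<le> 2 * (1/2)^n"
      using par[OF k(1)[of n] k(1)[of m], of "(1/4)^n"] k(2)[of n] k(2)[of m] sq[of n] by simp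
  next
    fix n t assume t: "t \<in> carrier G"
    let ?k = "\<lambda>z. k n (map_prod (act t) (act t) z)"
    have "N ?k = N (k n)" unfolding N_def
      using Q.act_integral[OF t, of "\<lambda>z. (k n z)\<^sup>2"] km[OF k(1)] by simp
    then show "(\<integral>z. \<bar>?k z - k n z\<bar> \<partial>?MM) \<le> 2 * (1/2)^n"
      using par[OF kernel_translate[OF k(1)[of n] t] k(1)[of n], of "(1/4)^n"] k(2)[of n] sq[of n] by simp
  qed
qed

definition kernel_op :: "('a \<times> 'a \<Rightarrow> real) \<Rightarrow> ('a \<Rightarrow> real) \<Rightarrow> 'a \<Rightarrow> real" where
  "kernel_op k u x = (\<integral>y. k (x, y) * u y \<partial>M)"

lemma integral_mult_bound:
  fixes f u :: "'a \<Rightarrow> real"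
  assumes f: "integrable M f" and u: "u \<in> borel_measurable M" "\<And>y. \<bar>u y\<bar> \<le> 1"
  shows "integrable M (\<lambda>y. f y * u y)" "\<bar>\<integral>y. f y * u y \<partial>M\<bar> \<le> (\<integral>y. \<bar>f y\<bar> \<partial>M)"
proof -
  show i: "integrable M (\<lambda>y. f y * u y)"
    using f u by (intro Bochner_Integration.integrable_bound[OF f] AE_I2)
      (auto simp: abs_mult intro!: mult_left_le)
  have "\<bar>\<integral>y. f y * u y \<partial>M\<bar> \<le> (\<integral>y. \<bar>f y * u y\<bar> \<partial>M)" by (rule integral_abs_bound)
  also have "\<dots> \<le> (\<integral>y. \<bar>f y\<bar> \<partial>M)"
    using i f u by (intro integral_mono Bochner_Integration.integrable_abs)
      (auto simp: abs_mult intro!: mult_left_le)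
  finally show "\<bar>\<integral>y. f y * u y \<partial>M\<bar> \<le> (\<integral>y. \<bar>f y\<bar> \<partial>M)" .
qed

lemma kernel_section_integrable:
  assumes "k \<in> kernels P" "tests P"
  shows "integrable M (\<lambda>y. k (x, y))"
  using kernel_section[OF assms] kernel_bounded[OF assms] by (intro integrable_bounded)

lemma kernel_op_measurable:
  assumes "k \<in> kernels P" "tests P" "u \<in> borel_measurable M"
  shows "kernel_op k u \<in> borel_measurable M"
proof -
  note [measurable] = kernel_measurable[OF assms(1,2)] assms(3)
  show ?thesis unfolding kernel_op_def by measurable
qed

lemma kernel_op_bounded:
  assumes k: "k \<in> kernels P" "tests P" and u: "u \<in> borel_measurable M" "\<And>y. \<bar>u y\<bar> \<le> 1"
  shows "\<bar>kernel_op k u x\<bar> \<le> card P"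
proof -
  note i = kernel_section_integrable[OF k, of x]
  have "\<bar>kernel_op k u x\<bar> \<le> (\<integral>y. \<bar>k (x, y)\<bar> \<partial>M)" unfolding kernel_op_def by (rule integral_mult_bound(2)[OF i u])
  also have "\<dots> \<le> (\<integral>y. real (card P) \<partial>M)"
    using i kernel_bounded[OF k] by (intro integral_mono Bochner_Integration.integrable_abs) auto
  finally show ?thesis by (simp add: prob_space)
qed

lemma kernel_op_integrable:
  assumes "k \<in> kernels P" "tests P" "u \<in> borel_measurable M" "\<And>y. \<bar>u y\<bar> \<le> 1"
  shows "integrable M (kernel_op k u)"
  using kernel_op_measurable[OF assms(1-3)] kernel_op_bounded[OF assms] by (rule integrable_bounded)

lemma kernel_op_diff:
  assumes k: "k \<in> kernels P" and l: "l \<in> kernels P" and P: "tests P"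
    and u: "u \<in> borel_measurable M" "\<And>y. \<bar>u y\<bar> \<le> 1"
  shows "(\<integral>x. \<bar>kernel_op k u x - kernel_op l u x\<bar> \<partial>M) \<le> (\<integral>z. \<bar>k z - l z\<bar> \<partial>(M \<Otimes>\<^sub>M M))"
proof -
  let ?MM = "M \<Otimes>\<^sub>M M"
  interpret Q: mp_system ?MM G "\<lambda>s. map_prod (act s) (act s)"
    by (intro mp_system_pair mp_system_axioms)
  interpret pp: pair_prob_space M M ..
  note [measurable] = kernel_measurable[OF k P] kernel_measurable[OF l P]
  have "\<bar>\<bar>k z - l z\<bar>\<bar> \<le> 2 * real (card P)" for z
    using kernel_bounded[OF k P, of z] kernel_bounded[OF l P, of z] by linarith
  then have i: "integrable ?MM (\<lambda>z. \<bar>k z - l z\<bar>)" by (intro Q.integrable_bounded) auto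
  have "\<bar>kernel_op k u x - kernel_op l u x\<bar> \<le> (\<integral>y. \<bar>k (x, y) - l (x, y)\<bar> \<partial>M)" for x
  proof -
    note ix = kernel_section_integrable[OF k P, of x] kernel_section_integrable[OF l P, of x]
    have "kernel_op k u x - kernel_op l u x = (\<integral>y. (k (x, y) - l (x, y)) * u y \<partial>M)"
      unfolding kernel_op_def left_diff_distrib using integral_mult_bound(1)[OF _ u] ix by simp
    then show ?thesis using integral_mult_bound(2)[OF _ u, of "\<lambda>y. k (x, y) - l (x, y)"] ix by simp
  qed
  then have "(\<integral>x. \<bar>kernel_op k u x - kernel_op l u x\<bar> \<partial>M) \<le> (\<integral>x. (\<integral>y. \<bar>k (x, y) - l (x, y)\<bar> \<partial>M) \<partial>M)"
    using kernel_op_integrable[OF k P u] kernel_op_integrable[OF l P u] pp.integrable_fst'[OF i] by (intro integral_mono) auto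
  also have "\<dots> = (\<integral>z. \<bar>k z - l z\<bar> \<partial>?MM)" by (rule pp.integral_fst'[OF i])
  finally show ?thesis .
qed

lemma kernel_op_act:
  assumes k: "k \<in> kernels P" "tests P" and u: "u \<in> borel_measurable M" and s: "s \<in> carrier G"
  shows "kernel_op k u (act s x) = kernel_op (\<lambda>z. k (map_prod (act s) (act s) z)) (\<lambda>y. u (act s y)) x"
proof -
  have "(\<lambda>y. k (act s x, y) * u y) \<in> borel_measurable M" using kernel_section[OF k] u by measurable
  from act_integral[OF s this] show ?thesis by (simp add: kernel_op_def)
qed

text \<open>
  The images \<open>kernel_op (k n) u\<close> form a Cauchy sequence in \<open>L\<^sup>1\<close>. Their limit is almost periodic: a
  translate of \<open>kernel_op (k n) u\<close> is close to \<open>kernel_op (k n)\<close> applied to a translate of \<open>u\<close>, because \<open>k n\<close> is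
  almost invariant, and these functions form a totally bounded set by \<open>kernel_compact\<close>.
\<close>
lemma kernel_limit_ap:
  assumes P: "tests P" and k: "\<And>n::nat. k n \<in> kernels P"
    and cau: "\<And>n m. n \<le> m \<Longrightarrow> (\<integral>z. \<bar>k n z - k m z\<bar> \<partial>(M \<Otimes>\<^sub>M M)) \<le> 2 * (1/2)^n"
    and inv: "\<And>n t. t \<in> carrier G \<Longrightarrow>
      (\<integral>z. \<bar>k n (map_prod (act t) (act t) z) - k n z\<bar> \<partial>(M \<Otimes>\<^sub>M M)) \<le> 2 * (1/2)^n"
    and um: "u \<in> borel_measurable M" and u1: "\<And>x. \<bar>u x\<bar> \<le> 1"
  shows "\<exists>W. ap W \<and> (\<forall>x. \<bar>W x\<bar> \<le> card P) \<and> (\<forall>n. (\<integral>x. \<bar>kernel_op (k n) u x - W x\<bar> \<partial>M) \<le> 2 * (1/2)^n)"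
proof -
  define b where "b = real (card P)"
  define w where "w n = kernel_op (k n) u" for n
  have wm[measurable]: "w n \<in> borel_measurable M" for n unfolding w_def by (rule kernel_op_measurable[OF k P um])
  have wb: "\<bar>w n x\<bar> \<le> b" for n x unfolding w_def b_def by (rule kernel_op_bounded[OF k P um u1])
  have b0: "0 \<le> b" by (simp add: b_def)
  have wi: "integrable M (w n)" for n using wm wb by (rule integrable_bounded)
  have wdiff: "(\<integral>x. \<bar>w n x - w m x\<bar> \<partial>M) \<le> 2 * (1/2)^n" if "n \<le> m" for n m
    unfolding w_def using kernel_op_diff[OF k k P um u1] cau[OF that] by (rule order_trans)
  have small: "\<exists>N. 2 * (1/2::real)^N < e" if "e > 0" for e
    using real_arch_pow_inv[of "e/2" "1/2"] that by (auto simp: field_simps)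
  have Cau: "\<exists>N. \<forall>i\<ge>N. \<forall>j\<ge>N. (\<integral>x. norm (w i x - w j x) \<partial>M) < e" if e: "e > 0" for e
  proof -
    obtain N where N: "2 * (1/2::real)^N < e" using small[OF e] by blast
    have lt: "(\<integral>x. \<bar>w i x - w j x\<bar> \<partial>M) < e" if "N \<le> i" "i \<le> j" for i j
    proof -
      have "2 * (1/2::real)^i \<le> 2 * (1/2)^N" using that by (intro mult_left_mono power_decreasing) auto
      then show ?thesis using wdiff[OF that(2)] N by linarith
    qed
    have "(\<integral>x. \<bar>w i x - w j x\<bar> \<partial>M) < e" if "N \<le> i" "N \<le> j" for i j
      using lt[of i j] lt[of j i] that by (cases "i \<le> j") (auto simp: abs_minus_commute)
    then show ?thesis by auto
  qed
  obtain r where r: "strict_mono r" "AE x in M. Cauchy (\<lambda>i. w (r i) x)"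
    using cauchy_L1_AE_cauchy_subseq[OF wi Cau] by blast
  \<comment> \<open>The cut-off only changes the limit on the null set where it does not exist.\<close>
  define W where "W x = max (- b) (min b (lim (\<lambda>i. w (r i) x)))" for x
  have Wm[measurable]: "W \<in> borel_measurable M" unfolding W_def by measurable
  have Wb: "\<bar>W x\<bar> \<le> b" for x unfolding W_def using b0 by auto
  have Wi: "integrable M W" using Wm Wb by (rule integrable_bounded)
  have AEW: "AE x in M. (\<lambda>i. w (r i) x) \<longlonglongrightarrow> W x"
    using r(2)
  proof eventually_elim
    case (elim x)
    then have l: "(\<lambda>i. w (r i) x) \<longlonglongrightarrow> lim (\<lambda>i. w (r i) x)"
      by (simp add: Cauchy_convergent convergent_LIMSEQ_iff[symmetric])
    have "lim (\<lambda>i. w (r i) x) \<le> b" using LIMSEQ_le_const2[OF l, of b] wb by (auto simp: abs_le_iff)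
    moreover have "- b \<le> lim (\<lambda>i. w (r i) x)"
    proof (rule LIMSEQ_le_const[OF l])
      show "\<exists>N. \<forall>n\<ge>N. - b \<le> w (r n) x" using wb by (auto simp: abs_le_iff intro: minus_le_iff[THEN iffD1])
    qed
    ultimately show ?case using l by (simp add: W_def)
  qed
  have lim: "(\<lambda>i. \<integral>x. \<bar>w (r i) x - W x\<bar> \<partial>M) \<longlonglongrightarrow> 0"
  proof -
    have "(\<lambda>i. \<integral>x. \<bar>w (r i) x - W x\<bar> \<partial>M) \<longlonglongrightarrow> (\<integral>x. 0 \<partial>M)"
    proof (rule integral_dominated_convergence[where w="\<lambda>_. 2 * b"])
      show "AE x in M. (\<lambda>i. \<bar>w (r i) x - W x\<bar>) \<longlonglongrightarrow> 0"
        using AEW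
      proof eventually_elim
        case (elim x)
        then have "(\<lambda>i. w (r i) x - W x) \<longlonglongrightarrow> 0" by (simp add: LIM_zero)
        then show ?case by (rule tendsto_rabs_zero)
      qed
      show "AE x in M. norm \<bar>w (r i) x - W x\<bar> \<le> 2 * b" for i
      proof (rule AE_I2)
        fix x show "norm \<bar>w (r i) x - W x\<bar> \<le> 2 * b"
          using wb[of "r i" x] Wb[of x] by simp
      qed
    qed auto
    then show ?thesis by simp
  qed
  have wW: "(\<integral>x. \<bar>w n x - W x\<bar> \<partial>M) \<le> 2 * (1/2)^n" for n
  proof -
    have "(\<lambda>i. 2 * (1/2)^n + (\<integral>x. \<bar>w (r i) x - W x\<bar> \<partial>M)) \<longlonglongrightarrow> 2 * (1/2)^n + 0"
      by (intro tendsto_add tendsto_const lim)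
    then have "(\<lambda>i. 2 * (1/2)^n + (\<integral>x. \<bar>w (r i) x - W x\<bar> \<partial>M)) \<longlonglongrightarrow> 2 * (1/2)^n" by simp
    then show ?thesis
    proof (rule LIMSEQ_le_const, intro exI[of _ n] allI impI)
      fix i assume "n \<le> i"
      then have "n \<le> r i" using seq_suble[OF r(1), of i] by linarith
      have "(\<integral>x. \<bar>w n x - W x\<bar> \<partial>M) \<le> (\<integral>x. \<bar>w n x - w (r i) x\<bar> + \<bar>w (r i) x - W x\<bar> \<partial>M)"
        using wi Wi by (intro integral_mono) auto
      also have "\<dots> = (\<integral>x. \<bar>w n x - w (r i) x\<bar> \<partial>M) + (\<integral>x. \<bar>w (r i) x - W x\<bar> \<partial>M)"
        using wi Wi by (intro Bochner_Integration.integral_add) auto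
      finally show "(\<integral>x. \<bar>w n x - W x\<bar> \<partial>M) \<le> 2 * (1/2)^n + (\<integral>x. \<bar>w (r i) x - W x\<bar> \<partial>M)"
        using wdiff[OF \<open>n \<le> r i\<close>] by simp
    qed
  qed
  have apW: "ap W"
    unfolding ap_def
  proof (intro conjI Wi allI impI)
    fix e :: real assume e: "e > 0"
    obtain n where n: "2 * (1/2::real)^n < e/10" using small[of "e/10"] e by auto
    obtain h :: "'g \<Rightarrow> nat" where h: "finite (h ` carrier G)" "\<And>s t x. s \<in> carrier G \<Longrightarrow> t \<in> carrier G \<Longrightarrow> h s = h t \<Longrightarrow>
      \<bar>kernel_op (k n) (\<lambda>y. u (act s y)) x - kernel_op (k n) (\<lambda>y. u (act t y)) x\<bar> \<le> e/10"
    proof -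
      have e10: "e/10 > 0" using e by simp
      from kernel_compact[OF k P um u1 e10, of n] obtain h :: "'g \<Rightarrow> nat" where
        h: "finite (h ` carrier G)" "\<forall>s\<in>carrier G. \<forall>t\<in>carrier G. h s = h t \<longrightarrow>
          (\<forall>x. \<bar>(\<integral>y. k n (x, y) * u (act s y) \<partial>M) - (\<integral>y. k n (x, y) * u (act t y) \<partial>M)\<bar> \<le> e/10)"
        by (elim exE conjE) (rule that)
      show thesis
      proof (rule that[OF h(1)])
        fix s t x assume "s \<in> carrier G" "t \<in> carrier G" "h s = h t"
        then show "\<bar>kernel_op (k n) (\<lambda>y. u (act s y)) x - kernel_op (k n) (\<lambda>y. u (act t y)) x\<bar> \<le> e/10"
          unfolding kernel_op_def by (rule h(2)[rule_format])
      qed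
    qed
    define v where "v s = kernel_op (k n) (\<lambda>y. u (act s y))" for s
    have vi: "integrable M (v s)" if "s \<in> carrier G" for s
      unfolding v_def by (rule kernel_op_integrable[OF k P act_borel[OF that um] u1])
    have dv: "(\<integral>x. \<bar>w n (act s x) - v s x\<bar> \<partial>M) \<le> 2 * (1/2)^n" if s: "s \<in> carrier G" for s
      unfolding w_def v_def kernel_op_act[OF k P um s]
      using kernel_op_diff[OF kernel_translate[OF k s] k P act_borel[OF s um] u1] inv[OF s] by (rule order_trans)
    have "osc W s t < e" if st: "s \<in> carrier G" "t \<in> carrier G" "h s = h t" for s t
    proof -
      have i: "integrable M (\<lambda>x. w n (act r x) - v r x)" if "r \<in> carrier G" for r
        using act_integrable[OF that wi[of n]] vi[OF that] by simp
      have "osc (w n) s t \<le> (\<integral>x. \<bar>w n (act s x) - v s x\<bar> + \<bar>w n (act t x) - v t x\<bar> + e/10 \<partial>M)"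
        unfolding osc_def
      proof (rule integral_mono)
        show "integrable M (\<lambda>x. \<bar>w n (act s x) - w n (act t x)\<bar>)" by (rule osc_integrable[OF wi st(1,2)])
        show "integrable M (\<lambda>x. \<bar>w n (act s x) - v s x\<bar> + \<bar>w n (act t x) - v t x\<bar> + e/10)"
          using i st by auto
        fix x
        have "\<bar>v s x - v t x\<bar> \<le> e/10" using h(2)[OF st] by (simp add: v_def)
        then show "\<bar>w n (act s x) - w n (act t x)\<bar> \<le> \<bar>w n (act s x) - v s x\<bar> + \<bar>w n (act t x) - v t x\<bar> + e/10"
          by linarith
      qed
      also have "\<dots> = (\<integral>x. \<bar>w n (act s x) - v s x\<bar> \<partial>M) + (\<integral>x. \<bar>w n (act t x) - v t x\<bar> \<partial>M) + e/10"
        using i st by (simp add: prob_space)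
      finally have 1: "osc (w n) s t \<le> 3 * (e/10)" using dv[OF st(1)] dv[OF st(2)] n by simp
      have "osc W s t \<le> osc (w n) s t + 2 * (\<integral>x. \<bar>W x - w n x\<bar> \<partial>M)" by (rule osc_approx[OF Wi wi st(1,2)])
      also have "(\<integral>x. \<bar>W x - w n x\<bar> \<partial>M) = (\<integral>x. \<bar>w n x - W x\<bar> \<partial>M)" by (simp add: abs_minus_commute)
      finally show ?thesis using 1 wW[of n] n e by simp
    qed
    then show "\<exists>h::'g \<Rightarrow> nat. finite (h ` carrier G) \<and>
      (\<forall>s\<in>carrier G. \<forall>t\<in>carrier G. h s = h t \<longrightarrow> osc W s t < e)" using h(1) by blast
  qed
  show ?thesis using apW Wb wW unfolding b_def w_def by blast
qed

text \<open>
  The quadratic form of \<open>k n\<close> at \<open>u\<close> is the inner product of \<open>u\<close> with \<open>kernel_op (k n) u\<close>, which tends to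
  an almost periodic function.
\<close>
lemma kernel_orth_tendsto_0:
  assumes P: "tests P" and k: "\<And>n::nat. k n \<in> kernels P"
    and cau: "\<And>n m. n \<le> m \<Longrightarrow> (\<integral>z. \<bar>k n z - k m z\<bar> \<partial>(M \<Otimes>\<^sub>M M)) \<le> 2 * (1/2)^n"
    and inv: "\<And>n t. t \<in> carrier G \<Longrightarrow>
      (\<integral>z. \<bar>k n (map_prod (act t) (act t) z) - k n z\<bar> \<partial>(M \<Otimes>\<^sub>M M)) \<le> 2 * (1/2)^n"
    and u: "orth u"
  shows "(\<lambda>n. \<integral>z. k n z * (u (fst z) * u (snd z)) \<partial>(M \<Otimes>\<^sub>M M)) \<longlonglongrightarrow> 0"
proof -
  let ?MM = "M \<Otimes>\<^sub>M M"
  interpret Q: mp_system ?MM G "\<lambda>s. map_prod (act s) (act s)"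
    by (intro mp_system_pair mp_system_axioms)
  interpret pp: pair_prob_space M M ..
  have um[measurable]: "u \<in> borel_measurable M" and u1: "\<bar>u x\<bar> \<le> 1" for x using u by (auto simp: orth_def)
  obtain W where W: "ap W" "\<forall>x. \<bar>W x\<bar> \<le> card P" "\<forall>n. (\<integral>x. \<bar>kernel_op (k n) u x - W x\<bar> \<partial>M) \<le> 2 * (1/2)^n"
    using kernel_limit_ap[of P k u, OF P k cau inv um u1] by blast
  have 0: "(\<integral>x. W x * u x \<partial>M) = 0" using u W(1,2) by (auto simp: orth_def mult.commute[of "W _"])
  have main: "\<bar>\<integral>z. k n z * (u (fst z) * u (snd z)) \<partial>?MM\<bar> \<le> 2 * (1/2)^n" for n
  proof -
    note [measurable] = kernel_measurable[OF k P]
    have ki: "integrable M (kernel_op (k n) u)" by (rule kernel_op_integrable[OF k P um u1])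
    have "\<bar>k n z * (u (fst z) * u (snd z))\<bar> \<le> card P * (1 * 1)" for z
      unfolding abs_mult of_nat_mult using kernel_bounded[OF k P] u1 by (intro mult_mono) auto
    then have "integrable ?MM (\<lambda>z. k n z * (u (fst z) * u (snd z)))" by (intro Q.integrable_bounded) auto
    from pp.integral_fst'[OF this]
    have "(\<integral>z. k n z * (u (fst z) * u (snd z)) \<partial>?MM) = (\<integral>x. (\<integral>y. u x * (k n (x, y) * u y) \<partial>M) \<partial>M)"
      by (simp add: mult_ac)
    also have "\<dots> = (\<integral>x. kernel_op (k n) u x * u x \<partial>M)" by (simp add: kernel_op_def mult.commute)
    also have "\<dots> = (\<integral>x. (kernel_op (k n) u x - W x) * u x \<partial>M)"
      unfolding left_diff_distrib using integral_mult_bound(1)[OF _ um u1] ki ap_integrable[OF W(1)] 0 by simp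
    also have "\<bar>\<dots>\<bar> \<le> (\<integral>x. \<bar>kernel_op (k n) u x - W x\<bar> \<partial>M)"
      using ki ap_integrable[OF W(1)] by (intro integral_mult_bound um u1) auto
    also have "\<dots> \<le> 2 * (1/2)^n" using W(3) by blast
    finally show ?thesis .
  qed
  show ?thesis
  proof (rule Lim_null_comparison)
    show "\<forall>\<^sub>F n in sequentially. norm (\<integral>z. k n z * (u (fst z) * u (snd z)) \<partial>?MM) \<le> 2 * (1/2)^n"
      using main by simp
    have "(\<lambda>n. 2 * (1/2::real)^n) \<longlonglongrightarrow> 2 * 0" by (intro tendsto_mult tendsto_const LIMSEQ_power_zero) simp
    then show "(\<lambda>n. 2 * (1/2::real)^n) \<longlonglongrightarrow> 0" by simp
  qed
qed

text \<open>
  If for every \<open>s\<close> some correlation had size at least \<open>e\<close>, then the quadratic forms of all translated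
  kernels \<open>\<Sum>\<^sub>p p(sx)p(sy)\<close>, summed over \<open>U\<close>, would be at least \<open>e\<^sup>2\<close>. This persists for midpoints,
  hence along the minimising sequence, where the forms tend to \<open>0\<close>.
\<close>
lemma weak_mixing:
  assumes P: "tests P" and U: "finite U" "\<And>u. u \<in> U \<Longrightarrow> orth u" and e: "e > 0"
  shows "\<exists>s\<in>carrier G. \<forall>u\<in>U. \<forall>p\<in>P. \<bar>\<integral>x. u (act s x) * p x \<partial>M\<bar> < e"
proof (rule ccontr)
  let ?MM = "M \<Otimes>\<^sub>M M"
  assume neg: "\<not> ?thesis"
  interpret Q: mp_system ?MM G "\<lambda>s. map_prod (act s) (act s)"
    by (intro mp_system_pair mp_system_axioms)
  interpret pp: pair_prob_space M M ..
  have finP: "finite P" and pm: "\<And>p. p \<in> P \<Longrightarrow> p \<in> borel_measurable M" and p1: "\<And>p x. p \<in> P \<Longrightarrow> \<bar>p x\<bar> \<le> 1"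
    using P by (auto simp: tests_def)
  have um: "\<And>u. u \<in> U \<Longrightarrow> u \<in> borel_measurable M" and u1: "\<And>u x. u \<in> U \<Longrightarrow> \<bar>u x\<bar> \<le> 1"
    using U(2) by (auto simp: orth_def)
  have swap: "(\<integral>x. u x * p (act s x) \<partial>M) = (\<integral>x. u (act (inv s) x) * p x \<partial>M)"
    if s: "s \<in> carrier G" and m: "u \<in> borel_measurable M" "p \<in> borel_measurable M" for s and u p :: "'a \<Rightarrow> real"
  proof -
    note [measurable] = act_borel[OF s m(2)] m(1)
    have "(\<integral>x. u x * p (act s x) \<partial>M) = (\<integral>x. u (act (inv s) x) * p (act s (act (inv s) x)) \<partial>M)"
      using act_integral[OF inv_closed[OF s], of "\<lambda>x. u x * p (act s x)"] by simp
    also have "(\<lambda>x. act s (act (inv s) x)) = (\<lambda>x. x)"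
      using act_mult[OF s inv_closed[OF s]] s by (simp add: act_one)
    finally show ?thesis by (simp add: fun_eq_iff)
  qed
  have big: "\<exists>u\<in>U. \<exists>p\<in>P. e \<le> \<bar>\<integral>x. u x * p (act s x) \<partial>M\<bar>" if s: "s \<in> carrier G" for s
  proof -
    obtain u p where "u \<in> U" "p \<in> P" "\<not> \<bar>\<integral>x. u (act (inv s) x) * p x \<partial>M\<bar> < e"
      using neg inv_closed[OF s] by blast
    then show ?thesis using swap[OF s um pm] by (intro bexI[of _ u] bexI[of _ p]) auto
  qed
  have iu: "integrable ?MM (\<lambda>z. k z * (u (fst z) * u (snd z)))" if "k \<in> kernels P" "u \<in> U" for k u
  proof (rule Q.integrable_bounded[of _ "real (card P) * (1 * 1)"])
    note [measurable] = kernel_measurable[OF that(1) P] um[OF that(2)]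
    show "(\<lambda>z. k z * (u (fst z) * u (snd z))) \<in> borel_measurable ?MM" by measurable
    show "\<bar>k z * (u (fst z) * u (snd z))\<bar> \<le> real (card P) * (1 * 1)" for z
      unfolding abs_mult using kernel_bounded[OF that(1) P] u1[OF that(2)] by (intro mult_mono) auto
  qed
  define \<Phi> where "\<Phi> k = (\<Sum>u\<in>U. \<integral>z. k z * (u (fst z) * u (snd z)) \<partial>?MM)" for k
  have "e\<^sup>2 \<le> \<Phi> k" if "k \<in> kernels P" for k
    using that
  proof induction
    case (base s)
    have pam: "(\<lambda>x. p (act s x)) \<in> borel_measurable M" if "p \<in> P" for p using base pm[OF that] by (rule act_borel)
    have "\<Phi> (\<lambda>z. \<Sum>p\<in>P. p (act s (fst z)) * p (act s (snd z))) = (\<Sum>u\<in>U. \<Sum>p\<in>P. (\<integral>x. u x * p (act s x) \<partial>M)\<^sup>2)"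
      unfolding \<Phi>_def
    proof (rule sum.cong[OF refl])
      fix u assume u: "u \<in> U"
      note [measurable] = um[OF u]
      have 1: "integrable ?MM (\<lambda>z. (u (fst z) * p (act s (fst z))) * (u (snd z) * p (act s (snd z))))"
        and 2: "(\<integral>z. (u (fst z) * p (act s (fst z))) * (u (snd z) * p (act s (snd z))) \<partial>?MM) = (\<integral>x. u x * p (act s x) \<partial>M)\<^sup>2"
        if p: "p \<in> P" for p
      proof -
        note [measurable] = pam[OF p]
        have "\<bar>(u (fst z) * p (act s (fst z))) * (u (snd z) * p (act s (snd z)))\<bar> \<le> (1 * 1) * (1 * 1)" for z
          unfolding abs_mult using u1[OF u] p1[OF p] by (intro mult_mono) auto
        then show 1: "integrable ?MM (\<lambda>z. (u (fst z) * p (act s (fst z))) * (u (snd z) * p (act s (snd z))))"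
          by (intro Q.integrable_bounded) auto
        show "(\<integral>z. (u (fst z) * p (act s (fst z))) * (u (snd z) * p (act s (snd z))) \<partial>?MM) = (\<integral>x. u x * p (act s x) \<partial>M)\<^sup>2"
          using pp.integral_fst'[OF 1] by (simp add: power2_eq_square)
      qed
      have "(\<lambda>z. (\<Sum>p\<in>P. p (act s (fst z)) * p (act s (snd z))) * (u (fst z) * u (snd z))) =
        (\<lambda>z. \<Sum>p\<in>P. (u (fst z) * p (act s (fst z))) * (u (snd z) * p (act s (snd z))))"
        by (simp add: sum_distrib_left mult_ac)
      then show "(\<integral>z. (\<Sum>p\<in>P. p (act s (fst z)) * p (act s (snd z))) * (u (fst z) * u (snd z)) \<partial>?MM) =
        (\<Sum>p\<in>P. (\<integral>x. u x * p (act s x) \<partial>M)\<^sup>2)"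
        using 1 2 by (simp add: Bochner_Integration.integral_sum)
    qed
    moreover have "e\<^sup>2 \<le> (\<Sum>u\<in>U. \<Sum>p\<in>P. (\<integral>x. u x * p (act s x) \<partial>M)\<^sup>2)"
    proof -
      obtain u p where up: "u \<in> U" "p \<in> P" "e \<le> \<bar>\<integral>x. u x * p (act s x) \<partial>M\<bar>" using big[OF base] by blast
      have "e\<^sup>2 \<le> (\<integral>x. u x * p (act s x) \<partial>M)\<^sup>2" using power_mono[OF up(3), of 2] e by simp
      also have "\<dots> \<le> (\<Sum>p\<in>P. (\<integral>x. u x * p (act s x) \<partial>M)\<^sup>2)"
        using up(2) finP by (intro member_le_sum) auto
      also have "\<dots> \<le> (\<Sum>u\<in>U. \<Sum>p\<in>P. (\<integral>x. u x * p (act s x) \<partial>M)\<^sup>2)"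
        using up(1) U(1) by (intro member_le_sum[of u U "\<lambda>u. \<Sum>p\<in>P. (\<integral>x. u x * p (act s x) \<partial>M)\<^sup>2"]) (auto intro: sum_nonneg)
      finally show ?thesis .
    qed
    ultimately show ?case by simp
  next
    case (mid k l)
    have "\<Phi> (\<lambda>z. (k z + l z) / 2) = (\<Sum>u\<in>U. ((\<integral>z. k z * (u (fst z) * u (snd z)) \<partial>?MM) + (\<integral>z. l z * (u (fst z) * u (snd z)) \<partial>?MM)) / 2)"
      unfolding \<Phi>_def
    proof (rule sum.cong[OF refl])
      fix u assume u: "u \<in> U"
      have "(\<lambda>z. (k z + l z) / 2 * (u (fst z) * u (snd z))) =
        (\<lambda>z. (k z * (u (fst z) * u (snd z)) + l z * (u (fst z) * u (snd z))) / 2)"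
        by (simp add: fun_eq_iff distrib_right)
      then show "(\<integral>z. (k z + l z) / 2 * (u (fst z) * u (snd z)) \<partial>?MM) =
        ((\<integral>z. k z * (u (fst z) * u (snd z)) \<partial>?MM) + (\<integral>z. l z * (u (fst z) * u (snd z)) \<partial>?MM)) / 2"
        using iu[OF mid.hyps(1) u] iu[OF mid.hyps(2) u] by simp
    qed
    also have "\<dots> = (\<Phi> k + \<Phi> l) / 2"
      by (simp add: \<Phi>_def sum.distrib flip: sum_divide_distrib)
    finally show ?case using mid.IH by simp
  qed
  note low = this
  from kernel_minimizing_sequence[OF P] obtain k where k0: "\<forall>n::nat. k n \<in> kernels P"
    "\<forall>n m. n \<le> m \<longrightarrow> (\<integral>z. \<bar>k n z - k m z\<bar> \<partial>?MM) \<le> 2 * (1/2)^n"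
    "\<forall>n. \<forall>t\<in>carrier G. (\<integral>z. \<bar>k n (map_prod (act t) (act t) z) - k n z\<bar> \<partial>?MM) \<le> 2 * (1/2)^n"
    by (elim exE conjE) (rule that)
  note k = k0(1)[rule_format] k0(2)[rule_format] k0(3)[rule_format]
  have "(\<lambda>n. \<Phi> (k n)) \<longlonglongrightarrow> (\<Sum>u\<in>U. 0)"
    unfolding \<Phi>_def using kernel_orth_tendsto_0[OF P k(1) k(2) k(3) U(2)] by (intro tendsto_sum) auto
  then have "e\<^sup>2 \<le> 0" using low[OF k(1)] by (intro LIMSEQ_le_const[of "\<lambda>n. \<Phi> (k n)"]) auto
  then show False using e by simp
qed

text \<open>
  Multiplying \<open>s\<close> by \<open>t\<^sup>-\<^sup>1\<close> only moves the test function. This lets one good \<open>s\<close> produce many good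
  elements and so avoid any prescribed finite set.
\<close>
lemma translate_test:
  fixes u p :: "'a \<Rightarrow> real"
  assumes s: "s \<in> carrier G" and t: "t \<in> carrier G"
    and m: "u \<in> borel_measurable M" "p \<in> borel_measurable M"
  shows "(\<integral>x. u (act (s \<otimes> inv t) x) * p x \<partial>M) = (\<integral>x. u (act s x) * p (act t x) \<partial>M)"
proof -
  have c: "s \<otimes> inv t \<in> carrier G" using s t by simp
  note [measurable] = act_borel[OF c m(1)] m(2)
  have "(\<integral>x. u (act (s \<otimes> inv t) x) * p x \<partial>M) = (\<integral>x. u (act (s \<otimes> inv t) (act t x)) * p (act t x) \<partial>M)"
    using act_integral[OF t, of "\<lambda>x. u (act (s \<otimes> inv t) x) * p x"] by simp
  also have "(\<lambda>x. act (s \<otimes> inv t) (act t x)) = act s"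
    using act_mult[OF c t] s t by (simp add: fun_eq_iff m_assoc)
  then have "(\<integral>x. u (act (s \<otimes> inv t) (act t x)) * p (act t x) \<partial>M) = (\<integral>x. u (act s x) * p (act t x) \<partial>M)"
    by (simp add: fun_eq_iff)
  finally show ?thesis .
qed

lemma translate_osc:
  fixes f :: "'a \<Rightarrow> real"
  assumes s: "s \<in> carrier G" and t: "t \<in> carrier G" and f: "f \<in> borel_measurable M"
  shows "(\<integral>x. \<bar>f (act (s \<otimes> inv t) x) - f x\<bar> \<partial>M) = osc f s t"
proof -
  have c: "s \<otimes> inv t \<in> carrier G" using s t by simp
  note [measurable] = act_borel[OF c f] f
  have "act (s \<otimes> inv t) (act t x) = act s x" for x
    using act_mult[OF c t, of x] s t by (simp add: m_assoc)
  then show ?thesis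
    using act_integral[OF t, of "\<lambda>x. \<bar>f (act (s \<otimes> inv t) x) - f x\<bar>"] by (simp add: osc_def)
qed

lemma translate_avoids:
  assumes "finite E" "s \<in> carrier G" "T \<subseteq> carrier G" "card T = Suc (card E)"
  shows "\<exists>t\<in>T. s \<otimes> inv t \<notin> E"
proof (rule ccontr)
  assume "\<not> ?thesis"
  then have "(\<lambda>t. s \<otimes> inv t) ` T \<subseteq> E" by auto
  moreover have "inj_on (\<lambda>t. s \<otimes> inv t) T"
  proof (rule inj_onI)
    fix x y assume xy: "x \<in> T" "y \<in> T" "s \<otimes> inv x = s \<otimes> inv y"
    then have c: "x \<in> carrier G" "y \<in> carrier G" using assms(3) by auto
    then have "inv x = inv y" using xy(3) assms(2) by (simp add: c)
    then show "x = y" using c by (metis inv_inv)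
  qed
  ultimately have "card T \<le> card E" using assms(1) by (metis card_image card_mono)
  then show False using assms(4) by simp
qed

lemma tests_translate:
  assumes "tests P" "finite T" "T \<subseteq> carrier G"
  shows "tests (\<Union>p\<in>P. \<Union>t\<in>T. {\<lambda>x. p (act t x)})"
  using assms act_borel by (auto simp: tests_def subset_iff)

lemma weak_mixing_avoiding:
  assumes P: "tests P" and U: "finite U" "\<And>u. u \<in> U \<Longrightarrow> orth u" and e: "e > 0"
    and E: "finite E" and inf: "infinite (carrier G)"
  shows "\<exists>s\<in>carrier G - E. \<forall>u\<in>U. \<forall>p\<in>P. \<bar>\<integral>x. u (act s x) * p x \<partial>M\<bar> < e"
proof -
  obtain T where T: "T \<subseteq> carrier G" "finite T" "card T = Suc (card E)"
    using infinite_arbitrarily_large[OF inf] by metis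
  obtain s where s: "s \<in> carrier G" "\<forall>u\<in>U. \<forall>p\<in>(\<Union>p\<in>P. \<Union>t\<in>T. {\<lambda>x. p (act t x)}). \<bar>\<integral>x. u (act s x) * p x \<partial>M\<bar> < e"
    using weak_mixing[OF tests_translate[OF P T(2,1)] U e] by blast
  obtain t where t: "t \<in> T" "s \<otimes> inv t \<notin> E" using translate_avoids[OF E s(1) T(1,3)] by blast
  have "\<bar>\<integral>x. u (act (s \<otimes> inv t) x) * p x \<partial>M\<bar> < e" if "u \<in> U" "p \<in> P" for u p
    using translate_test[OF s(1), of t u p] t T(1) that U(2)[OF that(1)] P s(2)
    by (auto simp: orth_def tests_def)
  then show ?thesis using t s(1) T(1) by (intro bexI[of _ "s \<otimes> inv t"]) auto
qed

text \<open>
  Elements of finite colour classes are avoided first. Then \<open>s\<close> lies in an infinite class, and \<open>s t\<^sup>-\<^sup>1\<close>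
  with \<open>t\<close> of the same colour almost fixes all functions in \<open>FS\<close>. There are enough such \<open>t\<close> to
  avoid \<open>E\<close> as well.
\<close>
lemma selection:
  assumes P: "tests P" and U: "finite U" "\<And>u. u \<in> U \<Longrightarrow> orth u" and e: "e > 0"
    and FS: "finite FS" "\<And>f. f \<in> FS \<Longrightarrow> ap f"
    and E: "finite E" and inf: "infinite (carrier G)"
  shows "\<exists>s\<in>carrier G - E. (\<forall>u\<in>U. \<forall>p\<in>P. \<bar>\<integral>x. u (act s x) * p x \<partial>M\<bar> < e) \<and>
    (\<forall>f\<in>FS. (\<integral>x. \<bar>f (act s x) - f x\<bar> \<partial>M) < e)"
proof -
  obtain h :: "'g \<Rightarrow> nat" where h: "finite (h ` carrier G)"
    "\<And>f s t. f \<in> FS \<Longrightarrow> s \<in> carrier G \<Longrightarrow> t \<in> carrier G \<Longrightarrow> h s = h t \<Longrightarrow> osc f s t < e"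
    using ap_joint[OF FS(1), of "\<lambda>f. f" e] FS(2) e by metis
  define cl where "cl c = {t \<in> carrier G. h t = c}" for c
  define E' where "E' = (\<Union>c\<in>{c \<in> h ` carrier G. finite (cl c)}. cl c)"
  have "finite E'" unfolding E'_def using h(1) by auto
  have "\<exists>T. infinite (cl c) \<longrightarrow> T \<subseteq> cl c \<and> finite T \<and> card T = Suc (card E)" for c
    using infinite_arbitrarily_large[of "cl c"] by metis
  then obtain T where T: "\<And>c. infinite (cl c) \<Longrightarrow> T c \<subseteq> cl c \<and> finite (T c) \<and> card (T c) = Suc (card E)"
    by metis
  define TT where "TT = (\<Union>c\<in>{c \<in> h ` carrier G. infinite (cl c)}. T c)"
  have TT: "finite TT" "TT \<subseteq> carrier G" unfolding TT_def using h(1) T by (auto simp: cl_def)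
  obtain s where s: "s \<in> carrier G" "s \<notin> E'"
    "\<forall>u\<in>U. \<forall>p\<in>(\<Union>p\<in>P. \<Union>t\<in>TT. {\<lambda>x. p (act t x)}). \<bar>\<integral>x. u (act s x) * p x \<partial>M\<bar> < e"
    using weak_mixing_avoiding[OF tests_translate[OF P TT] U e \<open>finite E'\<close> inf] by blast
  have ic: "infinite (cl (h s))" using s(1,2) by (auto simp: E'_def cl_def)
  have Ts: "T (h s) \<subseteq> carrier G" "card (T (h s)) = Suc (card E)" using T[OF ic] by (auto simp: cl_def)
  obtain t where t: "t \<in> T (h s)" "s \<otimes> inv t \<notin> E" using translate_avoids[OF E s(1) Ts] by blast
  have tc: "t \<in> carrier G" "h s = h t" using t T[OF ic] by (auto simp: cl_def)
  have tT: "t \<in> TT" using t ic s(1) by (auto simp: TT_def)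
  have "\<bar>\<integral>x. u (act (s \<otimes> inv t) x) * p x \<partial>M\<bar> < e" if "u \<in> U" "p \<in> P" for u p
    using translate_test[OF s(1) tc(1), of u p] tT that U(2)[OF that(1)] P s(3)
    by (auto simp: orth_def tests_def)
  moreover have "(\<integral>x. \<bar>f (act (s \<otimes> inv t) x) - f x\<bar> \<partial>M) < e" if "f \<in> FS" for f
    using translate_osc[OF s(1) tc(1) ap_measurable[OF FS(2)[OF that]]] h(2)[OF that s(1) tc] by simp
  ultimately show ?thesis using t(2) s(1) tc(1) by (intro bexI[of _ "s \<otimes> inv t"]) auto
qed

text \<open>
  Induction on \<open>n\<close>. The new element \<open>s\<close> is chosen so that \<open>A - F\<close>, translated by \<open>s\<close>, hardly correlates
  with any product built so far, while \<open>F\<close> is hardly moved. So a factor \<open>A\<close> at \<open>s\<close> can be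
  replaced by the factor \<open>F\<close> without translation. The induction hypothesis has to be used for the
  test functions multiplied by the functions \<open>F i\<close>, which is why the tests are arbitrary.
\<close>
lemma independent_translates:
  fixes A F :: "'l \<Rightarrow> 'a \<Rightarrow> real"
  assumes L: "finite L"
    and A: "\<And>i. i \<in> L \<Longrightarrow> A i \<in> borel_measurable M" "\<And>i x. i \<in> L \<Longrightarrow> 0 \<le> A i x \<and> A i x \<le> 1"
    and F: "\<And>i. i \<in> L \<Longrightarrow> ap (F i)" "\<And>i x. i \<in> L \<Longrightarrow> 0 \<le> F i x \<and> F i x \<le> 1"
    and AF: "\<And>i. i \<in> L \<Longrightarrow> orth (\<lambda>x. A i x - F i x)"
    and inf: "infinite (carrier G)"
    and H: "tests H" and e: "e > 0"
  shows "\<exists>S. S \<subseteq> carrier G \<and> finite S \<and> card S = n \<and> (\<forall>h\<in>H. \<forall>w\<in>S \<rightarrow> L.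
    \<bar>(\<integral>x. h x * (\<Prod>s\<in>S. A (w s) (act s x)) \<partial>M) - (\<integral>x. h x * (\<Prod>s\<in>S. F (w s) x) \<partial>M)\<bar> < e)"
  using H e
proof (induction n arbitrary: H e)
  case 0
  then show ?case by (intro exI[of _ "{}"]) auto
next
  case (Suc n)
  note Fm = ap_measurable[OF F(1)]
  have prod1: "\<bar>\<Prod>s\<in>S. f s\<bar> \<le> 1" if "\<And>s. s \<in> S \<Longrightarrow> 0 \<le> f s \<and> f s \<le> (1::real)" for f and S :: "'g set"
    using that prod_nonneg[of S f] by (simp add: abs_of_nonneg prod_le_1)
  have mult1: "\<bar>a * b\<bar> \<le> 1" if "\<bar>a\<bar> \<le> 1" "\<bar>b\<bar> \<le> (1::real)" for a b
    using that by (simp add: abs_mult mult_le_one)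
  define H' where "H' = (\<Union>h\<in>H. \<Union>i\<in>L. {\<lambda>x. h x * F i x})"
  have tH': "tests H'"
    using Suc.prems(1) L F(2) Fm unfolding tests_def H'_def by (auto intro!: mult1 simp: abs_of_nonneg)
  have e3: "e/3 > 0" using Suc.prems(2) by simp
  obtain S where S: "S \<subseteq> carrier G" "finite S" "card S = n" and
    SH: "\<And>h w. h \<in> H' \<Longrightarrow> w \<in> S \<rightarrow> L \<Longrightarrow>
    \<bar>(\<integral>x. h x * (\<Prod>s\<in>S. A (w s) (act s x)) \<partial>M) - (\<integral>x. h x * (\<Prod>s\<in>S. F (w s) x) \<partial>M)\<bar> < e/3"
    using Suc.IH[OF tH' e3] by blast
  have Hm: "h \<in> borel_measurable M" and H1: "\<bar>h x\<bar> \<le> 1" if "h \<in> H" for h x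
    using Suc.prems(1) that by (auto simp: tests_def)
  define q where "q h w x = h x * (\<Prod>s\<in>S. A (w s) (act s x))" for h w x
  have qm: "q h w \<in> borel_measurable M" if "h \<in> H" "w \<in> S \<rightarrow> L" for h w
    unfolding q_def using that S(1) Hm A(1)
    by (intro borel_measurable_times borel_measurable_prod act_borel) auto
  have q1: "\<bar>q h w x\<bar> \<le> 1" if "h \<in> H" "w \<in> S \<rightarrow> L" for h w x
    unfolding q_def using H1[OF that(1)] A(2)[OF funcset_mem[OF that(2)]] by (intro mult1 prod1) auto
  define P where "P = (\<Union>h\<in>H. \<Union>w\<in>PiE S (\<lambda>_. L). {q h w})"
  have fin: "finite (PiE S (\<lambda>_. L))" using S(2) L by (intro finite_PiE) auto
  have tP: "tests P"
    using Suc.prems(1) fin qm q1 unfolding tests_def P_def by (auto simp: PiE_def)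
  have fU: "finite ((\<lambda>i x. A i x - F i x) ` L)" "\<And>u. u \<in> (\<lambda>i x. A i x - F i x) ` L \<Longrightarrow> orth u" using L AF by auto
  have fF: "finite (F ` L)" "\<And>f. f \<in> F ` L \<Longrightarrow> ap f" using L F by auto
  obtain s where s: "s \<in> carrier G" "s \<notin> S"
    "\<And>i p. i \<in> L \<Longrightarrow> p \<in> P \<Longrightarrow> \<bar>\<integral>x. (A i (act s x) - F i (act s x)) * p x \<partial>M\<bar> < e/3"
    "\<And>i. i \<in> L \<Longrightarrow> (\<integral>x. \<bar>F i (act s x) - F i x\<bar> \<partial>M) < e/3"
  proof -
    have "\<exists>s\<in>carrier G - S. (\<forall>u\<in>(\<lambda>i x. A i x - F i x) ` L. \<forall>p\<in>P. \<bar>\<integral>x. u (act s x) * p x \<partial>M\<bar> < e/3) \<and>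
        (\<forall>f\<in>F ` L. (\<integral>x. \<bar>f (act s x) - f x\<bar> \<partial>M) < e/3)"
      by (rule selection[OF tP fU(1) _ e3 fF(1) _ S(2) inf]) (fact fU(2) fF(2))+
    then obtain s where "s \<in> carrier G - S"
      and 1: "\<forall>u\<in>(\<lambda>i x. A i x - F i x) ` L. \<forall>p\<in>P. \<bar>\<integral>x. u (act s x) * p x \<partial>M\<bar> < e/3"
      and 2: "\<forall>f\<in>F ` L. (\<integral>x. \<bar>f (act s x) - f x\<bar> \<partial>M) < e/3"
      by (elim bexE conjE) (rule that)
    then show thesis by (intro that[of s]) simp_all
  qed
  have "\<bar>(\<integral>x. h x * (\<Prod>s\<in>insert s S. A (w s) (act s x)) \<partial>M) - (\<integral>x. h x * (\<Prod>s\<in>insert s S. F (w s) x) \<partial>M)\<bar> < e"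
    if h: "h \<in> H" and w: "w \<in> insert s S \<rightarrow> L" for h w
  proof -
    have i: "w s \<in> L" and wS: "w \<in> S \<rightarrow> L" using w by auto
    have qP: "q h w \<in> P"
    proof -
      have "q h w = q h (restrict w S)" unfolding q_def by (auto simp: fun_eq_iff intro!: prod.cong)
      moreover have "restrict w S \<in> PiE S (\<lambda>_. L)" using wS by auto
      ultimately show ?thesis using h unfolding P_def by blast
    qed
    note qm' = qm[OF h wS] and q1' = q1[OF h wS]
    note [measurable] = qm' act_borel[OF s(1) A(1)[OF i]] act_borel[OF s(1) Fm[OF i]] Fm[OF i]
    have A01: "\<bar>A (w s) x\<bar> \<le> 1" "\<bar>F (w s) x\<bar> \<le> 1" for x using A(2)[OF i] F(2)[OF i] by (auto simp: abs_le_iff intro: order_trans)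
    have AF1: "\<bar>A (w s) x - F (w s) x\<bar> \<le> 1" for x using AF[OF i] by (auto simp: orth_def)
    have i1: "integrable M (\<lambda>x. (A (w s) (act s x) - F (w s) (act s x)) * q h w x)"
      using AF1 q1' by (intro integrable_bounded[of _ 1] mult1) auto
    have i2: "integrable M (\<lambda>x. F (w s) (act s x) * q h w x)"
      using A01 q1' by (intro integrable_bounded[of _ 1] mult1) auto
    have i3: "integrable M (\<lambda>x. F (w s) x * q h w x)"
      using A01 q1' by (intro integrable_bounded[of _ 1] mult1) auto
    have iF: "integrable M (\<lambda>x. \<bar>F (w s) (act s x) - F (w s) x\<bar>)"
      using act_integrable[OF s(1) ap_integrable[OF F(1)[OF i]]] ap_integrable[OF F(1)[OF i]] by simp
    define a1 where "a1 = (\<integral>x. (A (w s) (act s x) - F (w s) (act s x)) * q h w x \<partial>M)"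
    define a2 where "a2 = (\<integral>x. (F (w s) (act s x) - F (w s) x) * q h w x \<partial>M)"
    define a3 where "a3 = (\<integral>x. F (w s) x * q h w x \<partial>M)"
    have "(\<integral>x. h x * (\<Prod>s\<in>insert s S. A (w s) (act s x)) \<partial>M) = (\<integral>x. A (w s) (act s x) * q h w x \<partial>M)"
      using S(2) s(2) by (simp add: q_def mult_ac)
    also have "\<dots> = a1 + (\<integral>x. F (w s) (act s x) * q h w x \<partial>M)"
    proof -
      have "(\<integral>x. A (w s) (act s x) * q h w x \<partial>M) = (\<integral>x. (A (w s) (act s x) - F (w s) (act s x)) * q h w x + F (w s) (act s x) * q h w x \<partial>M)"
        by (simp add: left_diff_distrib)
      then show ?thesis using i1 i2 by (simp add: a1_def)
    qed
    also have "(\<integral>x. F (w s) (act s x) * q h w x \<partial>M) = a2 + a3"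
      using i2 i3 by (simp add: a2_def a3_def left_diff_distrib)
    finally have 1: "(\<integral>x. h x * (\<Prod>s\<in>insert s S. A (w s) (act s x)) \<partial>M) = a1 + (a2 + a3)" .
    have b1: "\<bar>a1\<bar> < e/3" using s(3)[OF i qP] by (simp add: a1_def)
    have "\<bar>a2\<bar> \<le> (\<integral>x. \<bar>(F (w s) (act s x) - F (w s) x) * q h w x\<bar> \<partial>M)" unfolding a2_def by (rule integral_abs_bound)
    also have "\<dots> \<le> (\<integral>x. \<bar>F (w s) (act s x) - F (w s) x\<bar> \<partial>M)"
    proof (rule integral_mono)
      show "integrable M (\<lambda>x. \<bar>(F (w s) (act s x) - F (w s) x) * q h w x\<bar>)"
        using i2 i3 by (intro Bochner_Integration.integrable_abs) (simp add: left_diff_distrib)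
      show "\<bar>(F (w s) (act s x) - F (w s) x) * q h w x\<bar> \<le> \<bar>F (w s) (act s x) - F (w s) x\<bar>" for x
        unfolding abs_mult using q1' by (intro mult_left_le) auto
    qed (rule iF)
    also have "\<dots> < e/3" by (rule s(4)[OF i])
    finally have b2: "\<bar>a2\<bar> < e/3" .
    have "(\<lambda>x. h x * F (w s) x) \<in> H'" using h i by (auto simp: H'_def)
    from SH[OF this wS] have "\<bar>(\<integral>x. h x * F (w s) x * (\<Prod>s\<in>S. A (w s) (act s x)) \<partial>M) - (\<integral>x. h x * F (w s) x * (\<Prod>s\<in>S. F (w s) x) \<partial>M)\<bar> < e/3" .
    moreover have "(\<integral>x. h x * F (w s) x * (\<Prod>s\<in>S. A (w s) (act s x)) \<partial>M) = a3"
      by (simp add: a3_def q_def mult_ac)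
    moreover have "(\<integral>x. h x * F (w s) x * (\<Prod>s\<in>S. F (w s) x) \<partial>M) = (\<integral>x. h x * (\<Prod>s\<in>insert s S. F (w s) x) \<partial>M)"
      using S(2) s(2) by (simp add: mult_ac)
    ultimately show ?thesis unfolding 1 using b1 b2 by linarith
  qed
  moreover have "card (insert s S) = Suc n" using S s by simp
  ultimately show ?case using S s(1) by (intro exI[of _ "insert s S"]) auto
qed

end

section \<open>Families of words without large shattered sets\<close>

text \<open>
  A letter \<open>(l, b)\<close> with \<open>b = True\<close> is starred, which means that its position is discarded. The
  relation \<open>R l c\<close> says that the letter \<open>l\<close> admits the label \<open>c\<close>; letters may admit several labels.
\<close>
definition shattered :: "('l \<Rightarrow> 'c \<Rightarrow> bool) \<Rightarrow> 'c set \<Rightarrow> ('g \<Rightarrow> 'l \<times> bool) set \<Rightarrow> 'g set \<Rightarrow> bool" where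
  "shattered R C S I \<longleftrightarrow> (\<forall>\<sigma>\<in>I \<rightarrow> C. \<exists>v\<in>S. \<forall>s\<in>I. \<not> snd (v s) \<and> R (fst (v s)) (\<sigma> s))"

lemma shattered_update:
  assumes I: "shattered R C S' I" "q \<notin> I" and upd: "\<And>v. v \<in> S' \<Longrightarrow> \<exists>e. v(q := e) \<in> S"
  shows "shattered R C S I"
  unfolding shattered_def
proof
  fix \<sigma> assume "\<sigma> \<in> I \<rightarrow> C"
  then obtain v where v: "v \<in> S'" "\<forall>s\<in>I. \<not> snd (v s) \<and> R (fst (v s)) (\<sigma> s)"
    using I(1) by (auto simp: shattered_def)
  obtain e where "v(q := e) \<in> S" using upd[OF v(1)] by blast
  then show "\<exists>v\<in>S. \<forall>s\<in>I. \<not> snd (v s) \<and> R (fst (v s)) (\<sigma> s)"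
    using v(2) I(2) by (intro bexI[of _ "v(q := e)"]) auto
qed

text \<open>
  A weighted Sauer--Shelah estimate, by induction on the positions. Split the words by their letter at
  a new position \<open>q\<close>. Starred letters use up one star. For unstarred letters a remainder \<open>v\<close> either
  extends, for every label, by a letter that admits the label, and the sets shattered by such
  remainders stay shattered after adding \<open>q\<close>; or the letters extending \<open>v\<close> all miss one common
  label and thus have total weight at most \<open>1 - \<beta>\<close>. The base \<open>4/\<beta>\<close> is chosen such that the three resulting terms add up to
  \<open>\<beta>/4 + (1 - \<beta>) + \<beta>/4 = 1 - \<beta>/2\<close> times the bound.
\<close>
lemma unshattered_weight_le:
  fixes p :: "'l \<Rightarrow> real" and S :: "('g \<Rightarrow> 'l \<times> bool) set"
  assumes L: "finite L" "\<And>a. a \<in> L \<Longrightarrow> 0 \<le> p a" "sum p L \<le> 1"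
    and C: "C \<noteq> {}" "\<And>c. c \<in> C \<Longrightarrow> sum p {a\<in>L. \<not> R a c} \<le> 1 - \<beta>"
    and \<beta>: "0 < \<beta>" "\<beta> \<le> 1"
    and F: "finite F" and S: "S \<subseteq> PiE F (\<lambda>_. L \<times> UNIV)"
    and stars: "\<And>v. v \<in> S \<Longrightarrow> card {s\<in>F. snd (v s)} \<le> t"
    and unsh: "\<And>I. I \<subseteq> F \<Longrightarrow> shattered R C S I \<Longrightarrow> card I < d"
  shows "(\<Sum>v\<in>S. \<Prod>s\<in>F. p (fst (v s))) \<le> (1 - \<beta>/2) ^ card F * (4/\<beta>) ^ (d + t)"
  using F S stars unsh
proof (induction F arbitrary: S d t)
  case empty
  have S: "S \<subseteq> {\<lambda>_. undefined}" using empty.prems(1) by simp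
  then have "(\<Sum>v\<in>S. \<Prod>s\<in>{}. p (fst (v s))) \<le> 1" by (auto simp: card_mono[OF _ S, simplified])
  also have "1 \<le> (4/\<beta>) ^ (d + t)" using \<beta> by (intro one_le_power) simp
  finally show ?case by simp
next
  case (insert q F)
  define E :: "('l \<times> bool) set" where "E = L \<times> UNIV"
  define W where "W v = (\<Prod>s\<in>F. p (fst (v s)))" for v :: "'g \<Rightarrow> 'l \<times> bool"
  define B where "B d t = (1 - \<beta>/2) ^ card F * (4/\<beta>) ^ (d + t)" for d t
  have finE: "finite E" using L by (simp add: E_def)
  have finP: "finite (PiE F (\<lambda>_. E))" using insert.hyps(1) finE by (intro finite_PiE) auto
  have W0: "0 \<le> W v" if "v \<in> PiE F (\<lambda>_. E)" for v
    unfolding W_def using that L(2) by (intro prod_nonneg) (auto simp: E_def PiE_iff mem_Times_iff)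
  have B0: "0 \<le> B d t" for d t using \<beta> by (simp add: B_def)
  show ?case
  proof (cases "S = {}")
    case True then show ?thesis using \<beta> by simp
  next
    case False
    then have "shattered R C S {}" by (auto simp: shattered_def)
    then have "0 < d" using insert.prems(3)[of "{}"] by simp
    then obtain d' where d': "d = Suc d'" by (cases d) auto
    define S1 where "S1 = {v \<in> PiE F (\<lambda>_. E). \<exists>a\<in>L. v(q := (a, True)) \<in> S}"
    define S0 where "S0 = {v \<in> PiE F (\<lambda>_. E). \<exists>a\<in>L. v(q := (a, False)) \<in> S}"
    define SR where "SR = {v \<in> PiE F (\<lambda>_. E). \<forall>c\<in>C. \<exists>a\<in>L. R a c \<and> v(q := (a, False)) \<in> S}"
    have sub: "S1 \<subseteq> PiE F (\<lambda>_. E)" "S0 \<subseteq> PiE F (\<lambda>_. E)" "SR \<subseteq> PiE F (\<lambda>_. E)"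
      by (auto simp: S1_def S0_def SR_def)
    have st: "card {s\<in>F. snd (v s)} + (if b then 1 else 0) \<le> t" if "v(q := (a, b)) \<in> S" for v a b
    proof -
      have "{s \<in> insert q F. snd ((v(q := (a, b))) s)} = (if b then insert q {s\<in>F. snd (v s)} else {s\<in>F. snd (v s)})"
        using insert.hyps(2) by auto
      then show ?thesis using insert.prems(2)[OF that] insert.hyps by (auto split: if_splits)
    qed
    have b1: "(\<Sum>v\<in>S1. W v) \<le> B d t / (4/\<beta>)"
    proof (cases "S1 = {}")
      case True then show ?thesis using B0 \<beta> by simp
    next
      case False
      then obtain v a where "v(q := (a, True)) \<in> S" by (auto simp: S1_def)
      then have "0 < t" using st[of v a True] by simp
      then obtain t' where t': "t = Suc t'" by (cases t) auto
      have "(\<Sum>v\<in>S1. W v) \<le> B d t'"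
        unfolding W_def B_def
      proof (rule insert.IH[OF sub(1)[unfolded E_def]])
        show "card {s\<in>F. snd (v s)} \<le> t'" if "v \<in> S1" for v
          using that st[of v _ True] by (auto simp: S1_def t')
        fix I assume I: "I \<subseteq> F" "shattered R C S1 I"
        then have "q \<notin> I" using insert.hyps by auto
        then have "shattered R C S I" by (rule shattered_update[OF I(2)]) (auto simp: S1_def)
        then show "card I < d" using insert.prems(3)[of I] I(1) by auto
      qed
      also have "\<dots> = B d t / (4/\<beta>)" using \<beta> by (simp add: B_def t')
      finally show ?thesis .
    qed
    have b0: "(\<Sum>v\<in>S0. W v) \<le> B d t"
      unfolding W_def B_def
    proof (rule insert.IH[OF sub(2)[unfolded E_def]])
      show "card {s\<in>F. snd (v s)} \<le> t" if "v \<in> S0" for v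
        using that st[of v _ False] by (auto simp: S0_def)
      fix I assume I: "I \<subseteq> F" "shattered R C S0 I"
      then have "q \<notin> I" using insert.hyps by auto
      then have "shattered R C S I" by (rule shattered_update[OF I(2)]) (auto simp: S0_def)
      then show "card I < d" using insert.prems(3)[of I] I(1) by auto
    qed
    have bR: "(\<Sum>v\<in>SR. W v) \<le> B d t / (4/\<beta>)"
    proof -
      have "(\<Sum>v\<in>SR. W v) \<le> B d' t"
        unfolding W_def B_def
      proof (rule insert.IH[OF sub(3)[unfolded E_def]])
        show "card {s\<in>F. snd (v s)} \<le> t" if "v \<in> SR" for v
          using that C(1) st[of v _ False] by (fastforce simp: SR_def)
        fix I assume I: "I \<subseteq> F" "shattered R C SR I"
        have qI: "q \<notin> I" using I(1) insert.hyps by auto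
        have "shattered R C S (insert q I)"
          unfolding shattered_def
        proof
          fix \<sigma> assume \<sigma>: "\<sigma> \<in> insert q I \<rightarrow> C"
          then obtain v where v: "v \<in> SR" "\<forall>s\<in>I. \<not> snd (v s) \<and> R (fst (v s)) (\<sigma> s)"
            using I(2) by (auto simp: shattered_def)
          obtain a where "a \<in> L" "R a (\<sigma> q)" "v(q := (a, False)) \<in> S"
            using v(1) \<sigma> by (auto simp: SR_def)
          then show "\<exists>v\<in>S. \<forall>s\<in>insert q I. \<not> snd (v s) \<and> R (fst (v s)) (\<sigma> s)"
            using v(2) qI by (intro bexI[of _ "v(q := (a, False))"]) auto
        qed
        then have "card (insert q I) < d" using I(1) by (intro insert.prems(3)) auto
        moreover have "finite I" using I(1) insert.hyps(1) by (rule finite_subset)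
        ultimately show "card I < d'" using qI by (simp add: d')
      qed
      also have "\<dots> = B d t / (4/\<beta>)" using \<beta> by (simp add: B_def d')
      finally show ?thesis .
    qed
    have point: "(\<Sum>e\<in>E. if v(q := e) \<in> S then p (fst e) else 0) \<le>
        (if v \<in> S1 then 1 else 0) + (1 - \<beta>) * (if v \<in> S0 then 1 else 0) + (if v \<in> SR then 1 else 0)"
      if v: "v \<in> PiE F (\<lambda>_. E)" for v
    proof -
      have "(\<Sum>e\<in>E. if v(q := e) \<in> S then p (fst e) else 0) =
        (\<Sum>a\<in>L. \<Sum>b\<in>UNIV. if v(q := (a, b)) \<in> S then p a else 0)"
        unfolding E_def by (subst sum.cartesian_product) (auto intro!: sum.cong)
      also have "\<dots> = (\<Sum>a\<in>L. if v(q := (a, True)) \<in> S then p a else 0) + (\<Sum>a\<in>L. if v(q := (a, False)) \<in> S then p a else 0)"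
        by (simp add: UNIV_bool sum.distrib add.commute)
      also have "(\<Sum>a\<in>L. if v(q := (a, True)) \<in> S then p a else 0) \<le> (if v \<in> S1 then 1 else 0)"
      proof (cases "v \<in> S1")
        case True
        have "(\<Sum>a\<in>L. if v(q := (a, True)) \<in> S then p a else 0) \<le> sum p L"
          using L(2) by (intro sum_mono) auto
        then show ?thesis using True L(3) by simp
      next
        case False
        then have "v(q := (a, True)) \<notin> S" if "a \<in> L" for a using v that by (auto simp: S1_def)
        then show ?thesis using False by simp
      qed
      also have "(\<Sum>a\<in>L. if v(q := (a, False)) \<in> S then p a else 0) \<le>
        (1 - \<beta>) * (if v \<in> S0 then 1 else 0) + (if v \<in> SR then 1 else 0)"
      proof (cases "v \<in> SR")
        case True
        have "(\<Sum>a\<in>L. if v(q := (a, False)) \<in> S then p a else 0) \<le> sum p L"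
          using L(2) by (intro sum_mono) auto
        moreover have "0 \<le> (1 - \<beta>) * (if v \<in> S0 then 1 else 0)" using \<beta> by simp
        ultimately show ?thesis using True L(3) by simp
      next
        case False
        then obtain c where c: "c \<in> C" "\<And>a. a \<in> L \<Longrightarrow> v(q := (a, False)) \<in> S \<Longrightarrow> \<not> R a c"
          using v by (auto simp: SR_def)
        show ?thesis
        proof (cases "v \<in> S0")
          case True
          have "(\<Sum>a\<in>L. if v(q := (a, False)) \<in> S then p a else 0) \<le> (\<Sum>a\<in>L. if \<not> R a c then p a else 0)"
            using c(2) L(2) by (intro sum_mono) auto
          also have "\<dots> = sum p {a\<in>L. \<not> R a c}" using L(1) by (simp add: sum.inter_filter)
          also have "\<dots> \<le> 1 - \<beta>" using C(2)[OF c(1)] .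
          finally show ?thesis using True False by simp
        next
          case F: False
          then have "v(q := (a, False)) \<notin> S" if "a \<in> L" for a using v that by (auto simp: S0_def)
          then show ?thesis using False F by simp
        qed
      qed
      finally show ?thesis by simp
    qed
    have PE: "PiE (insert q F) (\<lambda>_. E) = (\<lambda>(e, v). v(q := e)) ` (E \<times> PiE F (\<lambda>_. E))"
      by (rule PiE_insert_eq)
    have inj: "inj_on (\<lambda>(e, v). v(q := e)) (E \<times> PiE F (\<lambda>_. E))"
      using inj_combinator[OF insert.hyps(2), of "\<lambda>_. E"] by simp
    have "(\<Sum>v\<in>S. \<Prod>s\<in>insert q F. p (fst (v s))) =
      (\<Sum>v\<in>PiE (insert q F) (\<lambda>_. E). if v \<in> S then \<Prod>s\<in>insert q F. p (fst (v s)) else 0)"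
    proof -
      have fin: "finite (PiE (insert q F) (\<lambda>_. E))" using insert.hyps(1) finE by (intro finite_PiE) auto
      have "S = {v \<in> PiE (insert q F) (\<lambda>_. E). v \<in> S}" using insert.prems(1) by (auto simp: E_def)
      then show ?thesis using sum.inter_filter[OF fin, of "\<lambda>v. \<Prod>s\<in>insert q F. p (fst (v s))" "\<lambda>v. v \<in> S"] by simp
    qed
    also have "\<dots> = (\<Sum>(e, v)\<in>E \<times> PiE F (\<lambda>_. E). if v(q := e) \<in> S then \<Prod>s\<in>insert q F. p (fst ((v(q := e)) s)) else 0)"
      unfolding PE by (subst sum.reindex[OF inj]) (simp add: case_prod_unfold)
    also have "\<dots> = (\<Sum>(e, v)\<in>E \<times> PiE F (\<lambda>_. E). W v * (if v(q := e) \<in> S then p (fst e) else 0))"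
    proof (intro sum.cong refl, clarify)
      fix a b v
      have "(\<Prod>s\<in>F. p (fst ((v(q := (a, b))) s))) = W v"
        unfolding W_def using insert.hyps(2) by (intro prod.cong) auto
      then show "(if v(q := (a, b)) \<in> S then \<Prod>s\<in>insert q F. p (fst ((v(q := (a, b))) s)) else 0) =
          W v * (if v(q := (a, b)) \<in> S then p (fst (a, b)) else 0)"
        using insert.hyps by (simp add: mult.commute del: fun_upd_apply) simp
    qed
    also have "\<dots> = (\<Sum>v\<in>PiE F (\<lambda>_. E). W v * (\<Sum>e\<in>E. if v(q := e) \<in> S then p (fst e) else 0))"
      by (subst sum.cartesian_product[symmetric], subst sum.swap) (simp add: sum_distrib_left)
    also have "\<dots> \<le> (\<Sum>v\<in>PiE F (\<lambda>_. E). W v *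
      ((if v \<in> S1 then 1 else 0) + (1 - \<beta>) * (if v \<in> S0 then 1 else 0) + (if v \<in> SR then 1 else 0)))"
      by (intro sum_mono mult_left_mono point W0)
    also have "\<dots> = (\<Sum>v\<in>S1. W v) + (1 - \<beta>) * (\<Sum>v\<in>S0. W v) + (\<Sum>v\<in>SR. W v)"
    proof -
      have r: "(\<Sum>v\<in>T. W v) = (\<Sum>v\<in>PiE F (\<lambda>_. E). W v * (if v \<in> T then 1 else 0))"
        if "T \<subseteq> PiE F (\<lambda>_. E)" for T
        using finP that by (simp add: sum.If_cases Int_absorb1 if_distrib[of "\<lambda>a. _ * a"] cong: if_cong)
      show ?thesis unfolding r[OF sub(1)] r[OF sub(2)] r[OF sub(3)]
        by (simp add: distrib_left sum.distrib sum_distrib_left mult_ac)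
    qed
    also have "\<dots> \<le> B d t / (4/\<beta>) + (1 - \<beta>) * B d t + B d t / (4/\<beta>)"
      using b1 b0 bR \<beta> by (intro add_mono mult_left_mono) auto
    also have "\<dots> = (1 - \<beta>/2) * B d t" using \<beta> by (simp add: field_simps)
    also have "\<dots> = (1 - \<beta>/2) ^ card (insert q F) * (4/\<beta>) ^ (d + t)"
      using insert.hyps by (simp add: B_def)
    finally show ?thesis .
  qed
qed

section \<open>Lifting from the factors to the product\<close>

locale mp_system_pair = X: mp_system M G a + Y: mp_system N G b
  for M :: "'a measure" and N :: "'b measure" and G :: "('g, 'm) monoid_scheme" (structure)
    and a :: "'g \<Rightarrow> 'a \<Rightarrow> 'a" and b :: "'g \<Rightarrow> 'b \<Rightarrow> 'b"
begin

sublocale P: mp_system "M \<Otimes>\<^sub>M N" G "\<lambda>s. map_prod (a s) (b s)"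
  by (intro mp_system_pair X.mp_system_axioms Y.mp_system_axioms)

sublocale pair_prob_space M N ..

lemma integrable_lift_fst:
  fixes f :: "'a \<Rightarrow> real"
  assumes "integrable M f"
  shows "integrable (M \<Otimes>\<^sub>M N) (\<lambda>z. f (fst z))" "(\<integral>z. f (fst z) \<partial>(M \<Otimes>\<^sub>M N)) = (\<integral>x. f x \<partial>M)"
proof -
  have d: "distr (M \<Otimes>\<^sub>M N) M fst = M" by (rule Y.distr_pair_fst)
  show "integrable (M \<Otimes>\<^sub>M N) (\<lambda>z. f (fst z))"
    using integrable_distr_eq[OF measurable_fst, of f M N] assms d by simp
  show "(\<integral>z. f (fst z) \<partial>(M \<Otimes>\<^sub>M N)) = (\<integral>x. f x \<partial>M)"
    using integral_distr[OF measurable_fst, of f M N] assms d by simp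
qed

lemma distr_snd: "distr (M \<Otimes>\<^sub>M N) N snd = N"
proof (rule measure_eqI)
  fix A assume "A \<in> sets (distr (M \<Otimes>\<^sub>M N) N snd)"
  then have A: "A \<in> sets N" by simp
  have "snd -` A \<inter> space (M \<Otimes>\<^sub>M N) = space M \<times> A"
    using sets.sets_into_space[OF A] by (auto simp: space_pair_measure)
  then show "emeasure (distr (M \<Otimes>\<^sub>M N) N snd) A = emeasure N A"
    using A by (simp add: emeasure_distr Y.emeasure_pair_measure_Times X.emeasure_space_1)
qed simp

lemma integrable_lift_snd:
  fixes f :: "'b \<Rightarrow> real"
  assumes "integrable N f"
  shows "integrable (M \<Otimes>\<^sub>M N) (\<lambda>z. f (snd z))" "(\<integral>z. f (snd z) \<partial>(M \<Otimes>\<^sub>M N)) = (\<integral>y. f y \<partial>N)"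
proof -
  note d = distr_snd
  show "integrable (M \<Otimes>\<^sub>M N) (\<lambda>z. f (snd z))"
    using integrable_distr_eq[OF measurable_snd, of f N M] assms d by simp
  show "(\<integral>z. f (snd z) \<partial>(M \<Otimes>\<^sub>M N)) = (\<integral>x. f x \<partial>N)"
    using integral_distr[OF measurable_snd, of f N M] assms d by simp
qed

lemma ap_lift_fst:
  assumes "X.ap f"
  shows "P.ap (\<lambda>z. f (fst z))"
proof -
  note i = X.ap_integrable[OF assms]
  have "P.osc (\<lambda>z. f (fst z)) s t = X.osc f s t" if "s \<in> carrier G" "t \<in> carrier G" for s t
    using integrable_lift_fst(2)[OF X.osc_integrable[OF i that]] by (simp add: P.osc_def X.osc_def)
  then show ?thesis
    using assms integrable_lift_fst(1)[OF i] unfolding P.ap_def X.ap_def by simp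
qed

lemma ap_lift_snd:
  assumes "Y.ap f"
  shows "P.ap (\<lambda>z. f (snd z))"
proof -
  note i = Y.ap_integrable[OF assms]
  have "P.osc (\<lambda>z. f (snd z)) s t = Y.osc f s t" if "s \<in> carrier G" "t \<in> carrier G" for s t
    using integrable_lift_snd(2)[OF Y.osc_integrable[OF i that]] by (simp add: P.osc_def Y.osc_def)
  then show ?thesis
    using assms integrable_lift_snd(1)[OF i] unfolding P.ap_def Y.ap_def by simp
qed

lemma fubini_bounded:
  fixes k :: "'a \<times> 'b \<Rightarrow> real"
  assumes k: "k \<in> borel_measurable (M \<Otimes>\<^sub>M N)" "\<And>z. \<bar>k z\<bar> \<le> c"
  shows "integrable N (\<lambda>y. k (x, y))" "integrable M (\<lambda>x. k (x, y))"
    and "integrable M (\<lambda>x. \<integral>y. k (x, y) \<partial>N)" "(\<integral>x. \<integral>y. k (x, y) \<partial>N \<partial>M) = (\<integral>z. k z \<partial>(M \<Otimes>\<^sub>M N))"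
    and "integrable N (\<lambda>y. \<integral>x. k (x, y) \<partial>M)" "(\<integral>y. \<integral>x. k (x, y) \<partial>M \<partial>N) = (\<integral>z. k z \<partial>(M \<Otimes>\<^sub>M N))"
proof -
  have i: "integrable (M \<Otimes>\<^sub>M N) k" using k by (rule P.integrable_bounded)
  then have i': "integrable (M \<Otimes>\<^sub>M N) (case_prod (\<lambda>x y. k (x, y)))" by simp
  show "integrable N (\<lambda>y. k (x, y))"
    using measurable_Pair2[OF k(1), of x] k(2) X.space_UNIV by (intro Y.integrable_bounded[of _ c]) auto
  show "integrable M (\<lambda>x. k (x, y))"
    using measurable_Pair1[OF k(1), of y] k(2) Y.space_UNIV by (intro X.integrable_bounded[of _ c]) auto
  show "integrable M (\<lambda>x. \<integral>y. k (x, y) \<partial>N)" "(\<integral>x. \<integral>y. k (x, y) \<partial>N \<partial>M) = (\<integral>z. k z \<partial>(M \<Otimes>\<^sub>M N))"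
    using integrable_fst'[OF i] integral_fst'[OF i] by auto
  show "integrable N (\<lambda>y. \<integral>x. k (x, y) \<partial>M)" "(\<integral>y. \<integral>x. k (x, y) \<partial>M \<partial>N) = (\<integral>z. k z \<partial>(M \<Otimes>\<^sub>M N))"
    using integrable_snd[OF i'] integral_snd[OF i'] by auto
qed

lemma integral_prod_bounded:
  fixes f :: "'a \<Rightarrow> real" and g :: "'b \<Rightarrow> real"
  assumes f: "f \<in> borel_measurable M" "\<And>x. \<bar>f x\<bar> \<le> c" and g: "g \<in> borel_measurable N" "\<And>y. \<bar>g y\<bar> \<le> c'"
  shows "(\<integral>z. f (fst z) * g (snd z) \<partial>(M \<Otimes>\<^sub>M N)) = (\<integral>x. f x \<partial>M) * (\<integral>y. g y \<partial>N)"
proof -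
  note [measurable] = f(1) g(1)
  have b: "\<bar>f (fst z) * g (snd z)\<bar> \<le> c * c'" for z
    unfolding abs_mult using f(2) g(2) by (intro mult_mono) (auto intro: order_trans[OF abs_ge_zero])
  show ?thesis using fubini_bounded(4)[of "\<lambda>z. f (fst z) * g (snd z)", OF _ b] by simp
qed

text \<open>
  Integrating an almost periodic function of two variables over the second one gives an almost
  periodic function on the first factor, since the action preserves the measure on the second factor.
\<close>
lemma orth_lift_fst:
  assumes u: "X.orth u"
  shows "P.orth (\<lambda>z. u (fst z))"
proof -
  have um[measurable]: "u \<in> borel_measurable M" and u1: "\<bar>u x\<bar> \<le> 1" for x using u by (auto simp: X.orth_def)
  have "(\<integral>z. u (fst z) * k z \<partial>(M \<Otimes>\<^sub>M N)) = 0" if k: "P.ap k" "\<forall>z. \<bar>k z\<bar> \<le> c" for k c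
  proof -
    note km[measurable] = P.ap_measurable[OF k(1)]
    have kb: "\<bar>k z\<bar> \<le> c" for z using k(2) by (rule spec)
    define h where "h x = (\<integral>y. k (x, y) \<partial>N)" for x
    have hi: "integrable M h" unfolding h_def by (rule fubini_bounded(3)[OF km kb])
    have hb: "\<bar>h x\<bar> \<le> c" for x
    proof -
      have "\<bar>h x\<bar> \<le> (\<integral>y. \<bar>k (x, y)\<bar> \<partial>N)" unfolding h_def by (rule integral_abs_bound)
      also have "\<dots> \<le> (\<integral>y. c \<partial>N)"
        using fubini_bounded(1)[OF km kb] kb by (intro integral_mono Bochner_Integration.integrable_abs) auto
      finally show ?thesis by (simp add: Y.prob_space)
    qed
    have osc: "X.osc h s t \<le> P.osc k s t" if st: "s \<in> carrier G" "t \<in> carrier G" for s t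
    proof -
      define ks where "ks s z = k (map_prod (a s) (b s) z)" for s z
      have ksm: "ks s \<in> borel_measurable (M \<Otimes>\<^sub>M N)" if "s \<in> carrier G" for s
        unfolding ks_def using that km by (rule P.act_borel)
      have ksb: "\<bar>ks s z\<bar> \<le> c" for s z unfolding ks_def by (rule kb)
      have hs: "h (a s x) = (\<integral>y. ks s (x, y) \<partial>N)" if "s \<in> carrier G" for s x
        unfolding h_def ks_def
        using Y.act_integral[OF that borel_measurable_integrable[OF fubini_bounded(1)[OF km kb]], of "a s x"] by simp
      have dm: "(\<lambda>z. \<bar>ks s z - ks t z\<bar>) \<in> borel_measurable (M \<Otimes>\<^sub>M N)" using ksm st by simp
      have db: "\<bar>\<bar>ks s z - ks t z\<bar>\<bar> \<le> 2 * c" for z using ksb[of s z] ksb[of t z] by linarith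
      have "\<bar>h (a s x) - h (a t x)\<bar> \<le> (\<integral>y. \<bar>ks s (x, y) - ks t (x, y)\<bar> \<partial>N)" for x
      proof -
        have "h (a s x) - h (a t x) = (\<integral>y. ks s (x, y) - ks t (x, y) \<partial>N)"
          using fubini_bounded(1)[OF ksm ksb] st by (simp add: hs)
        then show ?thesis using integral_abs_bound[of N "\<lambda>y. ks s (x, y) - ks t (x, y)"] by simp
      qed
      then have "X.osc h s t \<le> (\<integral>x. \<integral>y. \<bar>ks s (x, y) - ks t (x, y)\<bar> \<partial>N \<partial>M)"
        unfolding X.osc_def using X.osc_integrable[OF hi st] fubini_bounded(3)[OF dm db]
        by (intro integral_mono) auto
      also have "\<dots> = P.osc k s t"
        using fubini_bounded(4)[OF dm db] by (simp add: P.osc_def ks_def)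
      finally show ?thesis .
    qed
    have "X.ap h"
    proof (rule X.ap_def[THEN iffD2], intro conjI hi allI impI)
      fix e :: real assume "e > 0"
      then obtain col :: "'g \<Rightarrow> nat" where "finite (col ` carrier G)"
        "\<forall>s\<in>carrier G. \<forall>t\<in>carrier G. col s = col t \<longrightarrow> P.osc k s t < e" using k(1) unfolding P.ap_def by metis
      then show "\<exists>col::'g \<Rightarrow> nat. finite (col ` carrier G) \<and>
          (\<forall>s\<in>carrier G. \<forall>t\<in>carrier G. col s = col t \<longrightarrow> X.osc h s t < e)"
        using osc by (intro exI[of _ col]) (meson le_less_trans)
    qed
    then have 0: "(\<integral>x. u x * h x \<partial>M) = 0" using u hb by (auto simp: X.orth_def)
    have "\<bar>u (fst z) * k z\<bar> \<le> 1 * c" for z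
      unfolding abs_mult using u1 kb by (intro mult_mono) auto
    from fubini_bounded(4)[of "\<lambda>z. u (fst z) * k z", OF _ this] have "(\<integral>z. u (fst z) * k z \<partial>(M \<Otimes>\<^sub>M N)) = (\<integral>x. u x * h x \<partial>M)"
      by (simp add: h_def)
    then show ?thesis using 0 by simp
  qed
  then show ?thesis using u1 by (auto simp: P.orth_def)
qed

text \<open>
  Exchange the factors.
\<close>
lemma orth_lift_snd:
  assumes u: "Y.orth u"
  shows "P.orth (\<lambda>z. u (snd z))"
proof -
  interpret S: mp_system_pair N M G b a ..
  have um[measurable]: "u \<in> borel_measurable N" and u1: "\<bar>u x\<bar> \<le> 1" for x using u by (auto simp: Y.orth_def)
  have swap: "(\<integral>z. f (prod.swap z) \<partial>(N \<Otimes>\<^sub>M M)) = (\<integral>z. f z \<partial>(M \<Otimes>\<^sub>M N))"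
    if "f \<in> borel_measurable (M \<Otimes>\<^sub>M N)" for f :: "'a \<times> 'b \<Rightarrow> real"
    using integral_product_swap[OF that] by (simp add: prod.swap_def case_prod_unfold)
  have "(\<integral>z. u (snd z) * k z \<partial>(M \<Otimes>\<^sub>M N)) = 0" if k: "P.ap k" "\<forall>z. \<bar>k z\<bar> \<le> c" for k c
  proof -
    note km[measurable] = P.ap_measurable[OF k(1)]
    have osc: "S.P.osc (\<lambda>z. k (prod.swap z)) s t = P.osc k s t" if st: "s \<in> carrier G" "t \<in> carrier G" for s t
    proof -
      have eq: "prod.swap (map_prod (b r) (a r) z) = map_prod (a r) (b r) (prod.swap z)" for r z
        by (cases z) simp
      note [measurable] = P.act_borel[OF st(1) km] P.act_borel[OF st(2) km]
      show ?thesis unfolding S.P.osc_def P.osc_def eq by (rule swap) measurable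
    qed
    have "integrable (N \<Otimes>\<^sub>M M) (\<lambda>z. k (prod.swap z))"
      using integrable_product_swap[OF P.ap_integrable[OF k(1)]] by (simp add: prod.swap_def case_prod_unfold)
    then have "S.P.ap (\<lambda>z. k (prod.swap z))"
      using k(1) osc unfolding S.P.ap_def P.ap_def by simp
    then have "(\<integral>z. u (fst z) * k (prod.swap z) \<partial>(N \<Otimes>\<^sub>M M)) = 0"
      using S.orth_lift_fst[OF u] k(2) unfolding S.P.orth_def by blast
    then show ?thesis using swap[of "\<lambda>z. u (snd z) * k z"] by simp
  qed
  then show ?thesis using u1 by (auto simp: P.orth_def)
qed

end

section \<open>Independence density forces overlap\<close>

text \<open>
  Positive sequential independence density with preimages in place of images under the inverse, with
  an arbitrary sigma-algebra, and with labellings of the whole set \<open>I\<close> only.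
\<close>
definition independence_density ::
    "('g, 'm) monoid_scheme \<Rightarrow> 'x measure \<Rightarrow> ('g \<Rightarrow> 'x \<Rightarrow> 'x) \<Rightarrow> nat \<Rightarrow> (nat \<Rightarrow> 'x set) \<Rightarrow> bool" where
  "independence_density G \<mu> act k U \<longleftrightarrow>
     (\<exists>\<delta>>0. \<exists>c>0. \<forall>M>0. \<exists>F\<subseteq>carrier G. finite F \<and> real (card F) \<ge> M \<and>
        (\<forall>D. (\<forall>s\<in>carrier G. D s \<in> sets \<mu> \<and> measure \<mu> (D s) \<ge> 1 - \<delta>) \<longrightarrow>
          (\<exists>I\<subseteq>F. (\<forall>\<sigma>\<in>I \<rightarrow> {..<k}. \<exists>x. \<forall>s\<in>I. x \<in> D s \<and> act s x \<in> U (\<sigma> s)) \<and>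
            real (card I) \<ge> c * real (card F))))"

definition label :: "nat \<Rightarrow> (nat \<Rightarrow> 'x set) \<Rightarrow> 'x \<Rightarrow> nat set" where
  "label k U x = {i. i < k \<and> x \<in> U i}"

text \<open>
  The atoms partition the space even if the sets \<open>U i\<close> overlap, which turns the tuple into a random
  letter \<open>label k U x\<close>.
\<close>
definition atom :: "nat \<Rightarrow> (nat \<Rightarrow> 'x set) \<Rightarrow> nat set \<Rightarrow> 'x set" where
  "atom k U a = {x. label k U x = a}"

text \<open>
  If \<open>F a\<close> is the conditional expectation of the atom \<open>a\<close>, then this is the conditional expectation
  of \<open>U i\<close>.
\<close>
definition local_density :: "nat \<Rightarrow> (nat set \<Rightarrow> 'x \<Rightarrow> real) \<Rightarrow> nat \<Rightarrow> 'x \<Rightarrow> real" where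
  "local_density k F i x = (\<Sum>a\<in>{a \<in> Pow {..<k}. i \<in> a}. F a x)"

lemma label_in_Pow: "label k U x \<in> Pow {..<k}"
  by (auto simp: label_def)

lemma sum_atoms: "finite T \<Longrightarrow> (\<Sum>a\<in>T. indicator (atom k U a) x) = (if label k U x \<in> T then 1 else 0 :: real)"
  by (simp add: atom_def indicator_def)

context mp_system
begin

definition atom_densities :: "nat \<Rightarrow> (nat \<Rightarrow> 'a set) \<Rightarrow> (nat set \<Rightarrow> 'a \<Rightarrow> real) \<Rightarrow> bool" where
  "atom_densities k U F \<longleftrightarrow> (\<forall>a\<in>Pow {..<k}. ap (F a) \<and> (\<forall>x. 0 \<le> F a x \<and> F a x \<le> 1) \<and>
     orth (\<lambda>x. indicator (atom k U a) x - F a x))"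

lemma atom_sets:
  assumes "\<And>i. i < k \<Longrightarrow> U i \<in> sets M" "a \<in> Pow {..<k}"
  shows "atom k U a \<in> sets M"
proof -
  have "atom k U a = {x\<in>space M. \<forall>i\<in>{..<k}. x \<in> U i \<longleftrightarrow> i \<in> a}"
    using assms(2) by (auto simp: atom_def label_def space_UNIV)
  also have "\<dots> \<in> sets M"
  proof (rule sets.sets_Collect_finite_All)
    fix i assume "i \<in> {..<k}"
    then have [measurable]: "U i \<in> sets M" using assms(1) by simp
    show "{x \<in> space M. (x \<in> U i) = (i \<in> a)} \<in> sets M" by measurable
  qed simp
  finally show ?thesis .
qed

lemma atom_densities_exist:
  assumes "\<And>i. i < k \<Longrightarrow> U i \<in> sets M"
  shows "\<exists>F. atom_densities k U F"
proof -
  have "\<forall>a\<in>Pow {..<k}. \<exists>F. ap F \<and> (\<forall>x. 0 \<le> F x \<and> F x \<le> 1) \<and> orth (\<lambda>x. indicator (atom k U a) x - F x)"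
    by (intro ballI decomposition atom_sets assms)
  then show ?thesis unfolding atom_densities_def by (rule bchoice)
qed

lemma orth_sum_integral:
  assumes T: "finite T" "\<And>a. a \<in> T \<Longrightarrow> orth (u a)" and k: "ap k" "\<And>x. \<bar>k x\<bar> \<le> c"
  shows "(\<integral>x. (\<Sum>a\<in>T. u a x) * k x \<partial>M) = 0"
proof -
  have i: "integrable M (\<lambda>x. u a x * k x)" if "a \<in> T" for a
  proof (rule Bochner_Integration.integrable_bound[OF ap_integrable[OF k(1)]])
    show "(\<lambda>x. u a x * k x) \<in> borel_measurable M"
      using T(2)[OF that] ap_measurable[OF k(1)] by (auto simp: orth_def)
    show "AE x in M. norm (u a x * k x) \<le> norm (k x)"
      using T(2)[OF that] by (auto simp: orth_def abs_mult intro!: mult_left_le_one_le)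
  qed
  have "(\<integral>x. (\<Sum>a\<in>T. u a x) * k x \<partial>M) = (\<Sum>a\<in>T. \<integral>x. u a x * k x \<partial>M)"
    using i by (simp add: sum_distrib_right Bochner_Integration.integral_sum)
  also have "\<dots> = 0"
    using T(2) k by (intro sum.neutral) (auto simp: orth_def)
  finally show ?thesis .
qed

text \<open>
  The difference between \<open>1\<close> and the sum is almost periodic, and it is also a sum of functions
  orthogonal to the almost periodic ones. So it is orthogonal to itself.
\<close>
lemma atom_densities_sum:
  assumes F: "atom_densities k U F"
  shows "AE x in M. (\<Sum>a\<in>Pow {..<k}. F a x) = 1"
proof -
  let ?T = "Pow {..<k}"
  define v where "v x = 1 - (\<Sum>a\<in>?T. F a x)" for x
  have apv: "ap v" unfolding v_def
    using F by (intro ap_diff ap_const ap_sum) (auto simp: atom_densities_def)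
  have vb: "\<bar>v x\<bar> \<le> 1 + card ?T" for x
  proof -
    have "0 \<le> (\<Sum>a\<in>?T. F a x)" using F by (intro sum_nonneg) (auto simp: atom_densities_def)
    moreover have "(\<Sum>a\<in>?T. F a x) \<le> (\<Sum>a\<in>?T. 1)" using F by (intro sum_mono) (auto simp: atom_densities_def)
    ultimately show ?thesis by (simp add: v_def)
  qed
  have veq: "v x = (\<Sum>a\<in>?T. indicator (atom k U a) x - F a x)" for x
    using label_in_Pow[of k U x] by (simp add: v_def sum_subtractf sum_atoms)
  have "(\<integral>x. (\<Sum>a\<in>?T. indicator (atom k U a) x - F a x) * v x \<partial>M) = 0"
    using F by (intro orth_sum_integral[OF _ _ apv vb]) (auto simp: atom_densities_def)
  then have 0: "(\<integral>x. v x * v x \<partial>M) = 0" by (simp add: veq[symmetric])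
  have "integrable M (\<lambda>x. v x * v x)"
  proof (rule integrable_bounded)
    show "(\<lambda>x. v x * v x) \<in> borel_measurable M" using ap_measurable[OF apv] by simp
    show "\<bar>v x * v x\<bar> \<le> (1 + card ?T) * (1 + card ?T)" for x
      unfolding abs_mult of_nat_mult using vb[of x] by (intro mult_mono) auto
  qed
  then have "AE x in M. v x * v x = 0" using 0 by (subst (asm) integral_nonneg_eq_0_iff_AE) auto
  then show ?thesis by eventually_elim (simp add: v_def)
qed

text \<open>
  If the almost periodic hulls \<open>C i\<close> had null intersection, independence sets would be bounded in
  size: among more than \<open>k\<close> times as many elements as colours, \<open>k\<close> have the same colour, and giving
  them the \<open>k\<close> different labels yields a point in the intersection of the translated hulls. The sets \<open>D s\<close> below also discard the null sets on which \<open>U i\<close> exceeds \<open>C i\<close> or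
  all translated \<open>C i\<close> meet.
\<close>
lemma independence_density_imp_overlap:
  assumes k: "k \<ge> 1" and Us: "\<And>i. i < k \<Longrightarrow> U i \<in> sets M" and F: "atom_densities k U F"
    and dens: "independence_density G M act k U"
  shows "\<not> (AE x in M. \<exists>i<k. local_density k F i x \<le> 0)"
proof
  assume null: "AE x in M. \<exists>i<k. local_density k F i x \<le> 0"
  define f where "f i = local_density k F i" for i
  have apF: "ap (F a)" and F0: "0 \<le> F a x" if "a \<in> Pow {..<k}" for a x
    using F that by (auto simp: atom_densities_def)
  have apf: "ap (f i)" for i unfolding f_def local_density_def using apF by (intro ap_sum) auto
  have f0: "0 \<le> f i x" for i x unfolding f_def local_density_def using F0 by (intro sum_nonneg) auto
  define C where "C i = {x. 0 < f i x}" for i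
  have Cap: "C i \<in> apsets" for i
  proof -
    have [measurable]: "f i \<in> borel_measurable ap_algebra" using apf[of i] by (simp add: ap_iff_ap_algebra)
    have "{x\<in>space ap_algebra. 0 < f i x} \<in> sets ap_algebra" by measurable
    then show ?thesis by (simp add: sets_ap_algebra space_ap_algebra C_def)
  qed
  have Cs: "C i \<in> sets M" and Ci: "ap (indicator (C i))" for i using Cap[of i] by (auto simp: apsets_def)
  \<comment> \<open>The complement of \<open>C i\<close> is almost periodic and carries no mass of \<open>f i\<close>, hence none of \<open>U i\<close>.\<close>
  have hull: "AE x in M. x \<in> U i \<longrightarrow> x \<in> C i" if i: "i < k" for i
  proof -
    let ?T = "{a \<in> Pow {..<k}. i \<in> a}"
    have apk: "ap (\<lambda>x. 1 - indicator (C i) x)" by (intro ap_diff ap_const Ci)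
    have "(\<integral>x. (\<Sum>a\<in>?T. indicator (atom k U a) x - F a x) * (1 - indicator (C i) x) \<partial>M) = 0"
      using F by (intro orth_sum_integral[OF _ _ apk, of _ _ 1]) (auto simp: atom_densities_def indicator_def)
    moreover have "(\<Sum>a\<in>?T. indicator (atom k U a) x - F a x) * (1 - indicator (C i) x) = indicator (U i - C i) x" for x
    proof -
      have "(\<Sum>a\<in>?T. indicator (atom k U a) x - F a x) = indicator (U i) x - f i x"
        using i by (simp add: sum_subtractf sum_atoms f_def local_density_def) (auto simp: label_def indicator_def)
      then show ?thesis using f0[of i x] by (auto simp: C_def indicator_def)
    qed
    ultimately have "measure M (U i - C i) = 0" using space_UNIV by simp
    then have "U i - C i \<in> null_sets M" using Us[OF i] Cs by (intro null_setsI) (auto simp: emeasure_eq_measure)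
    then have "AE x in M. x \<notin> U i - C i" by (rule AE_not_in)
    then show ?thesis by eventually_elim auto
  qed
  obtain \<delta> c where dc: "\<delta> > 0" "c > 0" and ind: "\<And>M'. M' > 0 \<Longrightarrow> \<exists>F\<subseteq>carrier G. finite F \<and> real (card F) \<ge> M' \<and>
        (\<forall>D. (\<forall>s\<in>carrier G. D s \<in> sets M \<and> measure M (D s) \<ge> 1 - \<delta>) \<longrightarrow>
          (\<exists>I\<subseteq>F. (\<forall>\<sigma>\<in>I \<rightarrow> {..<k}. \<exists>x. \<forall>s\<in>I. x \<in> D s \<and> act s x \<in> U (\<sigma> s)) \<and>
            real (card I) \<ge> c * real (card F)))"
    using dens unfolding independence_density_def by metis
  define e where "e = \<delta> / k"
  have e: "e > 0" using dc k by (simp add: e_def)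
  obtain h :: "'g \<Rightarrow> nat" where h: "finite (h ` carrier G)"
    and hosc: "\<And>i s t. i < k \<Longrightarrow> s \<in> carrier G \<Longrightarrow> t \<in> carrier G \<Longrightarrow> h s = h t \<Longrightarrow> osc (indicator (C i)) s t < e"
    using ap_joint[of "{..<k}" "\<lambda>i. indicator (C i)" e] Ci e by (metis finite_lessThan lessThan_iff)
  define r where "r n = (SOME t. t \<in> carrier G \<and> h t = n)" for n
  have r: "r (h s) \<in> carrier G" "h (r (h s)) = h s" if "s \<in> carrier G" for s
    using someI[of "\<lambda>t. t \<in> carrier G \<and> h t = h s" s] that by (auto simp: r_def)
  define D where "D s = {x. (\<forall>i\<in>{..<k}. act s x \<in> C i \<longleftrightarrow> act (r (h s)) x \<in> C i) \<and>
      (\<forall>i\<in>{..<k}. act s x \<in> U i \<longrightarrow> act s x \<in> C i) \<and> (\<exists>i\<in>{..<k}. act (r (h s)) x \<notin> C i)}" for s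
  have D: "D s \<in> sets M \<and> measure M (D s) \<ge> 1 - \<delta>" if s: "s \<in> carrier G" for s
  proof -
    note rs = r(1)[OF s]
    note [measurable] = act_measurable[OF s] act_measurable[OF rs] Cs
    have "{x\<in>space M. (\<forall>i\<in>{..<k}. act s x \<in> C i \<longleftrightarrow> act (r (h s)) x \<in> C i) \<and>
      (\<forall>i\<in>{..<k}. act s x \<in> U i \<longrightarrow> act s x \<in> C i) \<and> (\<exists>i\<in>{..<k}. act (r (h s)) x \<notin> C i)} \<in> sets M"
    proof (intro sets.sets_Collect_conj sets.sets_Collect_finite_All sets.sets_Collect_finite_Ex)
      fix i assume "i \<in> {..<k}"
      then have [measurable]: "U i \<in> sets M" using Us by simp
      show "{x \<in> space M. act s x \<in> U i \<longrightarrow> act s x \<in> C i} \<in> sets M" by measurable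
    qed auto
    then have Ds: "D s \<in> sets M" by (simp add: D_def space_UNIV)
    have AEact: "AE x in M. P (act t x)" if "AE x in M. P x" "t \<in> carrier G" for P t
    proof -
      have "AE x in distr M M (act t). P x" unfolding act_distr[OF that(2)] by (rule that(1))
      then show ?thesis by (rule AE_distrD[OF act_measurable[OF that(2)]])
    qed
    have AE1: "AE x in M. \<forall>i\<in>{..<k}. act s x \<in> U i \<longrightarrow> act s x \<in> C i"
      using AEact[OF hull s] by (intro AE_finite_allI) auto
    have AE2: "AE x in M. \<exists>i\<in>{..<k}. act (r (h s)) x \<notin> C i"
    proof -
      have "AE x in M. \<exists>i<k. f i (act (r (h s)) x) \<le> 0" using AEact[OF null rs] by (simp add: f_def)
      then show ?thesis by eventually_elim (force simp: C_def)
    qed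
    have "AE x in M. 1 - indicator (D s) x \<le> (\<Sum>i<k. \<bar>indicator (C i) (act s x) - indicator (C i) (act (r (h s)) x)\<bar> :: real)"
      using AE1 AE2
    proof eventually_elim
      case (elim x)
      show ?case
      proof (cases "x \<in> D s")
        case True then show ?thesis by (simp add: sum_nonneg)
      next
        case False
        then obtain i where i: "i < k" "(act s x \<in> C i) \<noteq> (act (r (h s)) x \<in> C i)" using elim by (auto simp: D_def)
        then have "1 = \<bar>indicator (C i) (act s x) - indicator (C i) (act (r (h s)) x) :: real\<bar>" by (auto simp: indicator_def)
        also have "\<dots> \<le> (\<Sum>i<k. \<bar>indicator (C i) (act s x) - indicator (C i) (act (r (h s)) x)\<bar>)"
          using i(1) by (intro member_le_sum) auto
        finally show ?thesis using False by simp
      qed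
    qed
    moreover have oi: "integrable M (\<lambda>x. \<bar>indicator (C i) (act s x) - indicator (C i) (act (r (h s)) x) :: real\<bar>)" for i
      by (rule osc_integrable[OF ap_integrable[OF Ci] s rs])
    moreover have iD: "integrable M (indicator (D s) :: 'a \<Rightarrow> real)" using Ds by (simp add: emeasure_eq_measure)
    ultimately have "(\<integral>x. 1 - indicator (D s) x \<partial>M) \<le> (\<integral>x. (\<Sum>i<k. \<bar>indicator (C i) (act s x) - indicator (C i) (act (r (h s)) x) :: real\<bar>) \<partial>M)"
      by (intro integral_mono_AE) auto
    also have "\<dots> = (\<Sum>i<k. osc (indicator (C i)) s (r (h s)))"
      using oi by (simp add: osc_def Bochner_Integration.integral_sum)
    also have "\<dots> \<le> (\<Sum>i<k. e)" using hosc s rs r(2)[OF s] by (intro sum_mono less_imp_le) auto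
    also have "\<dots> = \<delta>" using k by (simp add: e_def)
    finally have "measure M (space M) - measure M (D s) \<le> \<delta>" using iD space_UNIV by simp
    then have "1 - measure M (D s) \<le> \<delta>" unfolding prob_space .
    then show ?thesis using Ds by simp
  qed
  define Nc where "Nc = card (h ` carrier G)"
  obtain S where S: "S \<subseteq> carrier G" "finite S" "real (card S) \<ge> (real (k * Nc) + 1) / c"
    and SD: "\<And>D. (\<forall>s\<in>carrier G. D s \<in> sets M \<and> measure M (D s) \<ge> 1 - \<delta>) \<Longrightarrow>
          (\<exists>I\<subseteq>S. (\<forall>\<sigma>\<in>I \<rightarrow> {..<k}. \<exists>x. \<forall>s\<in>I. x \<in> D s \<and> act s x \<in> U (\<sigma> s)) \<and>
            real (card I) \<ge> c * real (card S))"
    using ind[of "(real (k * Nc) + 1) / c"] dc by (auto simp: add_nonneg_pos)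
  obtain I where I: "I \<subseteq> S" "\<And>\<sigma>. \<sigma> \<in> I \<rightarrow> {..<k} \<Longrightarrow> \<exists>x. \<forall>s\<in>I. x \<in> D s \<and> act s x \<in> U (\<sigma> s)"
    "real (card I) \<ge> c * real (card S)"
    using SD[of D] D by blast
  have fI: "finite I" using I(1) S(2) by (rule finite_subset)
  have "real (card I) \<ge> real (k * Nc) + 1"
    using I(3) S(3) dc(2) by (simp add: pos_divide_le_eq mult.commute)
  then have cI: "k * Nc < card I" by linarith
  have "\<exists>n\<in>h ` I. k \<le> card {s\<in>I. h s = n}"
  proof (rule ccontr)
    assume "\<not> ?thesis"
    then have lt: "card {s\<in>I. h s = n} \<le> k" if "n \<in> h ` I" for n using that by force
    have "card I = (\<Sum>n\<in>h ` I. card {s\<in>I. h s = n})"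
      using sum.image_gen[OF fI, of "\<lambda>_. 1::nat" h] by simp
    also have "\<dots> \<le> (\<Sum>n\<in>h ` I. k)" using lt by (rule sum_mono)
    also have "\<dots> \<le> k * Nc"
      unfolding Nc_def using I(1) S(1) h by (simp add: mult.commute card_mono image_mono)
    finally show False using cI by simp
  qed
  then obtain n where n: "k \<le> card {s\<in>I. h s = n}" by blast
  obtain J where J: "J \<subseteq> {s\<in>I. h s = n}" "card J = k" "finite J"
    using obtain_subset_with_card_n[OF n] by blast
  obtain \<tau> where \<tau>: "bij_betw \<tau> J {..<k}"
    using finite_same_card_bij[OF J(3), of "{..<k}"] J(2) by auto
  define \<sigma> where "\<sigma> s = (if s \<in> J then \<tau> s else 0)" for s
  have "\<tau> s < k" if "s \<in> J" for s using bij_betwE[OF \<tau>] that by auto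
  then have "\<sigma> \<in> I \<rightarrow> {..<k}" using k by (simp add: \<sigma>_def)
  then obtain x where x: "\<And>s. s \<in> I \<Longrightarrow> x \<in> D s \<and> act s x \<in> U (\<sigma> s)" using I(2) by blast
  have "act (r n) x \<in> C i" if i: "i < k" for i
  proof -
    have "i \<in> \<tau> ` J" using \<tau> i by (simp add: bij_betw_def)
    then obtain s where s: "s \<in> J" "\<tau> s = i" by (elim imageE) simp
    then have sI: "s \<in> I" "h s = n" using J(1) by auto
    have "act s x \<in> U i" "x \<in> D s" using x[OF sI(1)] s by (auto simp: \<sigma>_def)
    then show ?thesis using i sI(2) by (auto simp: D_def)
  qed
  moreover obtain s where "s \<in> J" using J(2) k by fastforce
  then have "x \<in> D s" "h s = n" using x J(1) by auto
  then have "\<exists>i<k. act (r n) x \<notin> C i" by (auto simp: D_def)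
  ultimately show False by blast
qed

lemma independence_density_imp_uniform_overlap:
  assumes k: "k \<ge> 1" and Us: "\<And>i. i < k \<Longrightarrow> U i \<in> sets M" and F: "atom_densities k U F"
    and dens: "independence_density G M act k U"
  shows "\<exists>\<beta>>0. \<beta> \<le> 1 \<and> {x. \<forall>i<k. \<beta> \<le> local_density k F i x} \<in> sets M \<and>
    measure M {x. \<forall>i<k. \<beta> \<le> local_density k F i x} > 0"
proof -
  define B where "B n = {x. \<forall>i<k. 1 / real (Suc n) \<le> local_density k F i x}" for n
  have fm: "local_density k F i \<in> borel_measurable M" for i
    unfolding local_density_def using F ap_measurable by (intro borel_measurable_sum) (auto simp: atom_densities_def)
  have Bs: "B n \<in> sets M" for n
  proof -
    have "{x\<in>space M. \<forall>i\<in>{..<k}. 1 / real (Suc n) \<le> local_density k F i x} \<in> sets M"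
      using fm by (intro sets.sets_Collect_finite_All) auto
    then show ?thesis by (simp add: B_def space_UNIV Ball_def)
  qed
  have "\<exists>n. measure M (B n) > 0"
  proof (rule ccontr)
    assume "\<not> ?thesis"
    then have "measure M (B n) = 0" for n using measure_nonneg[of M "B n"] by (metis less_eq_real_def)
    then have "B n \<in> null_sets M" for n using Bs by (intro null_setsI) (auto simp: emeasure_eq_measure)
    then have "AE x in M. x \<notin> B n" for n by (rule AE_not_in)
    then have "AE x in M. \<forall>n. x \<notin> B n" by (simp add: AE_all_countable)
    then have "AE x in M. \<exists>i<k. local_density k F i x \<le> 0"
    proof eventually_elim
      case (elim x)
      show ?case
      proof (rule ccontr)
        assume neg: "\<not> ?case"
        define m where "m = Min ((\<lambda>i. local_density k F i x) ` {..<k})"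
        have ne: "(\<lambda>i. local_density k F i x) ` {..<k} \<noteq> {}" using k by (simp add: lessThan_empty_iff)
        have "m > 0" unfolding m_def using neg ne by (subst Min_gr_iff) auto
        then obtain n where "1 / real (Suc n) < m" using nat_approx_posE by blast
        moreover have "m \<le> local_density k F i x" if "i < k" for i
          unfolding m_def using that by (intro Min_le) auto
        ultimately have "x \<in> B n" unfolding B_def by (fastforce intro: order_trans[OF less_imp_le])
        then show False using elim by simp
      qed
    qed
    then show False using independence_density_imp_overlap[OF k Us F dens] by blast
  qed
  then obtain n where "measure M (B n) > 0" by blast
  then show ?thesis using Bs[of n] unfolding B_def by (intro exI[of _ "1 / real (Suc n)"]) (auto simp: divide_simps)
qed

lemma pattern_sets:
  assumes Us: "\<And>i. i < k \<Longrightarrow> U i \<in> sets M" and B: "B \<in> sets M"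
    and S: "S \<subseteq> carrier G" "finite S" and w: "w \<in> S \<rightarrow> Pow {..<k}"
  shows "{x. x \<in> B \<and> (\<forall>s\<in>S. label k U (act s x) = w s)} \<in> sets M"
proof -
  have "{x\<in>space M. x \<in> B \<and> (\<forall>s\<in>S. act s x \<in> atom k U (w s))} \<in> sets M"
  proof (intro sets.sets_Collect_conj sets.sets_Collect_finite_All S(2))
    fix s assume s: "s \<in> S"
    have [measurable]: "act s \<in> M \<rightarrow>\<^sub>M M" "atom k U (w s) \<in> sets M"
      using s S(1) w by (auto intro!: act_measurable atom_sets Us)
    show "{x \<in> space M. act s x \<in> atom k U (w s)} \<in> sets M" by measurable
  qed (use B in simp)
  then show ?thesis by (simp add: space_UNIV atom_def)
qed

lemma pattern_indicator:
  assumes "finite S"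
  shows "indicator B x * (\<Prod>s\<in>S. indicator (atom k U (w s)) (act s x)) =
    (indicator {x. x \<in> B \<and> (\<forall>s\<in>S. label k U (act s x) = w s)} x :: real)"
proof -
  have "(\<Prod>s\<in>S. indicator (atom k U (w s)) (act s x) :: real) = (if \<forall>s\<in>S. label k U (act s x) = w s then 1 else 0)"
    using assms by (induction S rule: finite_induct) (auto simp: atom_def indicator_def)
  then show ?thesis by (simp add: indicator_def)
qed

text \<open>
  On \<open>B\<close> the integrand is the probability of the word \<open>w\<close> under the product law at \<open>x\<close>.
\<close>
lemma pattern_density:
  assumes F: "atom_densities k U F" and B: "B \<in> sets M"
    and w: "\<And>s. s \<in> S \<Longrightarrow> w s \<in> Pow {..<k}"
  shows "(\<lambda>x. indicator B x * (\<Prod>s\<in>S. F (w s) x)) \<in> borel_measurable M"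
    and "\<bar>indicator B x * (\<Prod>s\<in>S. F (w s) x)\<bar> \<le> 1"
    and "integrable M (\<lambda>x. indicator B x * (\<Prod>s\<in>S. F (w s) x))"
    and "\<bar>\<integral>x. indicator B x * (\<Prod>s\<in>S. F (w s) x) \<partial>M\<bar> \<le> 1"
proof -
  let ?g = "\<lambda>x. indicator B x * (\<Prod>s\<in>S. F (w s) x)"
  have F': "F (w s) \<in> borel_measurable M" "0 \<le> F (w s) x" "F (w s) x \<le> 1" if "s \<in> S" for s x
    using F w[OF that] ap_measurable by (auto simp: atom_densities_def)
  show m: "?g \<in> borel_measurable M"
    using B F'(1) by (intro borel_measurable_times borel_measurable_prod) auto
  have 1: "\<bar>?g x\<bar> \<le> 1" for x
    using F' prod_nonneg[of S "\<lambda>s. F (w s) x"] by (simp add: indicator_def prod_le_1)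
  then show "\<bar>?g x\<bar> \<le> 1" .
  show i: "integrable M ?g" using m 1 by (rule integrable_bounded)
  have "\<bar>\<integral>x. ?g x \<partial>M\<bar> \<le> (\<integral>x. \<bar>?g x\<bar> \<partial>M)" by (rule integral_abs_bound)
  also have "\<dots> \<le> (\<integral>x. 1 \<partial>M)" using i 1 by (intro integral_mono Bochner_Integration.integrable_abs) auto
  finally show "\<bar>\<integral>x. ?g x \<partial>M\<bar> \<le> 1" by (simp add: prob_space)
qed

end

section \<open>Overlap in both factors forces independence density\<close>

lemma abs_mult_diff_le:
  fixes x y x' y' :: real
  assumes "\<bar>x - x'\<bar> \<le> e" "\<bar>y - y'\<bar> \<le> e" "\<bar>y\<bar> \<le> 1" "\<bar>x'\<bar> \<le> 1"
  shows "\<bar>x * y - x' * y'\<bar> \<le> 2 * e"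
proof -
  have "x * y - x' * y' = (x - x') * y + x' * (y - y')" by (simp add: algebra_simps)
  then have "\<bar>x * y - x' * y'\<bar> \<le> \<bar>x - x'\<bar> * \<bar>y\<bar> + \<bar>x'\<bar> * \<bar>y - y'\<bar>"
    by (metis abs_mult abs_triangle_ineq)
  also have "\<dots> \<le> e * 1 + 1 * e" using assms by (intro add_mono mult_mono) auto
  finally show ?thesis by simp
qed

context mp_system_pair
begin

definition letter :: "(nat set \<Rightarrow> 'a \<Rightarrow> real) \<Rightarrow> (nat set \<Rightarrow> 'b \<Rightarrow> real) \<Rightarrow> nat set + nat set \<Rightarrow> 'a \<times> 'b \<Rightarrow> real" where
  "letter f g l z = (case l of Inl c \<Rightarrow> f c (fst z) | Inr c \<Rightarrow> g c (snd z))"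

text \<open>
  The elements are chosen in the product system with the letters of both factors as one alphabet. A word
  in the letters of one factor only, with a test function on that factor, then gives the estimate there.
\<close>
lemma common_translates:
  assumes Us: "\<And>i. i < k \<Longrightarrow> U i \<in> sets M" and F: "X.atom_densities k U F"
    and Vs: "\<And>i. i < k \<Longrightarrow> V i \<in> sets N" and H: "Y.atom_densities k V H"
    and BX: "BX \<in> sets M" and BY: "BY \<in> sets N"
    and inf: "infinite (carrier G)" and e: "e > 0"
  shows "\<exists>S\<subseteq>carrier G. finite S \<and> card S = n \<and>
    (\<forall>w\<in>S \<rightarrow> Pow {..<k}.
      \<bar>measure M {x. x \<in> BX \<and> (\<forall>s\<in>S. label k U (a s x) = w s)} - (\<integral>x. indicator BX x * (\<Prod>s\<in>S. F (w s) x) \<partial>M)\<bar> < e \<and>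
      \<bar>measure N {y. y \<in> BY \<and> (\<forall>s\<in>S. label k V (b s y) = w s)} - (\<integral>y. indicator BY y * (\<Prod>s\<in>S. H (w s) y) \<partial>N)\<bar> < e)"
proof -
  let ?L = "Inl ` Pow {..<k} \<union> Inr ` Pow {..<k}"
  define A where "A = letter (\<lambda>c. indicator (atom k U c)) (\<lambda>c. indicator (atom k V c))"
  define D where "D = letter F H"
  define hX where "hX z = (indicator BX (fst z) :: real)" for z :: "'a \<times> 'b"
  define hY where "hY z = (indicator BY (snd z) :: real)" for z :: "'a \<times> 'b"
  have mU: "atom k U c \<in> sets M" and mV: "atom k V c \<in> sets N" if "c \<in> Pow {..<k}" for c
    using X.atom_sets[OF Us that] Y.atom_sets[OF Vs that] by auto
  have F': "X.ap (F c)" "\<And>x. 0 \<le> F c x \<and> F c x \<le> 1" "X.orth (\<lambda>x. indicator (atom k U c) x - F c x)"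
    and H': "Y.ap (H c)" "\<And>y. 0 \<le> H c y \<and> H c y \<le> 1" "Y.orth (\<lambda>y. indicator (atom k V c) y - H c y)"
    if "c \<in> Pow {..<k}" for c
    using F H that by (auto simp: X.atom_densities_def Y.atom_densities_def)
  have finL: "finite ?L" by simp
  have Am: "A l \<in> borel_measurable (M \<Otimes>\<^sub>M N)" if "l \<in> ?L" for l
    using that
  proof
    assume "l \<in> Inl ` Pow {..<k}"
    then obtain c where c: "l = Inl c" "c \<in> Pow {..<k}" by auto
    note [measurable] = mU[OF c(2)]
    show ?thesis unfolding A_def letter_def c(1) sum.case by measurable
  next
    assume "l \<in> Inr ` Pow {..<k}"
    then obtain c where c: "l = Inr c" "c \<in> Pow {..<k}" by auto
    note [measurable] = mV[OF c(2)]
    show ?thesis unfolding A_def letter_def c(1) sum.case by measurable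
  qed
  have A01: "0 \<le> A l z \<and> A l z \<le> 1" if "l \<in> ?L" for l z
    by (simp add: A_def letter_def indicator_def split: sum.split)
  have Dap: "P.ap (D l)" and D01: "0 \<le> D l z \<and> D l z \<le> 1" and AD: "P.orth (\<lambda>z. A l z - D l z)" if "l \<in> ?L" for l z
  proof -
    have "P.ap (D l) \<and> (0 \<le> D l z \<and> D l z \<le> 1) \<and> P.orth (\<lambda>z. A l z - D l z)"
      using that
    proof
      assume "l \<in> Inl ` Pow {..<k}"
      then obtain c where c: "l = Inl c" "c \<in> Pow {..<k}" by auto
      show ?thesis unfolding A_def D_def letter_def c(1) sum.case
        using F'[OF c(2)] by (intro conjI ap_lift_fst orth_lift_fst[of "\<lambda>x. indicator (atom k U c) x - F c x"]) auto
    next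
      assume "l \<in> Inr ` Pow {..<k}"
      then obtain c where c: "l = Inr c" "c \<in> Pow {..<k}" by auto
      show ?thesis unfolding A_def D_def letter_def c(1) sum.case
        using H'[OF c(2)] by (intro conjI ap_lift_snd orth_lift_snd[of "\<lambda>x. indicator (atom k V c) x - H c x"]) auto
    qed
    then show "P.ap (D l)" "0 \<le> D l z \<and> D l z \<le> 1" "P.orth (\<lambda>z. A l z - D l z)" by auto
  qed
  have tH: "P.tests {hX, hY}"
  proof -
    note [measurable] = BX BY
    have "hX \<in> borel_measurable (M \<Otimes>\<^sub>M N)" "hY \<in> borel_measurable (M \<Otimes>\<^sub>M N)" unfolding hX_def hY_def by measurable
    then show ?thesis by (auto simp: P.tests_def hX_def hY_def indicator_def)
  qed
  obtain S where S: "S \<subseteq> carrier G" "finite S" "card S = n" and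
    SH: "\<And>h w. h \<in> {hX, hY} \<Longrightarrow> w \<in> S \<rightarrow> ?L \<Longrightarrow>
      \<bar>(\<integral>z. h z * (\<Prod>s\<in>S. A (w s) (map_prod (a s) (b s) z)) \<partial>(M \<Otimes>\<^sub>M N)) - (\<integral>z. h z * (\<Prod>s\<in>S. D (w s) z) \<partial>(M \<Otimes>\<^sub>M N))\<bar> < e"
  proof -
    have "\<exists>S. S \<subseteq> carrier G \<and> finite S \<and> card S = n \<and> (\<forall>h\<in>{hX, hY}. \<forall>w\<in>S \<rightarrow> ?L.
      \<bar>(\<integral>z. h z * (\<Prod>s\<in>S. A (w s) (map_prod (a s) (b s) z)) \<partial>(M \<Otimes>\<^sub>M N)) - (\<integral>z. h z * (\<Prod>s\<in>S. D (w s) z) \<partial>(M \<Otimes>\<^sub>M N))\<bar> < e)"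
      by (rule P.independent_translates[OF finL]) (fact Am A01 Dap D01 AD inf tH e)+
    then obtain S where S: "S \<subseteq> carrier G" "finite S" "card S = n" and SH: "\<forall>h\<in>{hX, hY}. \<forall>w\<in>S \<rightarrow> ?L.
      \<bar>(\<integral>z. h z * (\<Prod>s\<in>S. A (w s) (map_prod (a s) (b s) z)) \<partial>(M \<Otimes>\<^sub>M N)) - (\<integral>z. h z * (\<Prod>s\<in>S. D (w s) z) \<partial>(M \<Otimes>\<^sub>M N))\<bar> < e"
      by (elim exE conjE) (rule that)
    show thesis by (rule that[OF S SH[rule_format]])
  qed
  have "\<bar>measure M {x. x \<in> BX \<and> (\<forall>s\<in>S. label k U (a s x) = w s)} - (\<integral>x. indicator BX x * (\<Prod>s\<in>S. F (w s) x) \<partial>M)\<bar> < e"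
    if w: "w \<in> S \<rightarrow> Pow {..<k}" for w
  proof -
    let ?P = "{x. x \<in> BX \<and> (\<forall>s\<in>S. label k U (a s x) = w s)}"
    have ws: "w s \<in> Pow {..<k}" if "s \<in> S" for s using w that by auto
    have i: "integrable M (indicator ?P :: 'a \<Rightarrow> real)"
      using X.pattern_sets[OF Us BX S(1,2) w] by (simp add: X.emeasure_eq_measure)
    have "(\<lambda>s. Inl (w s)) \<in> S \<rightarrow> ?L" using ws by (intro Pi_I UnI1 imageI)
    from SH[of hX, OF _ this] have "\<bar>(\<integral>z. indicator BX (fst z) * (\<Prod>s\<in>S. indicator (atom k U (w s)) (a s (fst z))) \<partial>(M \<Otimes>\<^sub>M N)) -
        (\<integral>z. indicator BX (fst z) * (\<Prod>s\<in>S. F (w s) (fst z)) \<partial>(M \<Otimes>\<^sub>M N))\<bar> < e"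
      by (simp add: hX_def A_def D_def letter_def)
    then have "\<bar>(\<integral>x. indicator ?P x \<partial>M) - (\<integral>x. indicator BX x * (\<Prod>s\<in>S. F (w s) x) \<partial>M)\<bar> < e"
      using integrable_lift_fst(2)[OF i] integrable_lift_fst(2)[OF X.pattern_density(3)[OF F BX ws, of S]]
        by (simp add: X.pattern_indicator[OF S(2)])
    then show ?thesis by (simp add: X.space_UNIV)
  qed
  moreover have "\<bar>measure N {y. y \<in> BY \<and> (\<forall>s\<in>S. label k V (b s y) = w s)} - (\<integral>y. indicator BY y * (\<Prod>s\<in>S. H (w s) y) \<partial>N)\<bar> < e"
    if w: "w \<in> S \<rightarrow> Pow {..<k}" for w
  proof -
    let ?P = "{y. y \<in> BY \<and> (\<forall>s\<in>S. label k V (b s y) = w s)}"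
    have ws: "w s \<in> Pow {..<k}" if "s \<in> S" for s using w that by auto
    have i: "integrable N (indicator ?P :: 'b \<Rightarrow> real)"
      using Y.pattern_sets[OF Vs BY S(1,2) w] by (simp add: Y.emeasure_eq_measure)
    have "(\<lambda>s. Inr (w s)) \<in> S \<rightarrow> ?L" using ws by (intro Pi_I UnI2 imageI)
    from SH[of hY, OF _ this] have "\<bar>(\<integral>z. indicator BY (snd z) * (\<Prod>s\<in>S. indicator (atom k V (w s)) (b s (snd z))) \<partial>(M \<Otimes>\<^sub>M N)) -
        (\<integral>z. indicator BY (snd z) * (\<Prod>s\<in>S. H (w s) (snd z)) \<partial>(M \<Otimes>\<^sub>M N))\<bar> < e"
      by (simp add: hY_def A_def D_def letter_def)
    then have "\<bar>(\<integral>y. indicator ?P y \<partial>N) - (\<integral>y. indicator BY y * (\<Prod>s\<in>S. H (w s) y) \<partial>N)\<bar> < e"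
      using integrable_lift_snd(2)[OF i] integrable_lift_snd(2)[OF Y.pattern_density(3)[OF H BY ws, of S]]
        by (simp add: Y.pattern_indicator[OF S(2)])
    then show ?thesis by (simp add: Y.space_UNIV)
  qed
  ultimately show ?thesis using S by (intro exI[of _ S]) auto
qed

lemma AE_lift_fst:
  assumes "AE x in M. Q x"
  shows "AE z in M \<Otimes>\<^sub>M N. Q (fst z)"
proof -
  have "AE x in distr (M \<Otimes>\<^sub>M N) M fst. Q x" unfolding Y.distr_pair_fst by (rule assms)
  then show ?thesis by (rule AE_distrD[OF measurable_fst])
qed

lemma AE_lift_snd:
  assumes "AE y in N. Q y"
  shows "AE z in M \<Otimes>\<^sub>M N. Q (snd z)"
proof -
  have "AE y in distr (M \<Otimes>\<^sub>M N) N snd. Q y" unfolding distr_snd by (rule assms)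
  then show ?thesis by (rule AE_distrD[OF measurable_snd])
qed

text \<open>
  At almost every point of the rectangle \<open>BX \<times> BY\<close> the product law makes label \<open>i\<close> common to both letters
  with probability at least \<open>\<beta>X * \<beta>Y\<close>, so \<open>unshattered_weight_le\<close> applies there. Integrate.
\<close>
lemma unshattered_patterns_le:
  fixes S :: "'s set" and \<V> :: "('s \<Rightarrow> (nat set \<times> nat set) \<times> bool) set"
  assumes k: "k \<ge> 1" and F: "X.atom_densities k U F" and H: "Y.atom_densities k V H"
    and \<beta>X: "0 < \<beta>X" "\<beta>X \<le> 1" and \<beta>Y: "0 < \<beta>Y" "\<beta>Y \<le> 1"
    and BX: "BX \<in> sets M" "\<And>x i. x \<in> BX \<Longrightarrow> i < k \<Longrightarrow> \<beta>X \<le> local_density k F i x"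
    and BY: "BY \<in> sets N" "\<And>y i. y \<in> BY \<Longrightarrow> i < k \<Longrightarrow> \<beta>Y \<le> local_density k H i y"
    and S: "finite S" and \<V>: "\<V> \<subseteq> PiE S (\<lambda>_. (Pow {..<k} \<times> Pow {..<k}) \<times> UNIV)"
    and stars: "\<And>v. v \<in> \<V> \<Longrightarrow> card {s\<in>S. snd (v s)} \<le> t"
    and unsh: "\<And>I. I \<subseteq> S \<Longrightarrow> shattered (\<lambda>e i. i \<in> fst e \<inter> snd e) {..<k} \<V> I \<Longrightarrow> card I < d"
  shows "(\<Sum>v\<in>\<V>. (\<integral>x. indicator BX x * (\<Prod>s\<in>S. F (fst (fst (v s))) x) \<partial>M) *
      (\<integral>y. indicator BY y * (\<Prod>s\<in>S. H (snd (fst (v s))) y) \<partial>N))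
    \<le> (1 - \<beta>X * \<beta>Y / 2) ^ card S * (4 / (\<beta>X * \<beta>Y)) ^ (d + t)"
proof -
  define \<beta> where "\<beta> = \<beta>X * \<beta>Y"
  have \<beta>: "0 < \<beta>" "\<beta> \<le> 1" using \<beta>X \<beta>Y by (auto simp: \<beta>_def mult_le_one)
  define T where "T = Pow {..<k}"
  have finT: "finite T" by (simp add: T_def)
  have F0: "0 \<le> F c x" and H0: "0 \<le> H c y" if "c \<in> T" for c x y
    using F H that by (auto simp: X.atom_densities_def Y.atom_densities_def T_def)
  have vT: "fst (fst (v s)) \<in> T" "snd (fst (v s)) \<in> T" if "v \<in> \<V>" "s \<in> S" for v s
  proof -
    have "v s \<in> (T \<times> T) \<times> UNIV" using \<V> that by (auto simp: T_def PiE_iff)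
    then show "fst (fst (v s)) \<in> T" "snd (fst (v s)) \<in> T" by (simp_all add: mem_Times_iff)
  qed
  have fin\<V>: "finite \<V>"
    using \<V> by (rule finite_subset) (use S in \<open>intro finite_PiE, auto\<close>)
  define qX where "qX v x = indicator BX x * (\<Prod>s\<in>S. F (fst (fst (v s))) x)" for v :: "'s \<Rightarrow> (nat set \<times> nat set) \<times> bool" and x
  define qY where "qY v y = indicator BY y * (\<Prod>s\<in>S. H (snd (fst (v s))) y)" for v :: "'s \<Rightarrow> (nat set \<times> nat set) \<times> bool" and y
  have qX: "qX v \<in> borel_measurable M" "\<bar>qX v x\<bar> \<le> 1" and qY: "qY v \<in> borel_measurable N" "\<bar>qY v y\<bar> \<le> 1"
    if "v \<in> \<V>" for v x y
    unfolding qX_def qY_def using vT[OF that]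
    by (auto simp: T_def intro!: X.pattern_density[OF F BX(1)] Y.pattern_density[OF H BY(1)])
  define h where "h = (1 - \<beta> / 2) ^ card S * (4 / \<beta>) ^ (d + t)"
  have h0: "0 \<le> h" using \<beta> by (simp add: h_def)
  have le: "(\<Sum>v\<in>\<V>. qX v x * qY v y) \<le> h"
    if sX: "(\<Sum>c\<in>T. F c x) = 1" and sY: "(\<Sum>c\<in>T. H c y) = 1" for x y
  proof (cases "x \<in> BX \<and> y \<in> BY")
    case False
    then have "(\<Sum>v\<in>\<V>. qX v x * qY v y) = 0" by (intro sum.neutral) (auto simp: qX_def qY_def)
    then show ?thesis using h0 by simp
  next
    case True
    define p where "p e = F (fst e) x * H (snd e) y" for e
    have p0: "0 \<le> p e" if "e \<in> T \<times> T" for e using that F0 H0 by (auto simp: p_def)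
    have sum1: "sum p (T \<times> T) = 1"
    proof -
      have "sum p (T \<times> T) = (\<Sum>c\<in>T. F c x) * (\<Sum>c\<in>T. H c y)"
        by (simp add: p_def sum_product sum.cartesian_product case_prod_unfold)
      then show ?thesis using sX sY by simp
    qed
    have miss: "sum p {e \<in> T \<times> T. \<not> i \<in> fst e \<inter> snd e} \<le> 1 - \<beta>" if i: "i \<in> {..<k}" for i
    proof -
      let ?Ti = "{c \<in> T. i \<in> c}"
      have "sum p (?Ti \<times> ?Ti) = local_density k F i x * local_density k H i y"
        by (simp add: p_def sum_product sum.cartesian_product case_prod_unfold local_density_def T_def)
      also have "\<dots> \<ge> \<beta>X * \<beta>Y"
        using BX(2)[of x i] BY(2)[of y i] True i \<beta>X \<beta>Y by (intro mult_mono) auto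
      finally have 1: "\<beta> \<le> sum p (?Ti \<times> ?Ti)" by (simp add: \<beta>_def)
      have "{e \<in> T \<times> T. \<not> i \<in> fst e \<inter> snd e} = T \<times> T - ?Ti \<times> ?Ti" by auto
      then have "sum p {e \<in> T \<times> T. \<not> i \<in> fst e \<inter> snd e} = sum p (T \<times> T) - sum p (?Ti \<times> ?Ti)"
        using finT by (subst sum_diff[symmetric]) auto
      then show ?thesis using 1 sum1 by linarith
    qed
    have "(\<Sum>v\<in>\<V>. qX v x * qY v y) = (\<Sum>v\<in>\<V>. \<Prod>s\<in>S. p (fst (v s)))"
      using True by (simp add: qX_def qY_def p_def prod.distrib)
    also have "\<dots> \<le> h" unfolding h_def
    proof (rule unshattered_weight_le[where L="T \<times> T" and C="{..<k}" and R="\<lambda>e i. i \<in> fst e \<inter> snd e"])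
      show "\<V> \<subseteq> PiE S (\<lambda>_. (T \<times> T) \<times> UNIV)" using \<V> by (simp add: T_def)
    qed (use finT p0 sum1 miss \<beta> S stars unsh k in \<open>auto simp: lessThan_empty_iff\<close>)
    finally show ?thesis .
  qed
  have iq: "integrable (M \<Otimes>\<^sub>M N) (\<lambda>z. qX v (fst z) * qY v (snd z))" if "v \<in> \<V>" for v
  proof (rule P.integrable_bounded)
    note [measurable] = qX(1)[OF that] qY(1)[OF that]
    show "(\<lambda>z. qX v (fst z) * qY v (snd z)) \<in> borel_measurable (M \<Otimes>\<^sub>M N)" by measurable
    show "\<bar>qX v (fst z) * qY v (snd z)\<bar> \<le> 1 * 1" for z
      unfolding abs_mult using qX(2)[OF that] qY(2)[OF that] by (intro mult_mono) auto
  qed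
  have "(\<Sum>v\<in>\<V>. (\<integral>x. qX v x \<partial>M) * (\<integral>y. qY v y \<partial>N)) = (\<Sum>v\<in>\<V>. \<integral>z. qX v (fst z) * qY v (snd z) \<partial>(M \<Otimes>\<^sub>M N))"
    by (intro sum.cong refl integral_prod_bounded[symmetric, OF qX qY])
  also have "\<dots> = (\<integral>z. (\<Sum>v\<in>\<V>. qX v (fst z) * qY v (snd z)) \<partial>(M \<Otimes>\<^sub>M N))"
    using iq by (simp add: Bochner_Integration.integral_sum)
  also have "\<dots> \<le> (\<integral>z. h \<partial>(M \<Otimes>\<^sub>M N))"
  proof (rule integral_mono_AE)
    show "AE z in M \<Otimes>\<^sub>M N. (\<Sum>v\<in>\<V>. qX v (fst z) * qY v (snd z)) \<le> h"
      using AE_lift_fst[OF X.atom_densities_sum[OF F]] AE_lift_snd[OF Y.atom_densities_sum[OF H]]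
      by eventually_elim (rule le; simp add: T_def)
  qed (use iq in auto)
  also have "\<dots> = h" by (simp add: P.prob_space)
  finally show ?thesis by (simp add: qX_def qY_def h_def \<beta>_def)
qed

text \<open>
  Suppose that for some \<open>D\<close> all independence sets in \<open>S\<close> have fewer than \<open>m\<close> elements. To each point \<open>z\<close> of
  the rectangle belongs the word of its labels along \<open>S\<close>, starred at the positions \<open>s\<close> with
  \<open>z \<notin> D s\<close>. By Markov's inequality most points have few stars, and the words of these points
  shatter no set of \<open>m\<close> positions. By the previous lemma they have small total weight, and this
  weight is almost the measure of those points. That is a contradiction.
\<close>
lemma independence_density_Times:
  assumes k: "k \<ge> 1" and Us: "\<And>i. i < k \<Longrightarrow> U i \<in> sets M" and Vs: "\<And>i. i < k \<Longrightarrow> V i \<in> sets N"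
    and dU: "independence_density G M a k U" and dV: "independence_density G N b k V"
    and inf: "infinite (carrier G)"
    and \<rho>: "prob_space \<rho>" "space \<rho> = UNIV" "sets (M \<Otimes>\<^sub>M N) \<subseteq> sets \<rho>"
      "\<And>E. E \<in> sets (M \<Otimes>\<^sub>M N) \<Longrightarrow> measure \<rho> E = measure (M \<Otimes>\<^sub>M N) E"
  shows "independence_density G \<rho> (\<lambda>s. map_prod (a s) (b s)) k (\<lambda>i. U i \<times> V i)"
proof -
  interpret R: prob_space \<rho> by (rule \<rho>)
  obtain F where F: "X.atom_densities k U F" using X.atom_densities_exist[of k U] Us by blast
  obtain H where H: "Y.atom_densities k V H" using Y.atom_densities_exist[of k V] Vs by blast
  define BX where "BX \<beta> = {x. \<forall>i<k. \<beta> \<le> local_density k F i x}" for \<beta>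
  define BY where "BY \<beta> = {y. \<forall>i<k. \<beta> \<le> local_density k H i y}" for \<beta>
  obtain \<beta>X where \<beta>X: "0 < \<beta>X" "\<beta>X \<le> 1" and BXs: "BX \<beta>X \<in> sets M" and BX0: "measure M (BX \<beta>X) > 0"
    using X.independence_density_imp_uniform_overlap[OF k Us F dU] unfolding BX_def by blast
  obtain \<beta>Y where \<beta>Y: "0 < \<beta>Y" "\<beta>Y \<le> 1" and BYs: "BY \<beta>Y \<in> sets N" and BY0: "measure N (BY \<beta>Y) > 0"
    using Y.independence_density_imp_uniform_overlap[OF k Vs H dV] unfolding BY_def by blast
  define \<beta> where "\<beta> = \<beta>X * \<beta>Y"
  have \<beta>: "0 < \<beta>" "\<beta> \<le> 1" using \<beta>X \<beta>Y by (auto simp: \<beta>_def mult_le_one)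
  define \<kappa> where "\<kappa> = 1 - \<beta> / 2"
  have \<kappa>: "0 < \<kappa>" "\<kappa> < 1" using \<beta> by (auto simp: \<kappa>_def)
  define A where "A = 4 / \<beta>"
  have A: "A \<ge> 4" using \<beta> by (simp add: A_def field_simps)
  \<comment> \<open>With \<open>n = 4 * n0 * m\<close> positions, half of the decay \<open>\<kappa> ^ n\<close> pays for the factor \<open>A ^ (2 * m)\<close>.\<close>
  obtain n0 where n0: "\<kappa> ^ n0 < 1 / A" using real_arch_pow_inv[of "1/A" \<kappa>] A \<kappa> by auto
  have n0A: "\<kappa> ^ n0 * A \<le> 1" using n0 A by (simp add: field_simps)
  have n00: "n0 > 0" using n0 A by (cases n0) auto
  define q where "q = measure M (BX \<beta>X) * measure N (BY \<beta>Y)"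
  have q: "q > 0" using BX0 BY0 by (simp add: q_def)
  define \<delta> where "\<delta> = q / (16 * n0)"
  have \<delta>: "\<delta> > 0" using q n00 by (simp add: \<delta>_def)
  have "\<exists>S\<subseteq>carrier G. finite S \<and> real (card S) \<ge> M' \<and>
        (\<forall>D. (\<forall>s\<in>carrier G. D s \<in> sets \<rho> \<and> measure \<rho> (D s) \<ge> 1 - \<delta>) \<longrightarrow>
          (\<exists>I\<subseteq>S. (\<forall>\<sigma>\<in>I \<rightarrow> {..<k}. \<exists>z. \<forall>s\<in>I. z \<in> D s \<and> map_prod (a s) (b s) z \<in> U (\<sigma> s) \<times> V (\<sigma> s)) \<and>
            real (card I) \<ge> 1 / (4 * n0) * real (card S)))" if "M' > 0" for M' :: real
  proof -
    obtain m1 where m1: "\<kappa> ^ m1 < q / 4" using real_arch_pow_inv[of "q/4" \<kappa>] q \<kappa> by auto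
    define m where "m = Suc (max m1 (nat \<lceil>M'\<rceil>))"
    have m: "m > 0" "real m \<ge> M'" "m1 \<le> m" unfolding m_def by linarith+
    define n where "n = 4 * n0 * m"
    define E :: "((nat set \<times> nat set) \<times> bool) set" where "E = (Pow {..<k} \<times> Pow {..<k}) \<times> UNIV"
    have finE: "finite E" by (simp add: E_def)
    \<comment> \<open>The error has to remain small after summation over all words, of which there are at most \<open>card E ^ n\<close>.\<close>
    define e where "e = q / (8 * (real (card E ^ n) + 1))"
    have e: "e > 0" unfolding e_def using q by (intro divide_pos_pos mult_pos_pos add_nonneg_pos) auto
    obtain S where S: "S \<subseteq> carrier G" "finite S" "card S = n" and
      SX: "\<And>w. w \<in> S \<rightarrow> Pow {..<k} \<Longrightarrow>
        \<bar>measure M {x. x \<in> BX \<beta>X \<and> (\<forall>s\<in>S. label k U (a s x) = w s)} - (\<integral>x. indicator (BX \<beta>X) x * (\<Prod>s\<in>S. F (w s) x) \<partial>M)\<bar> < e"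
      and SY: "\<And>w. w \<in> S \<rightarrow> Pow {..<k} \<Longrightarrow>
        \<bar>measure N {y. y \<in> BY \<beta>Y \<and> (\<forall>s\<in>S. label k V (b s y) = w s)} - (\<integral>y. indicator (BY \<beta>Y) y * (\<Prod>s\<in>S. H (w s) y) \<partial>N)\<bar> < e"
      using common_translates[OF Us F Vs H BXs BYs inf e, of n] by blast
    have "\<exists>I\<subseteq>S. (\<forall>\<sigma>\<in>I \<rightarrow> {..<k}. \<exists>z. \<forall>s\<in>I. z \<in> D s \<and> map_prod (a s) (b s) z \<in> U (\<sigma> s) \<times> V (\<sigma> s)) \<and>
            real (card I) \<ge> 1 / (4 * n0) * real (card S)"
      if D: "\<forall>s\<in>carrier G. D s \<in> sets \<rho> \<and> measure \<rho> (D s) \<ge> 1 - \<delta>" for D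
    proof (rule ccontr)
      assume neg: "\<not> ?thesis"
      have cS: "1 / (4 * n0) * real (card S) = m" using n00 by (simp add: S(3) n_def)
      have small: "card I < m" if "I \<subseteq> S" "\<forall>\<sigma>\<in>I \<rightarrow> {..<k}. \<exists>z. \<forall>s\<in>I. z \<in> D s \<and> map_prod (a s) (b s) z \<in> U (\<sigma> s) \<times> V (\<sigma> s)" for I
        using neg that unfolding cS by (metis not_less of_nat_le_iff)
      have Ds: "D s \<in> sets \<rho>" "measure \<rho> (D s) \<ge> 1 - \<delta>" if "s \<in> S" for s using D S(1) that by auto
      define B where "B = BX \<beta>X \<times> BY \<beta>Y"
      have Bs: "B \<in> sets (M \<Otimes>\<^sub>M N)" unfolding B_def using BXs BYs by simp
      have rect: "measure \<rho> (A1 \<times> A2) = measure M A1 * measure N A2" if "A1 \<in> sets M" "A2 \<in> sets N" for A1 A2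
        using \<rho>(4)[of "A1 \<times> A2"] that
          by (simp add: measure_def Y.emeasure_pair_measure_Times enn2real_mult)
      have Bq: "measure \<rho> B = q" unfolding B_def q_def by (rule rect[OF BXs BYs])
      define v where "v z = (\<lambda>s\<in>S. ((label k U (a s (fst z)), label k V (b s (snd z))), z \<notin> D s))" for z
      define g where "g z = (\<Sum>s\<in>S. 1 - indicator (D s) z :: real)" for z
      have gcard: "g z = card {s\<in>S. z \<notin> D s}" for z
      proof -
        have "g z = (\<Sum>s\<in>S. if z \<notin> D s then 1 else 0)" unfolding g_def by (intro sum.cong) auto
        then show ?thesis using S(2) by (simp flip: sum.inter_filter)
      qed
      have g0: "0 \<le> g z" for z unfolding gcard by simp
      \<comment> \<open>The points of the rectangle with few stars.\<close>
      define Good where "Good = {z\<in>B. \<not> real m \<le> g z}"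
      define \<V> where "\<V> = v ` Good"
      define Pat where "Pat w = {x. x \<in> BX \<beta>X \<and> (\<forall>s\<in>S. label k U (a s x) = fst (fst (w s)))} \<times>
         {y. y \<in> BY \<beta>Y \<and> (\<forall>s\<in>S. label k V (b s y) = snd (fst (w s)))}" for w :: "'g \<Rightarrow> (nat set \<times> nat set) \<times> bool"
      have vE: "v z \<in> PiE S (\<lambda>_. E)" for z unfolding v_def E_def by (intro restrict_PiE_iff[THEN iffD2] ballI SigmaI label_in_Pow UNIV_I)
      have \<V>E: "\<V> \<subseteq> PiE S (\<lambda>_. E)" using vE by (auto simp: \<V>_def)
      have finPE: "finite (PiE S (\<lambda>_. E))" using S(2) finE by (intro finite_PiE) auto
      have fin\<V>: "finite \<V>" using \<V>E finPE by (rule finite_subset)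
      have card\<V>: "card \<V> \<le> card E ^ n"
        using card_mono[OF finPE \<V>E] S by (simp add: card_PiE)
      have stars: "card {s\<in>S. snd (w s)} \<le> m" if "w \<in> \<V>" for w
      proof -
        obtain z where z: "z \<in> Good" "w = v z" using \<open>w \<in> \<V>\<close> unfolding \<V>_def by (elim imageE)
        have "{s\<in>S. snd (w s)} = {s\<in>S. z \<notin> D s}" using z by (auto simp: v_def)
        then show ?thesis using z(1) gcard[of z] by (simp add: Good_def)
      qed
      have unsh: "card I < m" if I: "I \<subseteq> S" "shattered (\<lambda>e i. i \<in> fst e \<inter> snd e) {..<k} \<V> I" for I
      proof (rule small[OF I(1)], rule ballI)
        fix \<sigma> assume "\<sigma> \<in> I \<rightarrow> {..<k}"
        then obtain w where w: "w \<in> \<V>" "\<forall>s\<in>I. \<not> snd (w s) \<and> \<sigma> s \<in> fst (fst (w s)) \<inter> snd (fst (w s))"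
          using I(2) unfolding shattered_def by blast
        obtain z where z: "w = v z" using w(1) unfolding \<V>_def by (elim imageE)
        have "z \<in> D s \<and> map_prod (a s) (b s) z \<in> U (\<sigma> s) \<times> V (\<sigma> s)" if "s \<in> I" for s
          using w(2) that I(1) unfolding z by (cases z) (auto simp: v_def label_def subset_iff)
        then show "\<exists>z. \<forall>s\<in>I. z \<in> D s \<and> map_prod (a s) (b s) z \<in> U (\<sigma> s) \<times> V (\<sigma> s)" by blast
      qed
      define iX where "iX w = (\<integral>x. indicator (BX \<beta>X) x * (\<Prod>s\<in>S. F (fst (fst (w s))) x) \<partial>M)" for w :: "'g \<Rightarrow> (nat set \<times> nat set) \<times> bool"
      define iY where "iY w = (\<integral>y. indicator (BY \<beta>Y) y * (\<Prod>s\<in>S. H (snd (fst (w s))) y) \<partial>N)" for w :: "'g \<Rightarrow> (nat set \<times> nat set) \<times> bool"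
      have "(\<Sum>w\<in>\<V>. iX w * iY w) \<le> \<kappa> ^ card S * A ^ (m + m)"
        unfolding iX_def iY_def \<kappa>_def A_def \<beta>_def
        by (rule unshattered_patterns_le[OF k F H \<beta>X \<beta>Y BXs _ BYs _ S(2) \<V>E[unfolded E_def] stars unsh])
          (auto simp: BX_def BY_def)
      also have "\<dots> = (\<kappa> ^ n0 * A) ^ (2 * m) * \<kappa> ^ (2 * n0 * m)"
      proof -
        have "n = n0 * (2 * m) + 2 * n0 * m" by (simp add: n_def)
        then have "\<kappa> ^ n = (\<kappa> ^ n0) ^ (2 * m) * \<kappa> ^ (2 * n0 * m)" by (simp only: power_add power_mult)
        then show ?thesis by (simp add: S(3) power_mult_distrib mult_2)
      qed
      also have "\<dots> \<le> 1 * \<kappa> ^ m1"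
      proof (rule mult_mono)
        show "(\<kappa> ^ n0 * A) ^ (2 * m) \<le> 1" using n0A \<kappa> A by (intro power_le_one) auto
        have "m1 \<le> 2 * n0 * m" using m(3) n00 by (cases n0) auto
        then show "\<kappa> ^ (2 * n0 * m) \<le> \<kappa> ^ m1" using \<kappa> by (intro power_decreasing) auto
      qed (use \<kappa> in auto)
      finally have weight: "(\<Sum>w\<in>\<V>. iX w * iY w) < q / 4" using m1 by simp
      have patX: "{x. x \<in> BX \<beta>X \<and> (\<forall>s\<in>S. label k U (a s x) = w s)} \<in> sets M"
        and patY: "{y. y \<in> BY \<beta>Y \<and> (\<forall>s\<in>S. label k V (b s y) = w s)} \<in> sets N" if "w \<in> S \<rightarrow> Pow {..<k}" for w
        using that S(1,2) by (auto intro!: X.pattern_sets[OF Us BXs] Y.pattern_sets[OF Vs BYs])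
      have pat: "Pat w \<in> sets \<rho>" "measure \<rho> (Pat w) \<le> iX w * iY w + 2 * e" if "w \<in> \<V>" for w
      proof -
        have wE: "w s \<in> E" if "s \<in> S" for s using \<V>E \<open>w \<in> \<V>\<close> that by auto
        have w1: "(\<lambda>s. fst (fst (w s))) \<in> S \<rightarrow> Pow {..<k}" "(\<lambda>s. snd (fst (w s))) \<in> S \<rightarrow> Pow {..<k}"
          using wE by (fastforce simp: E_def mem_Times_iff)+
        show "Pat w \<in> sets \<rho>" unfolding Pat_def using patX[OF w1(1)] patY[OF w1(2)] \<rho>(3) by auto
        have "\<bar>iX w\<bar> \<le> 1" unfolding iX_def using w1(1) by (intro X.pattern_density(4)[OF F BXs]) auto
        then have "\<bar>measure \<rho> (Pat w) - iX w * iY w\<bar> \<le> 2 * e"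
          unfolding Pat_def rect[OF patX[OF w1(1)] patY[OF w1(2)]]
          using SX[OF w1(1)] SY[OF w1(2)] by (intro abs_mult_diff_le) (auto simp: iX_def iY_def)
        then show "measure \<rho> (Pat w) \<le> iX w * iY w + 2 * e" by linarith
      qed
      have gm[measurable]: "g \<in> borel_measurable \<rho>"
        unfolding g_def using Ds(1) by (intro borel_measurable_sum) auto
      have gint: "integrable \<rho> g"
        unfolding g_def using Ds(1) by (auto simp: R.emeasure_eq_measure)
      have "(\<integral>z. g z \<partial>\<rho>) = (\<Sum>s\<in>S. 1 - measure \<rho> (D s))"
        unfolding g_def using Ds(1) \<rho>(2) R.prob_space by (simp add: Bochner_Integration.integral_sum R.emeasure_eq_measure)
      also have "\<dots> \<le> (\<Sum>s\<in>S. \<delta>)" using Ds(2) by (intro sum_mono) (auto simp: algebra_simps)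
      finally have gI: "(\<integral>z. g z \<partial>\<rho>) \<le> n * \<delta>" by (simp add: S(3))
      have "measure \<rho> {z\<in>space \<rho>. real m \<le> g z} \<le> (\<integral>z. g z \<partial>\<rho>) / m"
        using gint m(1) by (intro integral_Markov_inequality_measure[where A="{}"]) (auto simp: g0)
      also have "\<dots> \<le> n * \<delta> / m" using gI m(1) by (intro divide_right_mono) auto
      also have "\<dots> = q / 4" using m(1) n00 by (simp add: n_def \<delta>_def)
      finally have bad: "measure \<rho> {z\<in>space \<rho>. real m \<le> g z} \<le> q / 4" .
      have Bs\<rho>[measurable]: "B \<in> sets \<rho>" using Bs \<rho>(3) by auto
      have Gs: "Good \<in> sets \<rho>"
      proof -
        have "Good = B \<inter> {z\<in>space \<rho>. \<not> real m \<le> g z}" using \<rho>(2) by (auto simp: Good_def)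
        also have "\<dots> \<in> sets \<rho>" by measurable
        finally show ?thesis .
      qed
      have "q = measure \<rho> B" by (simp add: Bq)
      also have "\<dots> \<le> measure \<rho> (Good \<union> {z\<in>space \<rho>. real m \<le> g z})"
      proof (rule R.finite_measure_mono)
        show "B \<subseteq> Good \<union> {z\<in>space \<rho>. real m \<le> g z}" using \<rho>(2) by (auto simp: Good_def)
        show "Good \<union> {z\<in>space \<rho>. real m \<le> g z} \<in> sets \<rho>" using Gs by measurable
      qed
      also have "\<dots> \<le> measure \<rho> Good + measure \<rho> {z\<in>space \<rho>. real m \<le> g z}"
        using Gs by (intro measure_Un_le) auto
      finally have 1: "q \<le> measure \<rho> Good + q / 4" using bad by linarith
      have "Good \<subseteq> (\<Union>w\<in>\<V>. Pat w)"
      proof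
        fix z assume z: "z \<in> Good"
        then have "z \<in> B" by (simp add: Good_def)
        then have "z \<in> Pat (v z)" by (cases z) (auto simp: Pat_def v_def B_def)
        then show "z \<in> (\<Union>w\<in>\<V>. Pat w)" using z by (auto simp: \<V>_def)
      qed
      then have "measure \<rho> Good \<le> measure \<rho> (\<Union>w\<in>\<V>. Pat w)"
        using pat(1) fin\<V> by (intro R.finite_measure_mono) auto
      also have "\<dots> \<le> (\<Sum>w\<in>\<V>. measure \<rho> (Pat w))"
        using pat(1) fin\<V> by (intro R.finite_measure_subadditive_finite) auto
      also have "\<dots> \<le> (\<Sum>w\<in>\<V>. iX w * iY w + 2 * e)" by (intro sum_mono pat(2))
      also have "\<dots> = (\<Sum>w\<in>\<V>. iX w * iY w) + card \<V> * (2 * e)" by (simp add: sum.distrib)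
      also have "card \<V> * (2 * e) \<le> q / 4"
      proof -
        have "real (card \<V>) \<le> real (card E ^ n) + 1" using card\<V> by (metis of_nat_le_iff add_increasing2 zero_le_one)
        then have "real (card \<V>) * (2 * e) \<le> (real (card E ^ n) + 1) * (2 * e)" using e by (intro mult_right_mono) auto
        also have "\<dots> = q / 4"
        proof -
          have "C * (2 * (q / (8 * C))) = q / 4" if "C > 0" for C :: real using that by simp
          moreover have "real (card E ^ n) + 1 > 0" by (intro add_nonneg_pos) auto
          ultimately show ?thesis unfolding e_def by blast
        qed
        finally show ?thesis .
      qed
      finally have "measure \<rho> Good < q / 4 + q / 4" using weight by linarith
      then show False using 1 q by linarith
    qed
    moreover have "real (card S) \<ge> M'"
    proof -
      have "m \<le> card S" using n00 by (simp add: S(3) n_def)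
      then show ?thesis using m(2) by linarith
    qed
    ultimately show ?thesis using S(1,2) by - (rule exI[of _ S], intro conjI allI impI)
  qed
  note main = this
  have c: "1 / real (4 * n0) > 0" using n00 by simp
  show ?thesis
    unfolding independence_density_def
    by (rule exI[of _ \<delta>], rule conjI[OF \<delta>], rule exI[of _ "1 / real (4 * n0)"], rule conjI[OF c],
        rule allI, rule impI, rule main)
qed

end

section \<open>The product formula\<close>

lemma mp_system_of_action:
  fixes \<mu> :: "'x::topological_space measure"
  assumes G: "group G" and act: "acts_by_homeomorphisms G \<phi>"
    and \<mu>: "regular_borel_prob \<mu>" and inv: "invariant_measure G \<phi> \<mu>"
  shows "mp_system \<mu> G \<phi>"
proof -
  interpret group G by fact
  interpret A: group_action G UNIV \<phi> using act by (simp add: acts_by_homeomorphisms_def)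
  have s\<mu>: "sets \<mu> = sets borel" and p: "prob_space \<mu>" using \<mu> by (auto simp: regular_borel_prob_def)
  have sp: "space \<mu> = UNIV" using sets_eq_imp_space_eq[OF s\<mu>] by simp
  have comp: "\<phi> (s \<otimes>\<^bsub>G\<^esub> t) x = \<phi> s (\<phi> t x)" if "s \<in> carrier G" "t \<in> carrier G" for s t x
    using A.composition_rule[OF UNIV_I that] .
  have one: "\<phi> \<one>\<^bsub>G\<^esub> x = x" for x using A.id_eq_one by (metis UNIV_I restrict_apply')
  have me: "\<phi> s \<in> \<mu> \<rightarrow>\<^sub>M \<mu>" if "s \<in> carrier G" for s
  proof -
    have "continuous_on UNIV (\<phi> s)"
      using act that by (auto simp: acts_by_homeomorphisms_def homeomorphism_def)
    then have "\<phi> s \<in> borel_measurable borel" by (rule borel_measurable_continuous_onI)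
    then show ?thesis by (simp add: measurable_cong_sets[OF s\<mu> s\<mu>])
  qed
  have di: "distr \<mu> \<mu> (\<phi> s) = \<mu>" if s: "s \<in> carrier G" for s
  proof (rule measure_eqI)
    fix A assume "A \<in> sets (distr \<mu> \<mu> (\<phi> s))"
    then have A: "A \<in> sets \<mu>" by simp
    have "\<phi> s -` A = \<phi> (inv\<^bsub>G\<^esub> s) ` A"
    proof (intro Set.set_eqI iffI)
      fix x assume "x \<in> \<phi> s -` A"
      moreover have "x = \<phi> (inv\<^bsub>G\<^esub> s) (\<phi> s x)" using comp[of "inv\<^bsub>G\<^esub> s" s x] s one by simp
      ultimately show "x \<in> \<phi> (inv\<^bsub>G\<^esub> s) ` A" by blast
    next
      fix x assume "x \<in> \<phi> (inv\<^bsub>G\<^esub> s) ` A"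
      then obtain y where "y \<in> A" "x = \<phi> (inv\<^bsub>G\<^esub> s) y" by blast
      then show "x \<in> \<phi> s -` A" using comp[of s "inv\<^bsub>G\<^esub> s" y] s one by simp
    qed
    then show "emeasure (distr \<mu> \<mu> (\<phi> s)) A = emeasure \<mu> A"
      using inv A s s\<mu> by (simp add: emeasure_distr[OF me[OF s]] sp invariant_measure_def)
  qed simp
  show ?thesis
    unfolding mp_system_def mp_system_axioms_def using p G sp me di comp one by auto
qed

lemma (in mp_system) image_inv_eq_vimage:
  assumes s: "s \<in> carrier G"
  shows "act (inv s) ` A = act s -` A"
proof (intro Set.set_eqI iffI)
  fix x assume "x \<in> act s -` A"
  moreover have "x = act (inv s) (act s x)" using act_mult[of "inv s" s x] s act_one by simp
  ultimately show "x \<in> act (inv s) ` A" by blast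
next
  fix x assume "x \<in> act (inv s) ` A"
  then obtain y where "y \<in> A" "x = act (inv s) y" by blast
  then show "x \<in> act s -` A" using act_mult[of s "inv s" y] s act_one by simp
qed

lemma large_borel_maps_iff:
  assumes "carrier G \<noteq> {}"
  shows "D \<in> large_borel_maps G \<mu> \<delta> \<longleftrightarrow> (\<forall>s\<in>carrier G. D s \<in> sets borel \<and> measure \<mu> (D s) \<ge> 1 - \<delta>)"
proof -
  have "bdd_below ((\<lambda>s. measure \<mu> (D s)) ` carrier G)" by (intro bdd_belowI[of _ 0]) auto
  then have "(INF s\<in>carrier G. measure \<mu> (D s)) \<ge> 1 - \<delta> \<longleftrightarrow> (\<forall>s\<in>carrier G. measure \<mu> (D s) \<ge> 1 - \<delta>)"
    using assms by (simp add: le_cINF_iff)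
  then show ?thesis by (auto simp: large_borel_maps_def Pi_iff)
qed

lemma independence_set_iff:
  fixes act :: "'g \<Rightarrow> 'x \<Rightarrow> 'x"
  assumes k: "length A \<ge> 1" and J: "J \<subseteq> carrier G" "finite J"
    and vim: "\<And>s A. s \<in> carrier G \<Longrightarrow> act (inv\<^bsub>G\<^esub> s) ` A = act s -` A"
  shows "independence_set G act A D J \<longleftrightarrow>
    (\<forall>\<sigma>\<in>J \<rightarrow> {..<length A}. \<exists>x. \<forall>s\<in>J. x \<in> D s \<and> act s x \<in> A ! \<sigma> s)"
proof
  assume ind: "independence_set G act A D J"
  show "\<forall>\<sigma>\<in>J \<rightarrow> {..<length A}. \<exists>x. \<forall>s\<in>J. x \<in> D s \<and> act s x \<in> A ! \<sigma> s"
  proof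
    fix \<sigma> assume \<sigma>: "\<sigma> \<in> J \<rightarrow> {..<length A}"
    show "\<exists>x. \<forall>s\<in>J. x \<in> D s \<and> act s x \<in> A ! \<sigma> s"
    proof (cases "J = {}")
      case False
      then have "(\<Inter>s\<in>J. D s \<inter> act (inv\<^bsub>G\<^esub> s) ` (A ! \<sigma> s)) \<noteq> {}"
        using ind J(2) \<sigma> by (auto simp: independence_set_def)
      then obtain x where "x \<in> (\<Inter>s\<in>J. D s \<inter> act (inv\<^bsub>G\<^esub> s) ` (A ! \<sigma> s))" by blast
      then have "x \<in> D s \<and> act s x \<in> A ! \<sigma> s" if "s \<in> J" for s
        using that J(1) vim[of s "A ! \<sigma> s"] by blast
      then show ?thesis by blast
    qed simp
  qed
next
  assume R: "\<forall>\<sigma>\<in>J \<rightarrow> {..<length A}. \<exists>x. \<forall>s\<in>J. x \<in> D s \<and> act s x \<in> A ! \<sigma> s"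
  show "independence_set G act A D J"
    unfolding independence_set_def
  proof (intro conjI J(1) allI impI, elim conjE)
    fix F \<sigma> assume F: "finite F" "F \<noteq> {}" "F \<subseteq> J" "\<sigma> \<in> F \<rightarrow> {..<length A}"
    define \<tau> where "\<tau> s = (if s \<in> F then \<sigma> s else 0)" for s
    have "\<tau> \<in> J \<rightarrow> {..<length A}" using F(4) k by (auto simp: \<tau>_def Pi_iff)
    then obtain x where x: "\<forall>s\<in>J. x \<in> D s \<and> act s x \<in> A ! \<tau> s" using R by blast
    have "x \<in> D s \<inter> act (inv\<^bsub>G\<^esub> s) ` (A ! \<sigma> s)" if "s \<in> F" for s
    proof -
      have "s \<in> J" using that F(3) by blast
      then have "x \<in> D s" "act s x \<in> A ! \<sigma> s" using x that by (auto simp: \<tau>_def)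
      then show ?thesis using vim[of s "A ! \<sigma> s"] \<open>s \<in> J\<close> J(1) by blast
    qed
    then show "(\<Inter>s\<in>F. D s \<inter> act (inv\<^bsub>G\<^esub> s) ` (A ! \<sigma> s)) \<noteq> {}" by blast
  qed
qed

text \<open>
  A labelling of a subset of \<open>I\<close> extends to \<open>I\<close>, so only labellings of all of \<open>I\<close> have to be realised.
\<close>
lemma positive_density_iff:
  fixes \<mu> :: "'x::topological_space measure"
  assumes k: "length A \<ge> 1" and G: "group G" and s\<mu>: "sets \<mu> = sets borel"
    and vim: "\<And>s A. s \<in> carrier G \<Longrightarrow> act (inv\<^bsub>G\<^esub> s) ` A = act s -` A"
  shows "positive_sequential_independence_density G act \<mu> A \<longleftrightarrow>
    independence_density G \<mu> act (length A) (\<lambda>i. A ! i)"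
proof -
  have ne: "carrier G \<noteq> {}" using group.is_monoid[OF G] monoid.carrier_not_empty by blast
  have eq: "(\<exists>I\<subseteq>F. independence_set G act A D I \<and> real (card I) \<ge> c * real (card F)) \<longleftrightarrow>
    (\<exists>I\<subseteq>F. (\<forall>\<sigma>\<in>I \<rightarrow> {..<length A}. \<exists>x. \<forall>s\<in>I. x \<in> D s \<and> act s x \<in> A ! \<sigma> s) \<and>
            real (card I) \<ge> c * real (card F))" if "F \<subseteq> carrier G" "finite F" for F D c
  proof (intro ex_cong1 conj_cong refl)
    fix I assume "I \<subseteq> F"
    then show "independence_set G act A D I \<longleftrightarrow>
      (\<forall>\<sigma>\<in>I \<rightarrow> {..<length A}. \<exists>x. \<forall>s\<in>I. x \<in> D s \<and> act s x \<in> A ! \<sigma> s)"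
      using that vim by (intro independence_set_iff[OF k]) (auto intro: finite_subset)
  qed
  have "(\<exists>F. F \<subseteq> carrier G \<and> finite F \<and> real (card F) \<ge> M \<and>
        (\<forall>D\<in>large_borel_maps G \<mu> \<delta>. \<exists>I\<subseteq>F. independence_set G act A D I \<and> real (card I) \<ge> c * real (card F))) \<longleftrightarrow>
    (\<exists>F\<subseteq>carrier G. finite F \<and> real (card F) \<ge> M \<and>
        (\<forall>D. (\<forall>s\<in>carrier G. D s \<in> sets \<mu> \<and> measure \<mu> (D s) \<ge> 1 - \<delta>) \<longrightarrow>
          (\<exists>I\<subseteq>F. (\<forall>\<sigma>\<in>I \<rightarrow> {..<length A}. \<exists>x. \<forall>s\<in>I. x \<in> D s \<and> act s x \<in> A ! \<sigma> s) \<and>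
            real (card I) \<ge> c * real (card F))))" for M \<delta> c
    unfolding Ball_def[of "large_borel_maps G \<mu> \<delta>"] large_borel_maps_iff[OF ne] s\<mu>
    by (intro ex_cong1 conj_cong refl all_cong1 imp_cong eq)
  then show ?thesis
    unfolding positive_sequential_independence_density_def independence_density_def by simp
qed

lemma independence_density_mono:
  assumes "independence_density G \<mu> act k U" "\<And>i. i < k \<Longrightarrow> U i \<subseteq> V i"
  shows "independence_density G \<mu> act k V"
proof -
  have grow: "\<forall>\<sigma>\<in>I \<rightarrow> {..<k}. \<exists>x. \<forall>s\<in>I. x \<in> D s \<and> act s x \<in> V (\<sigma> s)"
    if R: "\<forall>\<sigma>\<in>I \<rightarrow> {..<k}. \<exists>x. \<forall>s\<in>I. x \<in> D s \<and> act s x \<in> U (\<sigma> s)" for D I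
  proof
    fix \<sigma> assume \<sigma>: "\<sigma> \<in> I \<rightarrow> {..<k}"
    then obtain x where x: "\<forall>s\<in>I. x \<in> D s \<and> act s x \<in> U (\<sigma> s)" using R by blast
    have "x \<in> D s \<and> act s x \<in> V (\<sigma> s)" if "s \<in> I" for s
      using x that assms(2)[of "\<sigma> s"] \<sigma> by (auto simp: Pi_iff)
    then show "\<exists>x. \<forall>s\<in>I. x \<in> D s \<and> act s x \<in> V (\<sigma> s)" by blast
  qed
  show ?thesis
    using assms(1) unfolding independence_density_def
    by (elim ex_forward conj_forward all_forward imp_forward) (assumption | rule grow)+
qed

text \<open>
  Pull \<open>D\<close> back along \<open>\<pi>\<close>; a point found upstairs is mapped to a point with the required property.
\<close>
lemma independence_density_factor:
  assumes d: "independence_density G \<rho> act k (\<lambda>i. \<pi> -` U i)"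
    and \<pi>: "\<And>D. D \<in> sets \<mu> \<Longrightarrow> \<pi> -` D \<in> sets \<rho> \<and> measure \<rho> (\<pi> -` D) = measure \<mu> D"
    and eq: "\<And>s z. \<pi> (act s z) = act' s (\<pi> z)"
  shows "independence_density G \<mu> act' k U"
proof -
  obtain \<delta> c where dc: "\<delta> > 0" "c > 0" and ind: "\<And>M. M > 0 \<Longrightarrow> \<exists>F\<subseteq>carrier G. finite F \<and> real (card F) \<ge> M \<and>
        (\<forall>D. (\<forall>s\<in>carrier G. D s \<in> sets \<rho> \<and> measure \<rho> (D s) \<ge> 1 - \<delta>) \<longrightarrow>
          (\<exists>I\<subseteq>F. (\<forall>\<sigma>\<in>I \<rightarrow> {..<k}. \<exists>x. \<forall>s\<in>I. x \<in> D s \<and> act s x \<in> \<pi> -` U (\<sigma> s)) \<and>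
            real (card I) \<ge> c * real (card F)))"
    using d unfolding independence_density_def by metis
  have "\<exists>F\<subseteq>carrier G. finite F \<and> real (card F) \<ge> M \<and>
        (\<forall>D. (\<forall>s\<in>carrier G. D s \<in> sets \<mu> \<and> measure \<mu> (D s) \<ge> 1 - \<delta>) \<longrightarrow>
          (\<exists>I\<subseteq>F. (\<forall>\<sigma>\<in>I \<rightarrow> {..<k}. \<exists>x. \<forall>s\<in>I. x \<in> D s \<and> act' s x \<in> U (\<sigma> s)) \<and>
            real (card I) \<ge> c * real (card F)))" if M: "M > 0" for M
  proof -
    obtain F where F: "F \<subseteq> carrier G" "finite F" "real (card F) \<ge> M" and
      FD: "\<And>D. (\<forall>s\<in>carrier G. D s \<in> sets \<rho> \<and> measure \<rho> (D s) \<ge> 1 - \<delta>) \<Longrightarrow>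
          (\<exists>I\<subseteq>F. (\<forall>\<sigma>\<in>I \<rightarrow> {..<k}. \<exists>x. \<forall>s\<in>I. x \<in> D s \<and> act s x \<in> \<pi> -` U (\<sigma> s)) \<and>
            real (card I) \<ge> c * real (card F))"
      using ind[OF M] by blast
    have "\<exists>I\<subseteq>F. (\<forall>\<sigma>\<in>I \<rightarrow> {..<k}. \<exists>x. \<forall>s\<in>I. x \<in> D s \<and> act' s x \<in> U (\<sigma> s)) \<and>
            real (card I) \<ge> c * real (card F)"
      if D: "\<forall>s\<in>carrier G. D s \<in> sets \<mu> \<and> measure \<mu> (D s) \<ge> 1 - \<delta>" for D
    proof -
      obtain I where I: "I \<subseteq> F" "real (card I) \<ge> c * real (card F)"
        "\<And>\<sigma>. \<sigma> \<in> I \<rightarrow> {..<k} \<Longrightarrow> \<exists>z. \<forall>s\<in>I. z \<in> \<pi> -` D s \<and> act s z \<in> \<pi> -` U (\<sigma> s)"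
        using FD[of "\<lambda>s. \<pi> -` D s"] D \<pi> by (metis (no_types, lifting))
      have "\<exists>x. \<forall>s\<in>I. x \<in> D s \<and> act' s x \<in> U (\<sigma> s)" if "\<sigma> \<in> I \<rightarrow> {..<k}" for \<sigma>
        using I(3)[OF that] eq by (metis vimage_eq)
      then show ?thesis using I(1,2) by blast
    qed
    then show ?thesis using F by blast
  qed
  then show ?thesis unfolding independence_density_def using dc by blast
qed

text \<open>
  Neighbourhoods pull back along a continuous factor map, and their density upstairs is inherited below.
\<close>
lemma IN_tuples_factor:
  fixes \<rho> :: "'z::topological_space measure" and \<mu> :: "'x::topological_space measure" and \<pi> :: "'z \<Rightarrow> 'x"
  assumes zs: "zs \<in> IN_tuples G act \<rho> k" and k: "k \<ge> 1" and G: "group G"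
    and s: "sets \<rho> = sets borel" "sets \<mu> = sets borel"
    and vim: "\<And>s A. s \<in> carrier G \<Longrightarrow> act (inv\<^bsub>G\<^esub> s) ` A = act s -` A"
      "\<And>s A. s \<in> carrier G \<Longrightarrow> act' (inv\<^bsub>G\<^esub> s) ` A = act' s -` A"
    and cont: "continuous_on UNIV \<pi>"
    and \<pi>: "\<And>D. D \<in> sets \<mu> \<Longrightarrow> \<pi> -` D \<in> sets \<rho> \<and> measure \<rho> (\<pi> -` D) = measure \<mu> D"
    and eq: "\<And>s z. \<pi> (act s z) = act' s (\<pi> z)"
  shows "map \<pi> zs \<in> IN_tuples G act' \<mu> k"
proof -
  have len: "length zs = k" using zs by (simp add: IN_tuples_def)
  have "positive_sequential_independence_density G act' \<mu> Us"
    if Us: "length Us = k" "\<forall>i<k. map \<pi> zs ! i \<in> interior (Us ! i)" for Us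
  proof -
    let ?Ws = "map (\<lambda>U. \<pi> -` U) Us"
    have "zs ! i \<in> interior (?Ws ! i)" if i: "i < k" for i
    proof (rule interiorI)
      show "open (\<pi> -` interior (Us ! i))" using cont by (intro open_vimage open_interior)
      show "zs ! i \<in> \<pi> -` interior (Us ! i)" using Us i len by simp
      show "\<pi> -` interior (Us ! i) \<subseteq> ?Ws ! i" using i Us(1) interior_subset by auto
    qed
    then have "positive_sequential_independence_density G act \<rho> ?Ws"
      using zs Us(1) by (simp add: IN_tuples_def)
    then have "independence_density G \<rho> act k (\<lambda>i. ?Ws ! i)"
      using positive_density_iff[of ?Ws G \<rho> act] k G s(1) vim(1) Us(1) by simp
    then have "independence_density G \<rho> act k (\<lambda>i. \<pi> -` (Us ! i))"
      by (rule independence_density_mono) (simp add: Us)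
    then have "independence_density G \<mu> act' k (\<lambda>i. Us ! i)"
      using \<pi> eq by (rule independence_density_factor)
    then show ?thesis using positive_density_iff[of Us G \<mu> act'] k G s(2) vim(2) Us(1) by simp
  qed
  then show ?thesis using len by (simp add: IN_tuples_def)
qed

theorem theorem4p12:
  fixes G :: "('g, 'm) monoid_scheme"
    and \<phi> :: "'g \<Rightarrow> 'x::t2_space \<Rightarrow> 'x"
    and \<psi> :: "'g \<Rightarrow> 'y::t2_space \<Rightarrow> 'y"
    and \<mu> :: "'x measure"
    and \<nu> :: "'y measure"
    and k :: nat
  assumes "group G"
    and "compact (UNIV :: 'x set)"
    and "compact (UNIV :: 'y set)"
    and "acts_by_homeomorphisms G \<phi>"
    and "acts_by_homeomorphisms G \<psi>"
    and "regular_borel_prob \<mu>" and "invariant_measure G \<phi> \<mu>"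
    and "regular_borel_prob \<nu>" and "invariant_measure G \<psi> \<nu>"
    and "k \<ge> 1"
  shows "split_tuple ` IN_tuples G (diagonal_action \<phi> \<psi>) (regular_product \<mu> \<nu>) k =
         IN_tuples G \<phi> \<mu> k \<times> IN_tuples G \<psi> \<nu> k"
proof -
  define \<rho> where "\<rho> = regular_product \<mu> \<nu>"
  interpret X: mp_system \<mu> G \<phi> by (rule mp_system_of_action) fact+
  interpret Y: mp_system \<nu> G \<psi> by (rule mp_system_of_action) fact+
  interpret mp_system_pair \<mu> \<nu> G \<phi> \<psi> ..
  have s\<mu>: "sets \<mu> = sets borel" and s\<nu>: "sets \<nu> = sets borel"
    using assms(6,8) by (auto simp: regular_borel_prob_def)
  note rp = regular_product_extends[OF assms(2,3,6,8), folded \<rho>_def]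
  have p\<rho>: "prob_space \<rho>" and s\<rho>: "sets \<rho> = sets borel" using rp(1) by (auto simp: regular_borel_prob_def)
  have sp\<rho>: "space \<rho> = UNIV" using sets_eq_imp_space_eq[OF s\<rho>] by simp
  have s\<mu>\<nu>: "sets (\<mu> \<Otimes>\<^sub>M \<nu>) = sets (borel \<Otimes>\<^sub>M borel)" by (intro sets_pair_measure_cong s\<mu> s\<nu>)
  have sub: "sets (\<mu> \<Otimes>\<^sub>M \<nu>) \<subseteq> sets \<rho>" unfolding s\<mu>\<nu> s\<rho> by (rule borel_prod_subset)
  have m\<rho>: "measure \<rho> E = measure (\<mu> \<Otimes>\<^sub>M \<nu>) E" if "E \<in> sets (\<mu> \<Otimes>\<^sub>M \<nu>)" for E
    using rp(2)[OF that] by (simp add: measure_def)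
  have rect: "measure \<rho> (A \<times> B) = measure \<mu> A * measure \<nu> B" "A \<times> B \<in> sets \<rho>"
    if "A \<in> sets \<mu>" "B \<in> sets \<nu>" for A B
    using m\<rho>[of "A \<times> B"] sub that
    by (auto simp: measure_def Y.emeasure_pair_measure_Times enn2real_mult)
  have UX: "UNIV \<in> sets \<mu>" "measure \<mu> UNIV = 1" and UY: "UNIV \<in> sets \<nu>" "measure \<nu> UNIV = 1"
    using X.prob_space Y.prob_space by (simp_all add: X.space_UNIV Y.space_UNIV s\<mu> s\<nu>)
  have act: "diagonal_action \<phi> \<psi> = (\<lambda>s. map_prod (\<phi> s) (\<psi> s))" by (auto simp: diagonal_action_def)
  have dX: "positive_sequential_independence_density G \<phi> \<mu> A \<longleftrightarrow> independence_density G \<mu> \<phi> k (\<lambda>i. A ! i)"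
    if "length A = k" for A
    using positive_density_iff[of A G \<mu> \<phi>] that assms(1,10) s\<mu> X.image_inv_eq_vimage by simp
  have dY: "positive_sequential_independence_density G \<psi> \<nu> A \<longleftrightarrow> independence_density G \<nu> \<psi> k (\<lambda>i. A ! i)"
    if "length A = k" for A
    using positive_density_iff[of A G \<nu> \<psi>] that assms(1,10) s\<nu> Y.image_inv_eq_vimage by simp
  have dP: "positive_sequential_independence_density G (diagonal_action \<phi> \<psi>) \<rho> A \<longleftrightarrow>
      independence_density G \<rho> (\<lambda>s. map_prod (\<phi> s) (\<psi> s)) k (\<lambda>i. A ! i)"
    if "length A = k" for A
    unfolding act using positive_density_iff[of A G \<rho> "\<lambda>s. map_prod (\<phi> s) (\<psi> s)"] that assms(1,10) s\<rho> P.image_inv_eq_vimage by simp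
  show ?thesis unfolding \<rho>_def[symmetric]
  proof (intro Set.set_eqI iffI)
    fix p assume "p \<in> split_tuple ` IN_tuples G (diagonal_action \<phi> \<psi>) \<rho> k"
    then obtain zs where zs: "zs \<in> IN_tuples G (\<lambda>s. map_prod (\<phi> s) (\<psi> s)) \<rho> k" "p = (map fst zs, map snd zs)"
      unfolding act split_tuple_def by auto
    have "map fst zs \<in> IN_tuples G \<phi> \<mu> k"
    proof (rule IN_tuples_factor[OF zs(1) assms(10,1) s\<rho> s\<mu>])
      fix D assume "D \<in> sets \<mu>"
      moreover have "(fst -` D :: ('x \<times> 'y) set) = D \<times> UNIV" by auto
      ultimately show "(fst -` D :: ('x \<times> 'y) set) \<in> sets \<rho> \<and> measure \<rho> (fst -` D) = measure \<mu> D"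
        using rect[OF _ UY(1)] UY(2) by simp
    qed (simp_all add: P.image_inv_eq_vimage X.image_inv_eq_vimage continuous_on_fst)
    moreover have "map snd zs \<in> IN_tuples G \<psi> \<nu> k"
    proof (rule IN_tuples_factor[OF zs(1) assms(10,1) s\<rho> s\<nu>])
      fix D assume "D \<in> sets \<nu>"
      moreover have "(snd -` D :: ('x \<times> 'y) set) = UNIV \<times> D" by auto
      ultimately show "(snd -` D :: ('x \<times> 'y) set) \<in> sets \<rho> \<and> measure \<rho> (snd -` D) = measure \<nu> D"
        using rect[OF UX(1)] UX(2) by simp
    qed (simp_all add: P.image_inv_eq_vimage Y.image_inv_eq_vimage continuous_on_snd)
    ultimately show "p \<in> IN_tuples G \<phi> \<mu> k \<times> IN_tuples G \<psi> \<nu> k" by (simp add: zs(2))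
  next
    fix p assume "p \<in> IN_tuples G \<phi> \<mu> k \<times> IN_tuples G \<psi> \<nu> k"
    then obtain xs ys where p: "p = (xs, ys)" and xs: "xs \<in> IN_tuples G \<phi> \<mu> k" and ys: "ys \<in> IN_tuples G \<psi> \<nu> k"
      by auto
    have len: "length xs = k" "length ys = k" using xs ys by (auto simp: IN_tuples_def)
    have "zip xs ys \<in> IN_tuples G (diagonal_action \<phi> \<psi>) \<rho> k"
      unfolding IN_tuples_def
    proof (intro CollectI conjI allI impI, simp add: len, elim conjE)
      fix Ws :: "('x \<times> 'y) set list" assume Ws: "length Ws = k" "\<forall>i<k. zip xs ys ! i \<in> interior (Ws ! i)"
      have "\<exists>A B. open A \<and> open B \<and> xs ! i \<in> A \<and> ys ! i \<in> B \<and> A \<times> B \<subseteq> Ws ! i" if i: "i < k" for i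
      proof -
        have "(xs ! i, ys ! i) \<in> interior (Ws ! i)" using Ws(2) i len by simp
        then obtain A B where AB: "open A" "open B" "(xs ! i, ys ! i) \<in> A \<times> B" "A \<times> B \<subseteq> interior (Ws ! i)"
          by (rule open_prod_elim[OF open_interior])
        have "A \<times> B \<subseteq> Ws ! i" using AB(4) interior_subset by (rule subset_trans)
        then show ?thesis using AB(1-3) by (intro exI[of _ A] exI[of _ B]) simp
      qed
      then obtain U V where UV: "\<And>i. i < k \<Longrightarrow> open (U i)" "\<And>i. i < k \<Longrightarrow> open (V i)"
        "\<And>i. i < k \<Longrightarrow> xs ! i \<in> U i" "\<And>i. i < k \<Longrightarrow> ys ! i \<in> V i" "\<And>i. i < k \<Longrightarrow> U i \<times> V i \<subseteq> Ws ! i"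
        by metis
      have "independence_density G \<mu> \<phi> k (\<lambda>i. map U [0..<k] ! i)"
        using xs UV(1,3) dX[of "map U [0..<k]"] by (simp add: IN_tuples_def interior_open)
      then have dU: "independence_density G \<mu> \<phi> k U" by (rule independence_density_mono) simp
      have "independence_density G \<nu> \<psi> k (\<lambda>i. map V [0..<k] ! i)"
        using ys UV(2,4) dY[of "map V [0..<k]"] by (simp add: IN_tuples_def interior_open)
      then have dV: "independence_density G \<nu> \<psi> k V" by (rule independence_density_mono) simp
      \<comment> \<open>Density forces arbitrarily large finite subsets of \<open>G\<close>.\<close>
      have inf: "infinite (carrier G)"
      proof
        assume fin: "finite (carrier G)"
        obtain F where "F \<subseteq> carrier G" "real (card F) \<ge> real (card (carrier G)) + 1"
          using dU unfolding independence_density_def by (metis add_nonneg_pos of_nat_0_le_iff zero_less_one)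
        moreover from this(1) have "card F \<le> card (carrier G)" using fin by (intro card_mono)
        ultimately show False by linarith
      qed
      have "independence_density G \<rho> (\<lambda>s. map_prod (\<phi> s) (\<psi> s)) k (\<lambda>i. U i \<times> V i)"
        using UV(1,2) s\<mu> s\<nu>
        by (intro independence_density_Times[OF assms(10) _ _ dU dV inf p\<rho> sp\<rho> sub m\<rho>]) auto
      then have "independence_density G \<rho> (\<lambda>s. map_prod (\<phi> s) (\<psi> s)) k (\<lambda>i. Ws ! i)"
        by (rule independence_density_mono) (rule UV(5))
      then show "positive_sequential_independence_density G (diagonal_action \<phi> \<psi>) \<rho> Ws"
        using dP[OF Ws(1)] by simp
    qed
    moreover have "p = split_tuple (zip xs ys)" using len by (simp add: p split_tuple_def)
    ultimately show "p \<in> split_tuple ` IN_tuples G (diagonal_action \<phi> \<psi>) \<rho> k" by (rule rev_image_eqI)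
  qed
qed

end
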